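(* For any non-negative integer $N$ and all $\nu\neq 0$ with $-\frac{3\pi}{2}<\arg\nu<\frac{3\pi}{2}$, $$\mathbf{A}_{-\nu}(\nu) = \frac{1}{3\pi}\sum_{n=0}^{N-1} d_{2n}\frac{\Gamma\left(\frac{2n+1}{3}\right)}{\nu^{\frac{2n+1}{3}}} + R_N(\nu),$$ with $$d_{2n} = \frac{1}{(2n)!}\left[\frac{d^{2n}}{dt^{2n}}\left(\frac{t^3}{\sinh t - t}\right)^{\frac{2n+1}{3}}\right]_{t=0} = \frac{(-1)^n}{\Gamma\left(\frac{2n+1}{3}\right)}\int_0^{+\infty} t^{\frac{2n-2}{3}} e^{-2\pi t}\, iH^{(1)}_{it}(it)\,dt$$ (both expressions being equal for every integer $n\ge0$), and $$R_N(\nu) = \frac{(-1)^N}{3\pi\nu^{\frac{2N+1}{3}}}\int_0^{+\infty}\frac{t^{\frac{2N-2}{3}}e^{-2\pi t}}{1+(t/\nu)^{\frac{2}{3}}}\, iH^{(1)}_{it}(it)\,dt .$$ The cube roots are defined to be positive on the positive real line and are defined by analytic continuation elsewhere.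
   Context: The Anger--Weber function is defined by $\mathbf{A}_{-\nu}(z) = \frac{1}{\pi}\int_0^{+\infty} e^{\nu t - z\sinh t}\,dt$ for $|\arg z|<\frac{\pi}{2}$ and by analytic continuation in $z$ to the Riemann surface of the logarithm elsewhere; thus $\mathbf{A}_{-\nu}(\nu)=\frac1\pi\int_0^{+\infty}e^{-\nu(\sinh t-t)}dt$ for $|\arg\nu|<\frac{\pi}{2}$, and $\nu\mapsto\mathbf{A}_{-\nu}(\nu)$ for other values of $\arg\nu$ denotes the analytic continuation of this function on the Riemann surface of the logarithm. $H^{(1)}_\mu(z)$ is the Hankel function of the first kind of order $\mu$ (principal branch; here $\arg(it)=\frac{\pi}{2}$ for $t>0$). In the derivative formula, $\frac{t^3}{\sinh t-t}$ is taken with its removable singularity at $t=0$ removed (value $6$), and the fractional power is the one that is positive for real $t$. Empty sums are zero. *)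

theory Defs
  imports "HOL-Complex_Analysis.Complex_Analysis"
begin

text \<open>
  A point \<open>\<nu>\<close> of the Riemann surface of the logarithm is represented by its logarithm
  \<open>w = ln \<bar>\<nu>\<bar> + \<i> arg \<nu>\<close>, an arbitrary complex number: \<open>\<nu> = exp w\<close>, \<open>arg \<nu> = Im w\<close>.
\<close>

text \<open>The power \<open>\<nu>\<^sup>s\<close> on this surface; it is positive for \<open>arg \<nu> = 0\<close>.\<close>

definition log_powr :: "complex \<Rightarrow> real \<Rightarrow> complex" where
  "log_powr w s = exp (of_real s * w)"

text \<open>
  The analytic continuation to this surface of a function \<open>f\<close> given on \<open>Re \<nu> > 0\<close>, evaluated
  at the point with logarithm \<open>w\<close>. By the identity theorem the value does not depend on the
  choice of \<open>c\<close> and \<open>F\<close>. If \<open>f\<close> cannot be continued to a sector \<open>\<bar>arg \<nu>\<bar> < c\<close> containing the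
  point, the description denotes nothing and the value is unspecified.
\<close>

definition log_continuation :: "(complex \<Rightarrow> complex) \<Rightarrow> complex \<Rightarrow> complex" where
  "log_continuation f w =
     (THE v. \<exists>c F. pi / 2 \<le> c \<and> \<bar>Im w\<bar> < c \<and>
        F holomorphic_on {u. \<bar>Im u\<bar> < c} \<and>
        (\<forall>u. \<bar>Im u\<bar> < pi / 2 \<longrightarrow> F u = f (exp u)) \<and>
        v = F w)"

text \<open>\<open>\<^bold>A\<^sub>\<mu>(z)\<close> for \<open>Re z > 0\<close>.\<close>

definition anger_weber :: "complex \<Rightarrow> complex \<Rightarrow> complex" where
  "anger_weber \<mu> z =
     1 / of_real pi * (LINT t:{0<..}|lborel. exp (- \<mu> * of_real t - z * of_real (sinh t)))"

text \<open>\<open>\<^bold>A\<^sub>-\<^sub>\<nu>(\<nu>)\<close> on the Riemann surface of the logarithm, with \<open>w = log \<nu>\<close>.\<close>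

definition anger_weber_diag :: "complex \<Rightarrow> complex" where
  "anger_weber_diag w = log_continuation (\<lambda>\<nu>. anger_weber (- \<nu>) \<nu>) w"

definition bessel_J :: "complex \<Rightarrow> complex \<Rightarrow> complex" where
  "bessel_J \<mu> z =
     (z / 2) powr \<mu> *
     (\<Sum>k. (-1) ^ k * (z / 2) ^ (2 * k) * rGamma (\<mu> + of_nat k + 1) / fact k)"

definition hankel_H1 :: "complex \<Rightarrow> complex \<Rightarrow> complex" where
  "hankel_H1 \<mu> z =
     (let h = (\<lambda>\<kappa>. (bessel_J (- \<kappa>) z - exp (- of_real pi * \<i> * \<kappa>) * bessel_J \<kappa> z) /
                   (\<i> * sin (of_real pi * \<kappa>)))
      in if \<mu> \<in> \<int> then Lim (at \<mu>) h else h \<mu>)"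

text \<open>\<open>aw_coeff n\<close> is the coefficient \<open>d\<^sub>2\<^sub>n\<close>; the real \<open>powr\<close> has a positive base here.\<close>

definition aw_coeff :: "nat \<Rightarrow> real" where
  "aw_coeff n =
     1 / fact (2 * n) *
     (deriv ^^ (2 * n))
       (\<lambda>t::real. (if t = 0 then 6 else t ^ 3 / (sinh t - t)) powr ((2 * real n + 1) / 3)) 0"

definition aw_remainder :: "nat \<Rightarrow> complex \<Rightarrow> complex" where
  "aw_remainder N w =
     (-1) ^ N / (3 * of_real pi * log_powr w ((2 * real N + 1) / 3)) *
     (LINT t:{0<..}|lborel.
        of_real (t powr ((2 * real N - 2) / 3) * exp (- 2 * pi * t)) /
        (1 + log_powr (of_real (ln t) - w) (2 / 3)) *
        (\<i> * hankel_H1 (\<i> * of_real t) (\<i> * of_real t)))"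

end

theory Submission
  imports Defs
begin

text \<open>
  Up to a constant factor, \<open>e\<^bsup>-2\<pi>t\<^esup> i H\<^bsub>it\<^esub>(it)\<close> is the integral of \<open>exp (-t s(a))\<close> over real \<open>a\<close>, with
  \<open>s(a) = cosh a + i a + 3\<pi>/2 = -i (sinh z - z)\<close> at \<open>z = a - 3\<pi>i/2\<close>; this follows by expanding the
  integral into Bessel series. Let \<open>\<phi>\<close> be the odd holomorphic cube root of \<open>sinh z - z\<close> on
  \<open>\<bar>Im z\<bar> < 2\<pi>\<close>. The moments of the density reduce by Fubini to integrals of \<open>\<phi>\<^bsup>-(2n+1)\<^esup>\<close> over
  \<open>Im z = -3\<pi>/2\<close>. As the integrand is odd, each is half a rectangle contour integral, that is, a
  residue at \<open>0\<close>, and this residue is \<open>d\<^bsub>2n\<^esub>\<close>. The integral in \<open>R\<^sub>0(\<nu>)\<close>, for \<open>\<nu> > 0\<close>, becomes after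
  rotating the ray of integration a Laplace integral whose kernel is the integral of
  \<open>i\<phi> / (\<phi>(T)\<^sup>2 - \<phi>\<^sup>2)\<close> over the same line, with poles only at \<open>\<plusminus>T\<close>; the residues turn it into
  \<open>A\<^bsub>-\<nu>\<^esub>(\<nu>)\<close>. Since \<open>R\<^sub>0\<close> is holomorphic for \<open>\<bar>arg \<nu>\<bar> < 3\<pi>/2\<close>, it is the analytic continuation,
  and \<open>R\<^bsub>N\<^esub> - R\<^bsub>N+1\<^esub>\<close> is the \<open>N\<close>-th term of the expansion.
\<close>

section \<open>Parameter integrals and rotated Laplace integrals\<close>

text \<open>Rotating the ray by \<open>\<sigma>^3\<close>, where
  \<open>\<sigma> = \<i> \<phi>\<close>, gives integral powers of \<open>\<sigma>\<close> only on
  the right branch, that is, if \<open>\<bar>arg \<sigma>\<bar> < pi / 6\<close> along the whole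
  integration line. That \<open>\<sigma>^3 = s(a)\<close> has positive real part leaves three
  sectors for \<open>\<sigma>\<close>, so one must know in which quadrant \<open>\<phi>\<close>
  takes its values. This, the zero-freeness of \<open>sinh z - z\<close> off 0 and the position of
  the poles of the kernel all rest on one real inequality relating the real and imaginary parts of
  \<open>sinh z - z\<close>. The half-width \<open>2 pi\<close> of the strip leaves room around
  \<open>Im z = -3 pi / 2\<close>, while \<open>0 < y < 2 pi\<close> and \<open>sin y > 0\<close>
  still give \<open>y < pi\<close>.

  The Hankel function is given by power series in which no integral is visible. The integral is
  therefore cut at 0 and expanded into incomplete gamma functions at nonreal parameters; their lower
  parts cancel between the orders \<open>v\<close> and \<open>-v\<close>, and only Bessel series
  remain.\<close>

lemma dominated_holomorphic_diff_quotient_bound: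
  assumes holf: "f holomorphic_on ball z (2 * r)" and r: "r > 0"
    and bound: "\<And>u. u \<in> ball z (2 * r) \<Longrightarrow> norm (f u) \<le> B"
    and u: "u \<in> ball z r"
  shows "norm (f u - f z) \<le> B / r * norm (u - z)"
proof -
  have "norm (deriv f v) \<le> B / r" if v: "v \<in> ball z r" for v
  proof -
    have cball: "cball v r \<subseteq> ball z (2 * r)"
    proof
      fix x assume "x \<in> cball v r"
      then have "dist z x < r + r"
        using v dist_triangle[of z x v] by (auto simp: dist_commute)
      then show "x \<in> ball z (2 * r)" by simp
    qed
    have ballv: "ball v r \<subseteq> ball z (2 * r)" using cball by auto
    have "norm ((deriv ^^ 1) f v) \<le> fact 1 * B / r ^ 1"
    proof (rule Cauchy_inequality)
      show "f holomorphic_on ball v r" using holf ballv holomorphic_on_subset by blast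
      show "continuous_on (cball v r) f"
        using holf cball holomorphic_on_imp_continuous_on holomorphic_on_subset by blast
      show "norm (f x) \<le> B" if "norm (v - x) = r" for x
        using cball that by (intro bound) (auto simp: dist_norm)
    qed (use r in auto)
    then show ?thesis by simp
  qed
  moreover have "(f has_field_derivative deriv f v) (at v within ball z r)" if "v \<in> ball z r" for v
    by (rule has_field_derivative_at_within, rule holomorphic_derivI[OF holf]) (use that r in auto)
  ultimately show ?thesis
    using u r by (intro field_differentiable_bound[where S = "ball z r" and f' = "deriv f"]) auto
qed

text \<open>Domination of the integrand alone suffices: by the Cauchy estimate above, a bound
  \<open>g\<close> near \<open>z\<close> yields the bound \<open>g / r\<close> for the difference
  quotients, and dominated convergence differentiates under the integral.\<close>

lemma holomorphic_on_lebesgue_integral: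
  fixes f :: "complex \<Rightarrow> 'a \<Rightarrow> complex"
  assumes S: "open S"
    and meas: "\<And>z. z \<in> S \<Longrightarrow> f z \<in> borel_measurable M"
    and hol: "\<And>x. x \<in> space M \<Longrightarrow> (\<lambda>z. f z x) holomorphic_on S"
    and dom: "\<And>z. z \<in> S \<Longrightarrow> \<exists>U g. open U \<and> z \<in> U \<and> integrable M g \<and>
                (\<forall>u\<in>U \<inter> S. \<forall>x\<in>space M. norm (f u x) \<le> g x)"
  shows "(\<lambda>z. integral\<^sup>L M (f z)) holomorphic_on S"
  unfolding holomorphic_on_open[OF S]
proof
  fix z assume z: "z \<in> S"
  obtain U g where U: "open U" "z \<in> U" and g: "integrable M g"
    and fg: "\<And>u x. u \<in> U \<Longrightarrow> u \<in> S \<Longrightarrow> x \<in> space M \<Longrightarrow> norm (f u x) \<le> g x"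
    using dom[OF z] by blast
  obtain e where e: "e > 0" "ball z e \<subseteq> U \<inter> S"
    using U z S open_contains_ball[of "U \<inter> S"] by blast
  define r where "r = e / 2"
  have r: "r > 0" "ball z (2 * r) \<subseteq> U \<inter> S" using e by (auto simp: r_def)
  have zr: "ball z r \<subseteq> ball z (2 * r)" using r by (intro subset_ball) auto
  define D where "D = (\<lambda>x. deriv (\<lambda>z. f z x) z)"
  have int: "integrable M (f u)" if "u \<in> ball z (2 * r)" for u
    using that r by (intro Bochner_Integration.integrable_bound[OF g] meas AE_I2)
      (auto intro!: order_trans[OF fg abs_ge_self])
  have quot: "norm ((f u x - f z x) / (u - z)) \<le> g x / r"
    if "u \<in> ball z r" "u \<noteq> z" "x \<in> space M" for u x
  proof -
    have "norm (f u x - f z x) \<le> g x / r * norm (u - z)"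
    proof (rule dominated_holomorphic_diff_quotient_bound[where f = "\<lambda>z. f z x"])
      show "(\<lambda>z. f z x) holomorphic_on ball z (2 * r)"
        by (rule holomorphic_on_subset[OF hol[OF that(3)]]) (use r in blast)
      show "norm (f v x) \<le> g x" if "v \<in> ball z (2 * r)" for v
        using that r(2) \<open>x \<in> space M\<close> by (intro fg) blast+
    qed (use that r in auto)
    then show ?thesis using that r by (simp add: norm_divide divide_simps mult.commute)
  qed
  have lim: "((\<lambda>u. (f u x - f z x) / (u - z)) \<longlongrightarrow> D x) (at z)" if "x \<in> space M" for x
    using holomorphic_derivI[OF hol[OF that] S z] unfolding has_field_derivative_iff D_def .
  have "((\<lambda>u. (integral\<^sup>L M (f u) - integral\<^sup>L M (f z)) / (u - z)) \<longlongrightarrow> integral\<^sup>L M D) (at z)"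
    unfolding tendsto_at_iff_sequentially
  proof (intro allI impI)
    fix X assume X: "\<forall>i. X i \<in> UNIV - {z}" "X \<longlonglongrightarrow> z"
    have "eventually (\<lambda>i. X i \<in> ball z r) sequentially"
      using X(2) r by (intro topological_tendstoD) auto
    then obtain N where N: "\<And>i. i \<ge> N \<Longrightarrow> X i \<in> ball z r" by (auto simp: eventually_sequentially)
    \<comment> \<open>Only a tail of \<open>X\<close> lies in the ball where the difference
      quotients are dominated.\<close>
    define Y where "Y = (\<lambda>i. X (i + N))"
    have Y: "Y i \<in> ball z r" "Y i \<noteq> z" for i using N X by (auto simp: Y_def)
    have Ylim: "Y \<longlonglongrightarrow> z" unfolding Y_def using X(2) by (rule LIMSEQ_ignore_initial_segment)
    have fY: "f (Y i) \<in> borel_measurable M" "f z \<in> borel_measurable M" for i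
      using Y(1)[of i] zr r z by (auto intro!: meas)
    have "Y i \<in> ball z (2 * r)" for i using Y(1)[of i] zr by blast
    then have intY: "integrable M (f (Y i))" "integrable M (f z)" for i
      using int r by auto
    have lim': "(\<lambda>i. (f (Y i) x - f z x) / (Y i - z)) \<longlonglongrightarrow> D x" if "x \<in> space M" for x
      using lim[OF that] Y Ylim unfolding tendsto_at_iff_sequentially comp_def by blast
    have "(\<lambda>i. \<integral>x. (f (Y i) x - f z x) / (Y i - z) \<partial>M) \<longlonglongrightarrow> integral\<^sup>L M D"
    proof (rule integral_dominated_convergence)
      show "D \<in> borel_measurable M"
        by (rule borel_measurable_LIMSEQ_metric[OF _ lim']) (use fY in measurable)
      show "(\<lambda>x. (f (Y i) x - f z x) / (Y i - z)) \<in> borel_measurable M" for i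
        using fY by measurable
      show "integrable M (\<lambda>x. g x / r)" using g by simp
    qed (use lim' quot Y in auto)
    also have "(\<lambda>i. \<integral>x. (f (Y i) x - f z x) / (Y i - z) \<partial>M) =
        (\<lambda>i. (integral\<^sup>L M (f (Y i)) - integral\<^sup>L M (f z)) / (Y i - z))"
      using intY by simp
    finally show "((\<lambda>u. (integral\<^sup>L M (f u) - integral\<^sup>L M (f z)) / (u - z)) \<circ> X) \<longlonglongrightarrow> integral\<^sup>L M D"
      unfolding comp_def Y_def by (rule LIMSEQ_offset)
  qed
  then show "\<exists>f'. ((\<lambda>z. integral\<^sup>L M (f z)) has_field_derivative f') (at z)"
    unfolding has_field_derivative_iff by blast
qed

lemma holomorphic_on_set_lebesgue_integral:
  fixes f :: "complex \<Rightarrow> 'a \<Rightarrow> complex"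
  assumes S: "open S"
    and meas: "\<And>z. z \<in> S \<Longrightarrow> set_borel_measurable M A (f z)"
    and hol: "\<And>x. x \<in> A \<Longrightarrow> (\<lambda>z. f z x) holomorphic_on S"
    and dom: "\<And>z. z \<in> S \<Longrightarrow> \<exists>U g. open U \<and> z \<in> U \<and> set_integrable M A g \<and>
                (\<forall>u\<in>U \<inter> S. \<forall>x\<in>A. norm (f u x) \<le> g x)"
  shows "(\<lambda>z. LINT x:A|M. f z x) holomorphic_on S"
  unfolding set_lebesgue_integral_def
proof (rule holomorphic_on_lebesgue_integral[OF S])
  show "(\<lambda>z. indicator A x *\<^sub>R f z x) holomorphic_on S" for x
    using hol[of x] by (cases "x \<in> A") (auto intro: holomorphic_intros)
  show "\<exists>U g. open U \<and> z \<in> U \<and> integrable M g \<and>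
          (\<forall>u\<in>U \<inter> S. \<forall>x\<in>space M. norm (indicator A x *\<^sub>R f u x) \<le> g x)" if z: "z \<in> S" for z
  proof -
    obtain U g where "open U" "z \<in> U" "set_integrable M A g"
      and fg: "\<forall>u\<in>U \<inter> S. \<forall>x\<in>A. norm (f u x) \<le> g x" using dom[OF z] by blast
    moreover have "norm (indicator A x *\<^sub>R f u x) \<le> indicator A x *\<^sub>R g x" if "u \<in> U \<inter> S" for u x
      using fg that by (auto simp: indicator_def)
    ultimately show ?thesis unfolding set_integrable_def by blast
  qed
qed (use meas in \<open>auto simp: set_borel_measurable_def\<close>)

lemma open_strip: "open {z. \<bar>Im z\<bar> < c}" and convex_strip: "convex {z. \<bar>Im z\<bar> < c}"
proof -
  have strip: "{u. \<bar>Im u\<bar> < c} = {u. Im u < c} \<inter> {u. Im u > - c}" by auto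
  show "open {z. \<bar>Im z\<bar> < c}" "convex {z. \<bar>Im z\<bar> < c}" unfolding strip
    by (auto intro!: open_halfspace_Im_lt open_halfspace_Im_gt convex_Int convex_halfspace_Im_lt convex_halfspace_Im_gt)
qed

text \<open>In logarithmic coordinates a sector is a strip and the positive half-axis is the real
  line, which accumulates at 0. Every continuation below goes through this identity theorem, so
  formulas need checking for positive arguments only.\<close>

lemma holomorphic_strip_eqI:
  assumes "F holomorphic_on {u. \<bar>Im u\<bar> < c}" "G holomorphic_on {u. \<bar>Im u\<bar> < c}"
    and eq: "\<And>x. F (of_real x) = G (of_real x)" and w: "\<bar>Im w\<bar> < c"
  shows "F w = G w"
proof -
  have "(\<lambda>u. F u - G u) w = 0"
  proof (intro analytic_continuation[of "\<lambda>u. F u - G u" "{u. \<bar>Im u\<bar> < c}" \<real> 0 w])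
    show "0 islimpt (\<real> :: complex set)"
      unfolding islimpt_approachable
    proof (intro allI impI)
      fix e :: real assume "e > 0"
      then show "\<exists>x'\<in>\<real>. x' \<noteq> 0 \<and> dist x' (0::complex) < e"
        by (intro bexI[of _ "of_real (e / 2)"]) auto
    qed
  qed (use assms in \<open>auto intro!: holomorphic_intros open_strip convex_connected convex_strip simp: Reals_def\<close>)
  then show ?thesis by simp
qed

section \<open>Gamma integrals under scaling and continuation\<close>

lemma set_lebesgue_integral_Ioi_scale:
  fixes f :: "real \<Rightarrow> 'a :: {banach, second_countable_topology}"
  assumes c: "c > 0"
  shows "(LBINT x:{0<..}. f x) = c *\<^sub>R (LBINT x:{0<..}. f (c * x))"
proof -
  have "indicator {0<..} (c * x) = (indicator {0<..} x :: real)" for x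
    using c by (simp add: indicator_def zero_less_mult_iff)
  then show ?thesis
    unfolding set_lebesgue_integral_def
    using lborel_integral_real_affine[of c "\<lambda>x. indicator {0<..} x *\<^sub>R f x" 0] c by simp
qed

lemma set_integrable_Ioi_scale:
  fixes f :: "real \<Rightarrow> 'a :: {banach, second_countable_topology}"
  assumes c: "c > 0" and f: "set_integrable lborel {0<..} f"
  shows "set_integrable lborel {0<..} (\<lambda>x. f (c * x))"
proof -
  have "indicator {0<..} (c * x) = (indicator {0<..} x :: real)" for x
    using c by (simp add: indicator_def zero_less_mult_iff)
  then show ?thesis
    using lborel_integrable_real_affine[of "\<lambda>x. indicator {0<..} x *\<^sub>R f x" c 0] c f
    unfolding set_integrable_def by simp
qed

lemma Gamma_lebesgue_integral:
  assumes p: "p > (0::real)"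
  shows "set_integrable lborel {0<..} (\<lambda>t. t powr (p - 1) * exp (- t))" (is ?A)
    and "(LBINT t:{0<..}. t powr (p - 1) * exp (- t)) = Gamma p" (is ?B)
proof -
  have eq: "indicator {0..} t * t powr (p - 1) / exp t =
      indicator {0<..} t *\<^sub>R (t powr (p - 1) * exp (- t))" for t :: real
    by (auto simp: indicator_def exp_minus divide_inverse)
  have G: "Gamma p = nn_integral lborel (\<lambda>t. ennreal (indicator {0<..} t *\<^sub>R (t powr (p - 1) * exp (- t))))"
    using Gamma_conv_nn_integral_real[OF p] by (simp only: eq)
  show I: ?A
    unfolding set_integrable_def
    by (rule integrableI_nonneg) (use G[symmetric] in \<open>auto simp: indicator_def\<close>)
  have "ennreal (LBINT t:{0<..}. t powr (p - 1) * exp (- t)) = ennreal (Gamma p)"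
    unfolding G set_lebesgue_integral_def
    using I by (intro nn_integral_eq_integral[symmetric]) (auto simp: set_integrable_def)
  then show ?B
    using p unfolding set_lebesgue_integral_def
    by (subst (asm) ennreal_inj) (auto intro!: Bochner_Integration.integral_nonneg Gamma_real_nonneg)
qed

lemma Gamma_lebesgue_integral_scaled:
  assumes p: "p > (0::real)" and c: "c > 0"
  shows "set_integrable lborel {0<..} (\<lambda>t. t powr (p - 1) * exp (- c * t))" (is ?A)
    and "(LBINT t:{0<..}. t powr (p - 1) * exp (- c * t)) = Gamma p * c powr (- p)" (is ?B)
proof -
  have eq: "t powr (p - 1) * exp (- c * t) = c powr (1 - p) * ((c * t) powr (p - 1) * exp (- (c * t)))"
    if "t > 0" for t
    using c that by (simp add: powr_mult powr_diff)
  have "set_integrable lborel {0<..} (\<lambda>t. c powr (1 - p) * ((c * t) powr (p - 1) * exp (- (c * t))))"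
    using set_integrable_Ioi_scale[OF c Gamma_lebesgue_integral(1)[OF p]] by simp
  also have "?this \<longleftrightarrow> set_integrable lborel {0<..} (\<lambda>t. t powr (p - 1) * exp (- c * t))"
    by (intro set_integrable_cong refl eq[symmetric]) simp
  finally show ?A .
  have "(LBINT t:{0<..}. t powr (p - 1) * exp (- c * t)) =
      (LBINT t:{0<..}. c powr (1 - p) * ((c * t) powr (p - 1) * exp (- (c * t))))"
    by (intro set_lebesgue_integral_cong allI impI eq) simp_all
  also have "\<dots> = c powr (1 - p) * (LBINT t:{0<..}. (c * t) powr (p - 1) * exp (- (c * t)))"
    by (rule set_integral_mult_right)
  also have "(LBINT t:{0<..}. (c * t) powr (p - 1) * exp (- (c * t))) = Gamma p / c"
    using set_lebesgue_integral_Ioi_scale[OF c, of "\<lambda>t. t powr (p - 1) * exp (- t)"] c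
      Gamma_lebesgue_integral(2)[OF p] by (simp add: field_simps)
  also have "c powr (1 - p) * (Gamma p / c) = Gamma p * c powr (- p)"
    using c by (simp add: powr_diff powr_minus divide_simps)
  finally show ?B .
qed

lemma Re_exp_pos:
  assumes "\<bar>Im u\<bar> < pi / 2"
  shows "Re (exp u) > 0"
  using assms by (auto simp: Re_exp abs_less_iff intro!: mult_pos_pos cos_gt_zero_pi)

lemma exp_halfplane_neighbourhood:
  assumes "Re (exp (k * u)) > 0"
  shows "\<exists>\<delta>>0. \<exists>U. open U \<and> u \<in> U \<and> (\<forall>v\<in>U. Re (exp (k * v)) > \<delta>)"
proof (intro exI[of _ "Re (exp (k * u)) / 2"] exI[of _ "{v. Re (exp (k * v)) > Re (exp (k * u)) / 2}"] conjI ballI)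
  show "open {v. Re (exp (k * v)) > Re (exp (k * u)) / 2}"
    by (intro open_Collect_less continuous_intros)
qed (use assms in auto)

text \<open>Writing the rate as \<open>exp u\<close> makes its power \<open>exp (- p * u)\<close>
  entire, so no branch has to be chosen. Both sides are holomorphic in \<open>u\<close>, and for
  real \<open>u\<close> the claim is the scaled Gamma integral.\<close>

lemma Gamma_lebesgue_integral_exp:
  assumes p: "p > (0::real)" and u: "\<bar>Im u\<bar> < pi / 2"
  shows "set_integrable lborel {0<..} (\<lambda>t. of_real (t powr (p - 1)) * exp (- (exp u * of_real t)))" (is ?A)
    and "(LBINT t:{0<..}. of_real (t powr (p - 1)) * exp (- (exp u * of_real t))) =
           of_real (Gamma p) * exp (- of_real p * u)" (is ?B)
proof -
  have bound: "norm (of_real (t powr (p - 1)) * exp (- (exp v * of_real t))) \<le> t powr (p - 1) * exp (- c * t)"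
    if "Re (exp v) \<ge> c" "t > 0" for v c t
    using that by (auto simp: norm_mult intro!: mult_mono)
  show ?A
    by (rule set_integrable_bound[OF Gamma_lebesgue_integral_scaled(1)[OF p Re_exp_pos[OF u]]])
      (use bound[of "Re (exp u)" u] in \<open>auto simp: set_borel_measurable_def intro!: AE_I2\<close>)
  show ?B
  proof (rule holomorphic_strip_eqI[OF _ _ _ u])
    show "(\<lambda>u. LBINT t:{0<..}. of_real (t powr (p - 1)) * exp (- (exp u * of_real t)))
            holomorphic_on {u. \<bar>Im u\<bar> < pi / 2}"
    proof (rule holomorphic_on_set_lebesgue_integral)
      show "open {u. \<bar>Im u\<bar> < pi / 2}" by (intro open_Collect_less continuous_intros)
      fix z assume "z \<in> {u. \<bar>Im u\<bar> < pi / 2}"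
      then have "Re (exp (1 * z)) > 0" by (simp add: Re_exp_pos)
      then obtain \<delta> U where \<delta>: "\<delta> > 0" and U: "open U" "z \<in> U" "\<And>v. v \<in> U \<Longrightarrow> Re (exp v) > \<delta>"
        using exp_halfplane_neighbourhood[of 1 z] by auto
      have "norm (of_real (t powr (p - 1)) * exp (- (exp v * of_real t))) \<le>
          t powr (p - 1) * exp (- \<delta> * t)" if "v \<in> U" "t > 0" for v t
        by (rule bound[OF less_imp_le[OF U(3)[OF that(1)]] that(2)])
      then show "\<exists>U g. open U \<and> z \<in> U \<and> set_integrable lborel {0<..} g \<and>
          (\<forall>u\<in>U \<inter> {u. \<bar>Im u\<bar> < pi / 2}. \<forall>t\<in>{0<..}.
             norm (of_real (t powr (p - 1)) * exp (- (exp u * of_real t))) \<le> g t)"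
        using U(1,2) Gamma_lebesgue_integral_scaled(1)[OF p \<delta>]
        by (intro exI[of _ U] exI[of _ "\<lambda>t. t powr (p - 1) * exp (- \<delta> * t)"]) simp
    qed (auto simp: set_borel_measurable_def intro!: holomorphic_intros)
    show "(\<lambda>u. of_real (Gamma p) * exp (- of_real p * u)) holomorphic_on {u. \<bar>Im u\<bar> < pi / 2}"
      by (intro holomorphic_intros)
    fix x :: real
    have "(LBINT t:{0<..}. of_real (t powr (p - 1)) * exp (- (exp (complex_of_real x) * of_real t))) =
        (LBINT t:{0<..}. complex_of_real (t powr (p - 1) * exp (- exp x * t)))"
      by (simp only: of_real_mult of_real_minus exp_of_real mult_minus_left flip: exp_of_real)
    also have "\<dots> = of_real (Gamma p * exp x powr (- p))"
      using Gamma_lebesgue_integral_scaled(2)[OF p exp_gt_zero, of x]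
      by (simp only: set_integral_complex_of_real)
    also have "\<dots> = of_real (Gamma p) * exp (- of_real p * of_real x)"
    proof -
      have "exp x powr (- p) = exp (- p * x)" by (simp add: powr_def)
      then show ?thesis by (simp only: of_real_mult of_real_minus flip: exp_of_real)
    qed
    finally show "(LBINT t:{0<..}. of_real (t powr (p - 1)) * exp (- (exp (complex_of_real x) * of_real t))) =
        of_real (Gamma p) * exp (- of_real p * of_real x)" .
  qed
qed

text \<open>The case \<open>u = 3 * Ln \<sigma>\<close>: the half-angle \<open>pi / 6\<close> is
  what puts \<open>u\<close> into the strip of convergence, and the denominator 3 of the exponent
  turns the fractional power of \<open>\<sigma> ^ 3\<close> into an integral power of
  \<open>\<sigma>\<close>.\<close>

lemma Gamma_lebesgue_integral_cube:
  assumes \<sigma>: "\<sigma> \<noteq> 0" "\<bar>Im (Ln \<sigma>)\<bar> < pi / 6"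
  shows "(LBINT t:{0<..}. of_real (t powr ((2 * real n + 1) / 3 - 1)) * exp (- (\<sigma> ^ 3 * of_real t))) =
           of_real (Gamma ((2 * real n + 1) / 3)) / \<sigma> ^ (2 * n + 1)"
proof -
  have e1: "exp (of_nat 3 * Ln \<sigma>) = \<sigma> ^ 3"
    by (simp only: exp_of_nat_mult exp_Ln[OF \<sigma>(1)])
  have e2: "exp (of_nat (2 * n + 1) * Ln \<sigma>) = \<sigma> ^ (2 * n + 1)"
    by (simp only: exp_of_nat_mult exp_Ln[OF \<sigma>(1)])
  have "complex_of_real ((2 * real n + 1) / 3) * of_nat 3 = of_nat (2 * n + 1)"
    by simp
  then have e3: "- complex_of_real ((2 * real n + 1) / 3) * (of_nat 3 * Ln \<sigma>) = - (of_nat (2 * n + 1) * Ln \<sigma>)"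
    by (metis mult.assoc mult_minus_left)
  have im: "\<bar>Im (of_nat 3 * Ln \<sigma>)\<bar> < pi / 2" using \<sigma>(2) by simp
  have "(2 * real n + 1) / 3 > 0" by simp
  note Gamma_lebesgue_integral_exp(2)[OF this im, unfolded e1 e3 exp_minus e2]
  then show ?thesis by (simp only: divide_inverse exp_minus)
qed

section \<open>Rotating the ray of integration\<close>

lemma norm_square_le_norm_square_add:
  fixes z :: complex
  assumes "Re (z\<^sup>2) > 0" "r \<ge> 0"
  shows "(norm z)\<^sup>2 \<le> norm (z\<^sup>2 + of_real r)"
proof -
  have "(norm (z\<^sup>2))\<^sup>2 \<le> (norm (z\<^sup>2 + of_real r))\<^sup>2"
    unfolding cmod_power2 using assms by (auto intro!: add_mono power_mono)
  then have "norm (z\<^sup>2) \<le> norm (z\<^sup>2 + of_real r)"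
    by (rule power2_le_imp_le) simp
  then show ?thesis by (simp only: norm_power)
qed

text \<open>The substitution \<open>x \<mapsto> x / s ^ 3\<close> under the integral sign, Jacobian
  included. Real \<open>s\<close> is the case from which the rotation is continued
  analytically.\<close>

lemma Stieltjes_kernel_scale:
  assumes s: "s > 0" and x: "x > (0::real)"
  shows "(1 / s ^ 3) * ((1 / s ^ 3 * x) powr (-2/3) / (1 + (1 / s ^ 3 * x) powr (2/3)) * exp (- (s ^ 3 * (\<nu> * (1 / s ^ 3 * x))))) =
         x powr (-2/3) * exp (- \<nu> * x) * (s / (s\<^sup>2 + x powr (2/3)))"
proof -
  define q where "q = x powr (2/3)"
  have q: "q > 0" using x by (simp add: q_def)
  have "exp (2 * ln s) = s\<^sup>2" using s exp_of_nat_mult[of 2 "ln s"] by simp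
  moreover have "(1 / s ^ 3) powr (2/3) = exp (- (2 * ln s))"
    using s by (simp add: powr_def ln_div ln_realpow)
  ultimately have s3: "(1 / s ^ 3) powr (2/3) = 1 / s\<^sup>2"
    by (simp only: exp_minus inverse_eq_divide)
  have q1: "(1 / s ^ 3 * x) powr (2/3) = q / s\<^sup>2"
    using s x s3 by (subst powr_mult) (simp_all add: q_def)
  have q2: "(1 / s ^ 3 * x) powr (-2/3) = s\<^sup>2 / q"
    using q1 powr_minus_divide[of "1 / s ^ 3 * x" "2/3"] by simp
  have q3: "x powr (-2/3) = 1 / q"
    using powr_minus_divide[of x "2/3"] by (simp add: q_def)
  have e: "s ^ 3 * (\<nu> * (1 / s ^ 3 * x)) = \<nu> * x" using s by simp
  have "s\<^sup>2 + q > 0" using s q by (intro add_pos_pos) auto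
  then have k: "1 / s ^ 3 * (s\<^sup>2 / q / (1 + q / s\<^sup>2)) = 1 / q * (s / (s\<^sup>2 + q))"
    using s q by (simp add: field_simps power2_eq_square power3_eq_cube)
  have "(1 / s ^ 3) * (s\<^sup>2 / q / (1 + q / s\<^sup>2) * exp (- (\<nu> * x))) =
      (1 / s ^ 3 * (s\<^sup>2 / q / (1 + q / s\<^sup>2))) * exp (- (\<nu> * x))"
    by (simp only: mult.assoc)
  also have "\<dots> = 1 / q * exp (- \<nu> * x) * (s / (s\<^sup>2 + q))"
    unfolding k by simp
  finally show ?thesis
    unfolding q1 q2 q3 e q_def[symmetric] .
qed

text \<open>
  Substituting \<open>x \<mapsto> x / \<sigma>\<^sup>3\<close>, that is rotating the ray of integration, in the integral on the left.
\<close>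

lemma rotated_Stieltjes_integral:
  assumes \<nu>: "\<nu> > 0" and \<sigma>: "\<sigma> \<noteq> 0" "\<bar>Im (Ln \<sigma>)\<bar> < pi / 6"
  shows "(LBINT x:{0<..}. of_real (x powr (-2/3) / (1 + x powr (2/3))) * exp (- (\<sigma> ^ 3 * of_real (\<nu> * x)))) =
         (LBINT x:{0<..}. of_real (x powr (-2/3) * exp (- \<nu> * x)) * (\<sigma> / (\<sigma>\<^sup>2 + of_real (x powr (2/3)))))"
proof -
  let ?f = "\<lambda>(u::complex) x. of_real (x powr (-2/3) / (1 + x powr (2/3))) * exp (- (exp (3 * u) * of_real (\<nu> * x)))"
  let ?g = "\<lambda>(u::complex) x. of_real (x powr (-2/3) * exp (- \<nu> * x)) * (exp u / (exp (2 * u) + of_real (x powr (2/3))))"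
  \<comment> \<open>The width \<open>pi / 6\<close> keeps \<open>Re (exp (3 * u))\<close> positive,
    so the exponential in \<open>?f\<close> decays; \<open>Re (exp (2 * u))\<close> is then positive
    too, which keeps the denominator of \<open>?g\<close> away from 0.\<close>
  define S where "S = {u. \<bar>Im u\<bar> < pi / 6}"
  have S: "open S" unfolding S_def by (intro open_Collect_less continuous_intros)
  have dom: "set_integrable lborel {0<..} (\<lambda>x. x powr (-2/3) * exp (- c * x))" if "c > 0" for c :: real
    using Gamma_lebesgue_integral_scaled(1)[of "1/3" c] that by simp
  define F where "F = (\<lambda>u::complex. LBINT x:{0<..}. ?f u x)"
  define G where "G = (\<lambda>u::complex. LBINT x:{0<..}. ?g u x)"
  have Re2: "Re (exp (2 * u)) > 0" and Re3: "Re (exp (3 * u)) > 0" if "u \<in> S" for u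
    using that by (auto simp: S_def intro!: Re_exp_pos)
  have sq: "exp (2 * u) = (exp u)\<^sup>2" for u :: complex
    by (simp add: exp_double)
  have den: "norm (exp u / (exp (2 * u) + of_real r)) \<le> norm (exp (- u))" "exp (2 * u) + of_real r \<noteq> 0"
    if "u \<in> S" "r \<ge> 0" for u r
  proof -
    have *: "(norm (exp u))\<^sup>2 \<le> norm (exp (2 * u) + of_real r)"
      using norm_square_le_norm_square_add[of "exp u" r] that Re2[of u] by (simp add: sq)
    then show ne: "exp (2 * u) + of_real r \<noteq> 0"
      by (metis exp_not_eq_zero norm_eq_zero norm_zero power2_less_eq_zero_iff)
    have "norm (exp u / (exp (2 * u) + of_real r)) \<le> norm (exp u) / (norm (exp u))\<^sup>2"
      unfolding norm_divide using * ne by (intro divide_left_mono mult_pos_pos) auto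
    also have "\<dots> = norm (exp (- u))"
      by (simp add: exp_minus power2_eq_square norm_divide norm_inverse divide_simps)
    finally show "norm (exp u / (exp (2 * u) + of_real r)) \<le> norm (exp (- u))" .
  qed
  have "F (Ln \<sigma>) = G (Ln \<sigma>)"
  proof (rule holomorphic_strip_eqI[where c = "pi / 6" and F = F and G = G and w = "Ln \<sigma>"])
    show "F holomorphic_on {u. \<bar>Im u\<bar> < pi / 6}"
      unfolding F_def S_def[symmetric]
    proof (rule holomorphic_on_set_lebesgue_integral[OF S])
      fix z assume "z \<in> S"
      then have "Re (exp (3 * z)) > 0" by (rule Re3)
      then obtain \<delta> U where \<delta>: "\<delta> > 0" and U: "open U" "z \<in> U" "\<And>v. v \<in> U \<Longrightarrow> Re (exp (3 * v)) > \<delta>"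
        using exp_halfplane_neighbourhood[of 3 z] by auto
      have "norm (?f u x) \<le>
          x powr (-2/3) * exp (- (\<delta> * \<nu>) * x)" if "u \<in> U" "x > 0" for u x
      proof -
        have "x powr (-2/3) / (1 + x powr (2/3)) \<le> x powr (-2/3) / 1"
          by (intro divide_left_mono) (auto intro: add_pos_nonneg)
        moreover have "\<delta> * (\<nu> * x) \<le> Re (exp (3 * u)) * (\<nu> * x)"
          using U(3)[OF that(1)] that \<nu> by (intro mult_right_mono) auto
        ultimately show ?thesis
          unfolding norm_mult norm_of_real norm_exp_eq_Re using that \<nu>
          by (intro mult_mono) (auto simp: mult.assoc)
      qed
      then show "\<exists>U g. open U \<and> z \<in> U \<and> set_integrable lborel {0<..} g \<and> (\<forall>u\<in>U \<inter> S. \<forall>x\<in>{0<..}.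
          norm (?f u x) \<le> g x)"
        using U dom[of "\<delta> * \<nu>"] \<delta> \<nu> by (intro exI[of _ U] exI[of _ "\<lambda>x. x powr (-2/3) * exp (- (\<delta> * \<nu>) * x)"]) auto
    qed (auto simp: set_borel_measurable_def intro!: holomorphic_intros)
    show "G holomorphic_on {u. \<bar>Im u\<bar> < pi / 6}"
      unfolding G_def S_def[symmetric]
    proof (rule holomorphic_on_set_lebesgue_integral[OF S])
      fix z assume z: "z \<in> S"
      define U where "U = {v::complex. norm (exp (- v)) < norm (exp (- z)) + 1}"
      have "open U" unfolding U_def by (intro open_Collect_less continuous_intros)
      moreover have "norm (?g u x) \<le>
          x powr (-2/3) * exp (- \<nu> * x) * (norm (exp (- z)) + 1)" if "u \<in> U" "u \<in> S" for u x
        unfolding norm_mult norm_of_real using den(1)[OF that(2), of "x powr (2/3)"] that(1)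
        by (intro mult_mono) (auto simp: U_def abs_mult)
      ultimately show "\<exists>U g. open U \<and> z \<in> U \<and> set_integrable lborel {0<..} g \<and> (\<forall>u\<in>U \<inter> S. \<forall>x\<in>{0<..}.
          norm (?g u x) \<le> g x)"
        using dom[OF \<nu>]
        by (intro exI[of _ U] exI[of _ "\<lambda>x. x powr (-2/3) * exp (- \<nu> * x) * (norm (exp (- z)) + 1)"])
          (auto simp: U_def)
    next
      show "(\<lambda>u. ?g u x) holomorphic_on S" if "x \<in> {0<..}" for x
        using den(2) by (intro holomorphic_intros) simp_all
    qed (simp add: set_borel_measurable_def)
    fix y :: real
    define s where "s = exp y"
    have s: "s > 0" by (simp add: s_def)
    have e3: "exp (3 * complex_of_real y) = of_real (s ^ 3)"
      using exp_of_nat_mult[of 3 "complex_of_real y"] by (simp add: s_def exp_of_real)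
    have e2: "exp (2 * complex_of_real y) = of_real (s\<^sup>2)"
      using exp_of_nat_mult[of 2 "complex_of_real y"] by (simp add: s_def exp_of_real)
    have e1: "exp (complex_of_real y) = of_real s" by (simp add: s_def exp_of_real)
    have ex: "exp (- (complex_of_real a * of_real b)) = of_real (exp (- (a * b)))" for a b
      by (simp only: exp_of_real[symmetric] of_real_mult of_real_minus)
    have "F (of_real y) = (LBINT x:{0<..}. of_real (x powr (-2/3) / (1 + x powr (2/3)) * exp (- (s ^ 3 * (\<nu> * x)))))"
      unfolding F_def e3 ex by (simp only: of_real_mult)
    also have "\<dots> = (1 / s ^ 3) *\<^sub>R (LBINT x:{0<..}. complex_of_real (((1 / s ^ 3) * x) powr (-2/3) / (1 + ((1 / s ^ 3) * x) powr (2/3)) * exp (- (s ^ 3 * (\<nu> * ((1 / s ^ 3) * x))))))"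
      using s by (subst set_lebesgue_integral_Ioi_scale[of "1 / s ^ 3"]) auto
    also have "\<dots> = (LBINT x:{0<..}. complex_of_real ((1 / s ^ 3) * (((1 / s ^ 3) * x) powr (-2/3) / (1 + ((1 / s ^ 3) * x) powr (2/3)) * exp (- (s ^ 3 * (\<nu> * ((1 / s ^ 3) * x)))))))"
      by (simp only: scaleR_conv_of_real of_real_mult set_integral_mult_right)
    also have "\<dots> = (LBINT x:{0<..}. complex_of_real (x powr (-2/3) * exp (- \<nu> * x) * (s / (s\<^sup>2 + x powr (2/3)))))"
    proof (rule set_lebesgue_integral_cong, simp, intro allI impI)
      fix x :: real assume "x \<in> {0<..}"
      then show "complex_of_real ((1 / s ^ 3) * ((1 / s ^ 3 * x) powr (-2/3) / (1 + (1 / s ^ 3 * x) powr (2/3)) * exp (- (s ^ 3 * (\<nu> * (1 / s ^ 3 * x)))))) =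
          complex_of_real (x powr (-2/3) * exp (- \<nu> * x) * (s / (s\<^sup>2 + x powr (2/3))))"
        using Stieltjes_kernel_scale[OF s, of x \<nu>] by simp
    qed
    also have "\<dots> = G (of_real y)"
      unfolding G_def e1 e2 by (simp only: of_real_mult of_real_add of_real_divide)
    finally show "F (of_real y) = G (of_real y)" .
  qed (rule \<sigma>(2))
  moreover have "exp (3 * Ln \<sigma>) = \<sigma> ^ 3" "exp (2 * Ln \<sigma>) = \<sigma>\<^sup>2"
    using exp_of_nat_mult[of 3 "Ln \<sigma>"] exp_of_nat_mult[of 2 "Ln \<sigma>"] \<sigma>(1) by (simp_all only: exp_Ln of_nat_numeral not_False_eq_True)
  ultimately show ?thesis
    unfolding F_def G_def by (simp only: exp_Ln[OF \<sigma>(1)])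
qed

section \<open>The Hankel function as an integral\<close>

lemma set_integrable_lborel_of_lebesgue:
  fixes f :: "real \<Rightarrow> 'a :: euclidean_space"
  assumes "f absolutely_integrable_on S" "set_borel_measurable lborel S f"
  shows "set_integrable lborel S f" "(LBINT x:S. f x) = integral S f" (is ?A)
proof -
  show "set_integrable lborel S f"
    using assms unfolding set_integrable_def set_borel_measurable_def
    by (subst (asm) integrable_completion) auto
  then show ?A
    by (rule set_borel_integral_eq_integral)
qed

lemma exp_lebesgue_integral:
  assumes c: "Re c > 0"
  shows "set_integrable lborel {0<..} (\<lambda>t. exp (- (c * of_real t)))" (is ?A)
    and "(LBINT t:{0<..}. exp (- (c * of_real t))) = 1 / c" (is ?B)
proof -
  have "c \<noteq> 0" using c by auto
  then have e: "exp (Ln c) = c" by simp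
  have "\<bar>Im (Ln c)\<bar> < pi / 2" using c \<open>c \<noteq> 0\<close> Re_Ln_pos_lt by blast
  note G = Gamma_lebesgue_integral_exp[OF zero_less_one this, unfolded e]
  have eq: "of_real (t powr (1 - 1)) * exp (- (c * of_real t)) = exp (- (c * of_real t))"
    if "t \<in> {0<..}" for t
    using that by simp
  have "set_integrable lborel {0<..} (\<lambda>t. of_real (t powr (1 - 1)) * exp (- (c * of_real t))) \<longleftrightarrow>
      set_integrable lborel {0<..} (\<lambda>t. exp (- (c * of_real t)))"
    by (intro set_integrable_cong refl eq)
  then show ?A
    using G(1) by blast
  have "(LBINT t:{0<..}. exp (- (c * of_real t))) =
      (LBINT t:{0<..}. of_real (t powr (1 - 1)) * exp (- (c * of_real t)))"
    by (intro set_lebesgue_integral_cong allI impI eq[symmetric]) auto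
  also have "\<dots> = exp (- Ln c)" unfolding G(2) by simp
  also have "\<dots> = 1 / c" using e by (simp add: exp_minus inverse_eq_divide)
  finally show ?B .
qed

lemma integral_split_reflect:
  fixes f :: "real \<Rightarrow> 'a :: {banach, second_countable_topology}"
  assumes f: "integrable lborel f"
  shows "integral\<^sup>L lborel f = (LBINT x:{0<..}. f x) + (LBINT x:{0<..}. f (- x))"
proof -
  have int: "set_integrable lborel {0<..} f" "set_integrable lborel {..<0} f"
    using f unfolding set_integrable_def by (auto intro: integrable_mult_indicator)
  have "integral\<^sup>L lborel f = (LINT x:{0<..} \<union> {..<0}|lborel. f x)"
    unfolding set_lebesgue_integral_def
  proof (intro integral_cong_AE)
    have "AE x in lborel. x \<noteq> (0::real)" by (rule AE_lborel_singleton)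
    then show "AE x in lborel. f x = indicat_real ({0<..} \<union> {..<0}) x *\<^sub>R f x"
      by eventually_elim (auto simp: indicator_def)
  qed (use f in auto)
  also have "\<dots> = (LBINT x:{0<..}. f x) + (LBINT x:{..<0}. f x)"
    by (intro set_integral_Un int) auto
  also have "(LBINT x:{..<0}. f x) = (LBINT x:{0<..}. f (- x))"
    unfolding set_lebesgue_integral_def
    by (subst lborel_integral_real_affine[where c = "-1" and t = 0])
      (auto intro!: Bochner_Integration.integral_cong simp: indicator_def)
  finally show ?thesis .
qed

section \<open>Incomplete gamma functions at nonreal parameters\<close>

text \<open>With \<open>t = y * exp u\<close> this is \<open>y^(-s)\<close> times the upper
  incomplete gamma function \<open>\<Gamma>(s, y)\<close>.\<close>

definition exp_exp_integral :: "real \<Rightarrow> complex \<Rightarrow> complex" where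
  "exp_exp_integral y s = (LBINT u:{0<..}. exp (- of_real (y * exp u) + s * of_real u))"

text \<open>The series of \<open>y^(-s)\<close> times the lower incomplete gamma function; as a
  series it also makes sense for \<open>Re s \<le> 0\<close>, away from the poles
  \<open>s = -j\<close>.\<close>

definition lower_gamma_sum :: "real \<Rightarrow> complex \<Rightarrow> complex" where
  "lower_gamma_sum y s = (\<Sum>j. of_real ((- y) ^ j / fact j) / (s + of_nat j))"

text \<open>Completing the square after \<open>exp u \<ge> u^2 / 2\<close>. Working with
  \<open>c + 1\<close> leaves a spare factor \<open>exp (- u)\<close>, hence integrability for every
  rate \<open>c\<close>.\<close>

lemma exp_exp_bound:
  assumes y: "y > 0" and u: "u > 0"
  shows "exp (- (y * exp u) + c * u) \<le> exp ((c + 1)\<^sup>2 / (2 * y)) * exp (- (1 * u :: real))"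
proof -
  have "y * exp u \<ge> y * (u\<^sup>2 / 2)"
    using exp_lower_Taylor_quadratic[of u] y u by (intro mult_left_mono) auto
  moreover have "(c + 1) * u \<le> y * (u\<^sup>2 / 2) + (c + 1)\<^sup>2 / (2 * y)"
  proof -
    have "0 \<le> y / 2 * (u - (c + 1) / y)\<^sup>2" using y by simp
    also have "\<dots> = y * (u\<^sup>2 / 2) + (c + 1)\<^sup>2 / (2 * y) - (c + 1) * u"
      using y by (simp add: power2_eq_square field_simps)
    finally show ?thesis by simp
  qed
  ultimately have "- (y * exp u) + c * u \<le> (c + 1)\<^sup>2 / (2 * y) + - (1 * u)"
    by (simp add: algebra_simps)
  then show ?thesis unfolding exp_add[symmetric] by simp
qed

lemma norm_exp_exp: "norm (exp (- of_real (y * exp u) + s * of_real u)) = exp (- (y * exp u) + Re s * u)"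
  by simp

lemma set_integrable_exp_exp:
  assumes y: "y > 0"
  shows "set_integrable lborel {0<..} (\<lambda>u. exp (- of_real (y * exp u) + (s::complex) * of_real u))"
proof (rule set_integrable_bound)
  show "set_integrable lborel {0<..} (\<lambda>u. of_real (exp ((Re s + 1)\<^sup>2 / (2 * y))) * exp (- (1 * complex_of_real u)))"
    by (intro set_integrable_mult_right exp_lebesgue_integral(1)) auto
  show "AE u in lborel. u \<in> {0<..} \<longrightarrow> norm (exp (- of_real (y * exp u) + s * of_real u)) \<le>
      norm (of_real (exp ((Re s + 1)\<^sup>2 / (2 * y))) * exp (- (1 * complex_of_real u)))"
  proof (intro AE_I2 impI)
    fix u :: real assume "u \<in> {0<..}"
    then show "norm (exp (- of_real (y * exp u) + s * of_real u)) \<le>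
      norm (of_real (exp ((Re s + 1)\<^sup>2 / (2 * y))) * exp (- (1 * complex_of_real u)))"
      unfolding norm_exp_exp using exp_exp_bound[OF y, of u "Re s"]
      by (simp add: norm_mult del: of_real_exp)
  qed
qed (simp add: set_borel_measurable_def)

text \<open>The substitution \<open>t = y * exp u\<close> in Euler's integral;
  \<open>exp (- s * ln y)\<close> is the power \<open>y^(-s)\<close>.\<close>

lemma Gamma_integral_exp_exp:
  assumes y: "y > 0" and s: "Re s > 0"
  shows "integrable lborel (\<lambda>u. exp (- of_real (y * exp u) + s * of_real u))" (is ?A)
    and "(LBINT u. exp (- of_real (y * exp u) + s * of_real u)) = Gamma s * exp (- s * of_real (ln y))" (is ?B)
proof -
  define f where "f = (\<lambda>t. complex_of_real t powr (s - 1) / of_real (exp t))"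
  define g where "g = (\<lambda>u. y * exp u)"
  have range: "g ` UNIV = {0<..}"
  proof (intro equalityI subsetI)
    fix x :: real assume "x \<in> {0<..}"
    then have "x = g (ln (x / y))" using y by (simp add: g_def)
    then show "x \<in> g ` UNIV" by blast
  qed (use y in \<open>auto simp: g_def\<close>)
  have eq: "\<bar>g u\<bar> *\<^sub>R f (g u) = exp (s * of_real (ln y)) * exp (- of_real (y * exp u) + s * of_real u)" for u
  proof -
    have pos: "g u > 0" using y by (simp add: g_def)
    have ln: "ln (g u) = ln y + u" using y by (simp add: g_def ln_mult)
    have "complex_of_real (g u) powr (s - 1) = exp ((s - 1) * of_real (ln y + u))"
      using pos by (simp add: powr_def Ln_of_real ln)
    moreover have "complex_of_real (g u) = exp (of_real (ln y + u))"
      using pos ln by (metis exp_ln exp_of_real)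
    moreover have "1 / complex_of_real (exp (g u)) = exp (- of_real (y * exp u))"
      by (simp add: g_def exp_minus inverse_eq_divide exp_of_real del: of_real_mult)
    ultimately have "\<bar>g u\<bar> *\<^sub>R f (g u) = exp (of_real (ln y + u)) * exp ((s - 1) * of_real (ln y + u)) * exp (- of_real (y * exp u))"
      unfolding f_def scaleR_conv_of_real using pos by (simp add: divide_inverse)
    also have "\<dots> = exp (s * of_real (ln y)) * exp (- of_real (y * exp u) + s * of_real u)"
      unfolding exp_add[symmetric] by (simp add: algebra_simps)
    finally show ?thesis .
  qed
  have "(\<lambda>u. \<bar>g u\<bar> *\<^sub>R f (g u)) absolutely_integrable_on UNIV \<and> integral UNIV (\<lambda>u. \<bar>g u\<bar> *\<^sub>R f (g u)) = Gamma s
      \<longleftrightarrow> f absolutely_integrable_on g ` UNIV \<and> integral (g ` UNIV) f = Gamma s"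
  proof (rule has_absolute_integral_change_of_variables_real)
    show "(g has_real_derivative g x) (at x within UNIV)" for x
      unfolding g_def by (auto intro!: derivative_eq_intros)
    show "inj_on g UNIV" using y by (auto simp: g_def inj_on_def)
  qed auto
  moreover have "f absolutely_integrable_on {0<..}" "integral {0<..} f = Gamma s"
    using absolutely_integrable_Gamma_integral'[OF s] Gamma_integral_complex'[OF s]
    unfolding f_def by (auto intro: integral_unique)
  ultimately have *: "(\<lambda>u. \<bar>g u\<bar> *\<^sub>R f (g u)) absolutely_integrable_on UNIV"
      "integral UNIV (\<lambda>u. \<bar>g u\<bar> *\<^sub>R f (g u)) = Gamma s"
    unfolding range by auto
  have "set_borel_measurable lborel UNIV (\<lambda>u. \<bar>g u\<bar> *\<^sub>R f (g u))"
    unfolding eq by (simp add: set_borel_measurable_def)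
  note L = set_integrable_lborel_of_lebesgue[OF *(1) this]
  have L1: "integrable lborel (\<lambda>u. exp (s * of_real (ln y)) * exp (- of_real (y * exp u) + s * of_real u))"
    using L(1) unfolding eq set_integrable_def by simp
  then show int: ?A
  proof -
    have "integrable lborel (\<lambda>u. exp (- (s * of_real (ln y))) *
        (exp (s * of_real (ln y)) * exp (- of_real (y * exp u) + s * of_real u)))"
      by (intro integrable_mult_right L1)
    then show ?thesis by (simp add: exp_minus flip: mult.assoc)
  qed
  have "Gamma s = (LBINT u. exp (s * of_real (ln y)) * exp (- of_real (y * exp u) + s * of_real u))"
    using L(2) *(2) unfolding eq set_lebesgue_integral_def by simp
  also have "\<dots> = exp (s * of_real (ln y)) * (LBINT u. exp (- of_real (y * exp u) + s * of_real u))"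
    using int by simp
  finally show ?B
    by (simp add: exp_minus field_simps)
qed

lemma summable_exp_coeff: "summable (\<lambda>j. norm (complex_of_real ((- y) ^ j / fact j)))"
proof -
  have "norm (complex_of_real ((- y) ^ j / fact j)) = inverse (fact j) * \<bar>y\<bar> ^ j" for j
    unfolding norm_of_real by (simp add: power_abs abs_mult divide_inverse mult.commute)
  then show ?thesis using summable_exp[of "\<bar>y\<bar>"] by simp
qed

lemma sums_exp_coeff: "(\<lambda>j. complex_of_real ((- y) ^ j / fact j) * z ^ j) sums exp (- (of_real y * z))"
proof -
  have "complex_of_real ((- y) ^ j / fact j) * z ^ j = (- (of_real y * z)) ^ j /\<^sub>R fact j" for j
  proof -
    have "complex_of_real ((- y) ^ j / fact j) * z ^ j = ((- of_real y) ^ j * z ^ j) /\<^sub>R fact j"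
      by (simp add: scaleR_conv_of_real divide_inverse)
    also have "(- of_real y) ^ j * z ^ j = (- (of_real y * z)) ^ j"
      by (simp flip: power_mult_distrib)
    finally show ?thesis .
  qed
  then show ?thesis using exp_converges[of "- (of_real y * z)"] by simp
qed

lemma sums_lebesgue_integral_dominated:
  fixes f :: "nat \<Rightarrow> 'a \<Rightarrow> 'b :: {banach, second_countable_topology}"
  assumes c: "summable c" and int: "\<And>k. integrable M (f k)" and g: "integrable M g"
    and bound: "\<And>k x. norm (f k x) \<le> c k * (g x :: real)" and F: "\<And>x. (\<lambda>k. f k x) sums F x"
  shows "(\<lambda>k. integral\<^sup>L M (f k)) sums integral\<^sup>L M F"
proof -
  have "(\<lambda>k. integral\<^sup>L M (f k)) sums (\<integral>x. (\<Sum>k. f k x) \<partial>M)"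
  proof (rule sums_integral[OF int])
    have "summable (\<lambda>k. norm (f k x))" for x
      by (rule summable_comparison_test'[OF summable_mult2[OF c, of "g x"], of 0]) (simp add: bound)
    then show "AE x in M. summable (\<lambda>k. norm (f k x))" by simp
    have "(\<integral>x. norm (f k x) \<partial>M) \<le> (\<integral>x. c k * g x \<partial>M)" for k
      by (intro integral_mono integrable_norm int bound integrable_mult_right g)
    then show "summable (\<lambda>k. \<integral>x. norm (f k x) \<partial>M)"
      by (intro summable_comparison_test'[OF summable_mult2[OF c, of "integral\<^sup>L M g"], of 0]) simp
  qed
  moreover have "(\<lambda>x. \<Sum>k. f k x) = F" using F by (auto simp: sums_iff)
  ultimately show ?thesis by simp
qed

text \<open>This integral is the reflected part \<open>u < 0\<close> of the one in
  \<open>Gamma_integral_exp_exp\<close>. After the reflection \<open>exp (- u) < 1\<close>, so the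
  exponential series is dominated by its coefficients and can be integrated term by term.\<close>

lemma lower_gamma_sum_integral:
  assumes s: "Re s > 0"
  shows "(LBINT u:{0<..}. exp (- of_real (y * exp (- u)) - s * of_real u)) = lower_gamma_sum y s"
proof -
  define a where "a = (\<lambda>j. complex_of_real ((- y) ^ j / fact j))"
  define f where "f = (\<lambda>j u. indicator {0<..} u *\<^sub>R (a j * exp (- ((s + of_nat j) * of_real u))))"
  have Re: "Re (s + of_nat j) > 0" for j using s by simp
  have int: "integrable lborel (f j)" for j
    using set_integrable_mult_right[OF exp_lebesgue_integral(1)[OF Re[of j]], of "a j"]
    by (simp add: f_def set_integrable_def)
  have nf: "norm (f j u) \<le> norm (a j) * (indicator {0<..} u * exp (- (Re s * u)))" for j u
  proof (cases "u > 0")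
    case True
    then have "Re s * u \<le> (Re s + real j) * u" by (intro mult_right_mono) auto
    then show ?thesis using True by (simp add: f_def norm_mult mult_left_mono)
  qed (simp add: f_def)
  have sa: "summable (\<lambda>j. norm (a j))" unfolding a_def by (rule summable_exp_coeff)
  have e: "integrable lborel (\<lambda>u. indicator {0<..} u * exp (- (Re s * u)))"
    using exp_lebesgue_integral(1)[OF s, THEN set_integrable_norm] by (simp add: set_integrable_def)
  have sumf: "(\<lambda>j. f j u) sums (indicator {0<..} u *\<^sub>R exp (- of_real (y * exp (- u)) - s * of_real u))" for u
  proof -
    have "(\<lambda>j. (a j * exp (- of_real u) ^ j) * exp (- (s * of_real u))) sums
        (exp (- (of_real y * exp (- of_real u))) * exp (- (s * of_real u)))"
      unfolding a_def by (intro sums_mult2 sums_exp_coeff)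
    also have "(\<lambda>j. (a j * exp (- of_real u) ^ j) * exp (- (s * of_real u))) =
        (\<lambda>j. a j * exp (- ((s + of_nat j) * of_real u)))"
    proof
      fix j
      have "exp (- complex_of_real u) ^ j = exp (of_nat j * (- of_real u))" by (simp only: exp_of_nat_mult)
      then show "(a j * exp (- of_real u) ^ j) * exp (- (s * of_real u)) = a j * exp (- ((s + of_nat j) * of_real u))"
        by (simp add: mult.assoc exp_add[symmetric] algebra_simps)
    qed
    also have "exp (- (of_real y * exp (- of_real u))) * exp (- (s * of_real u)) =
        exp (- of_real (y * exp (- u)) - s * complex_of_real u)"
      by (simp add: exp_add[symmetric] exp_of_real[symmetric])
    finally show ?thesis unfolding f_def by (rule sums_scaleR_right)
  qed
  note sums_lebesgue_integral_dominated[OF sa int e nf sumf]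
  moreover have "integral\<^sup>L lborel (f j) = a j / (s + of_nat j)" for j
    using exp_lebesgue_integral(2)[OF Re[of j]] set_integral_mult_right[where a = "a j"]
    unfolding f_def set_lebesgue_integral_def[symmetric] by simp
  ultimately show ?thesis
    unfolding lower_gamma_sum_def set_lebesgue_integral_def a_def by (simp add: sums_iff)
qed

lemma exp_exp_integral_right_halfplane:
  assumes y: "y > 0" and s: "Re s > 0"
  shows "exp_exp_integral y s = Gamma s * exp (- s * of_real (ln y)) - lower_gamma_sum y s"
proof -
  have "(LBINT u:{0<..}. exp (- of_real (y * exp (- u)) + s * of_real (- u))) = lower_gamma_sum y s"
    using lower_gamma_sum_integral[OF s, of y] by simp
  then show ?thesis
    using integral_split_reflect[OF Gamma_integral_exp_exp(1)[OF y s]]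
    unfolding Gamma_integral_exp_exp(2)[OF y s] exp_exp_integral_def[symmetric] by simp
qed

lemma summable_lower_gamma_sum:
  assumes "Im s \<noteq> 0"
  shows "summable (\<lambda>j. norm (of_real ((- y) ^ j / fact j) / (s + of_nat j)))"
proof (rule summable_comparison_test'[OF summable_mult2[OF summable_exp_coeff[of y], of "1 / \<bar>Im s\<bar>"], of 0])
  fix j :: nat
  have "norm (of_real ((- y) ^ j / fact j) / (s + of_nat j)) =
      norm (complex_of_real ((- y) ^ j / fact j)) * (1 / norm (s + of_nat j))"
    by (simp only: norm_divide) simp
  also have "\<dots> \<le> norm (complex_of_real ((- y) ^ j / fact j)) * (1 / \<bar>Im s\<bar>)"
  proof -
    have "\<bar>Im s\<bar> \<le> norm (s + of_nat j)" using abs_Im_le_cmod[of "s + of_nat j"] by simp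
    moreover have "\<bar>Im s\<bar> > 0" using assms by simp
    ultimately show ?thesis by (intro mult_left_mono divide_left_mono mult_pos_pos norm_ge_zero) linarith+
  qed
  finally show "norm (norm (of_real ((- y) ^ j / fact j) / (s + of_nat j))) \<le>
      norm (complex_of_real ((- y) ^ j / fact j)) * (1 / \<bar>Im s\<bar>)" by (simp only: real_norm_def abs_norm_cancel)
qed

text \<open>Split \<open>s / (s + j) = 1 - j / (s + j)\<close>: the first part sums to the
  exponential, the second is the series at \<open>s + 1\<close> after an index shift.\<close>

lemma lower_gamma_sum_rec:
  assumes s: "Im s \<noteq> 0"
  shows "s * lower_gamma_sum y s = exp (- of_real y) + of_real y * lower_gamma_sum y (s + 1)"
proof -
  define a where "a = (\<lambda>j. complex_of_real ((- y) ^ j / fact j))"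
  have nz: "s + of_nat j \<noteq> 0" for j
  proof
    assume "s + of_nat j = 0"
    then have "Im (s + of_nat j) = 0" by simp
    then show False using s by simp
  qed
  have W: "(\<lambda>j. a j / (s' + of_nat j)) sums lower_gamma_sum y s'" if "Im s' \<noteq> 0" for s'
    unfolding lower_gamma_sum_def a_def
    by (rule summable_sums, rule summable_norm_cancel, rule summable_lower_gamma_sum[OF that])
  have E: "a sums exp (- of_real y)"
    using sums_exp_coeff[of y 1] by (simp add: a_def)
  have "(\<lambda>j. - of_real y * (a j / (s + 1 + of_nat j))) sums (- of_real y * lower_gamma_sum y (s + 1))"
    by (intro sums_mult W) (use s in simp)
  also have "(\<lambda>j. - of_real y * (a j / (s + 1 + of_nat j))) = (\<lambda>j. a (Suc j) * of_nat (Suc j) / (s + of_nat (Suc j)))"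
  proof
    fix j
    have "a (Suc j) * of_nat (Suc j) = - of_real y * a j"
      by (simp add: a_def field_simps del: of_nat_Suc)
    then show "- of_real y * (a j / (s + 1 + of_nat j)) = a (Suc j) * of_nat (Suc j) / (s + of_nat (Suc j))"
      by (simp add: add.assoc)
  qed
  finally have "(\<lambda>j. a j * of_nat j / (s + of_nat j)) sums (- of_real y * lower_gamma_sum y (s + 1))"
    by (subst (asm) sums_Suc_iff) simp
  then have "(\<lambda>j. a j - a j * of_nat j / (s + of_nat j)) sums (exp (- of_real y) - - of_real y * lower_gamma_sum y (s + 1))"
    by (intro sums_diff E)
  also have "(\<lambda>j. a j - a j * of_nat j / (s + of_nat j)) = (\<lambda>j. s * (a j / (s + of_nat j)))"
  proof
    fix j
    show "a j - a j * of_nat j / (s + of_nat j) = s * (a j / (s + of_nat j))"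
      using nz[of j] by (simp add: divide_simps) (simp add: algebra_simps)
  qed
  finally have "(\<lambda>j. s * (a j / (s + of_nat j))) sums (exp (- of_real y) + of_real y * lower_gamma_sum y (s + 1))"
    by simp
  moreover have "(\<lambda>j. s * (a j / (s + of_nat j))) sums (s * lower_gamma_sum y s)"
    by (intro sums_mult W s)
  ultimately show ?thesis by (rule sums_unique2[symmetric])
qed

text \<open>The derivative of \<open>exp (- y * exp u + s * u)\<close> is integrated over the
  half-line; only the boundary value \<open>exp (- y)\<close> at 0 survives. Together with
  \<open>lower_gamma_sum_rec\<close> it reproduces the functional equation of
  \<open>Gamma\<close>.\<close>

lemma exp_exp_integral_rec:
  assumes y: "y > 0"
  shows "s * exp_exp_integral y s = of_real y * exp_exp_integral y (s + 1) - exp (- of_real y)"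
proof -
  define F where "F = (\<lambda>s u. exp (- of_real (y * exp u) + s * complex_of_real u))"
  have int: "set_integrable lborel {0<..} (F s)" for s
    unfolding F_def by (rule set_integrable_exp_exp[OF y])
  have shift: "of_real (exp u) * F s u = F (s + 1) u" for u
    by (simp add: F_def exp_add exp_diff algebra_simps exp_of_real[symmetric] exp_minus)
  define f where "f = (\<lambda>u. s * F s u - of_real y * F (s + 1) u)"
  have "set_integrable lborel {0<..} f"
    unfolding f_def by (intro set_integral_diff(1) set_integrable_mult_right int)
  moreover have "einterval 0 \<infinity> = {0<..}" by (auto simp: einterval_def)
  ultimately have "set_integrable lborel (einterval 0 \<infinity>) f" by simp
  then have "(LBINT x=0..\<infinity>. f x) = 0 - exp (- of_real y)"
  proof (rule interval_integral_FTC_integrable[rotated 3])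
    fix x :: real
    have "((\<lambda>u. exp (- (of_real y * exp u) + s * u)) has_field_derivative
        (- (of_real y * exp (of_real x)) + s) * exp (- (of_real y * exp (of_real x)) + s * of_real x)) (at (of_real x))"
      by (auto intro!: derivative_eq_intros)
    from has_vector_derivative_real_field[OF this]
    have "((\<lambda>u. F s u) has_vector_derivative (- (of_real y * exp (of_real x)) + s) * F s x) (at x)"
      by (simp add: F_def exp_of_real comp_def)
    also have "(- (of_real y * exp (of_real x)) + s) * F s x = f x"
      unfolding f_def shift[symmetric] by (simp add: algebra_simps exp_of_real)
    finally show "(F s has_vector_derivative f x) (at x)" by simp
    show "isCont f x" unfolding f_def F_def by (intro continuous_intros)
  next
    have "isCont (F s) 0" unfolding F_def by (intro continuous_intros)
    then have "(F s \<longlongrightarrow> F s 0) (at_right 0)"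
      by (simp add: isCont_def filterlim_at_split)
    then show "((F s \<circ> real_of_ereal) \<longlongrightarrow> exp (- of_real y)) (at_right 0)"
      by (simp add: F_def zero_ereal_def ereal_tendsto_simps)
    have "(F s \<longlongrightarrow> 0) at_top"
    proof (rule Lim_null_comparison)
      show "eventually (\<lambda>u. norm (F s u) \<le> exp ((Re s + 1)\<^sup>2 / (2 * y)) * exp (- (1 * u))) at_top"
        using eventually_gt_at_top[of 0]
      proof eventually_elim
        case (elim u)
        show ?case unfolding F_def norm_exp_exp by (rule exp_exp_bound[OF y elim])
      qed
      show "((\<lambda>u. exp ((Re s + 1)\<^sup>2 / (2 * y)) * exp (- (1 * u :: real))) \<longlongrightarrow> 0) at_top"
        by (intro tendsto_mult_right_zero) (auto intro!: filterlim_compose[OF exp_at_bot] filterlim_uminus_at_bot_at_top)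
    qed
    then show "((F s \<circ> real_of_ereal) \<longlongrightarrow> 0) (at_left \<infinity>)"
      by (simp add: ereal_tendsto_simps)
  qed simp
  moreover have "(LBINT x=0..\<infinity>. f x) = (LBINT x:{0<..}. f x)"
    unfolding zero_ereal_def by (rule interval_integral_to_infinity_eq)
  moreover have "(LBINT x:{0<..}. f x) = s * exp_exp_integral y s - of_real y * exp_exp_integral y (s + 1)"
    unfolding f_def using int
    by (subst set_integral_diff(2)) (auto simp: exp_exp_integral_def F_def)
  ultimately show ?thesis by (simp add: algebra_simps)
qed

text \<open>Both sides obey the same recurrence, so the decomposition known for
  \<open>Re s > 0\<close> moves left one unit at a time; the arguments \<open>v - k\<close> below
  run arbitrarily far to the left. A nonzero imaginary part avoids the poles.\<close>

lemma exp_exp_integral_eq: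
  assumes y: "y > 0" and s: "Im s \<noteq> 0"
  shows "exp_exp_integral y s = Gamma s * exp (- s * of_real (ln y)) - lower_gamma_sum y s"
proof -
  have "Im s \<noteq> 0 \<Longrightarrow> Re s > - real n \<Longrightarrow>
      exp_exp_integral y s = Gamma s * exp (- s * of_real (ln y)) - lower_gamma_sum y s" for n
  proof (induction n arbitrary: s)
    case 0
    then show ?case by (intro exp_exp_integral_right_halfplane y) simp
  next
    case (Suc n)
    have nz: "s \<noteq> 0" using Suc.prems(1) by auto
    have "exp_exp_integral y (s + 1) = Gamma (s + 1) * exp (- (s + 1) * of_real (ln y)) - lower_gamma_sum y (s + 1)"
      by (rule Suc.IH) (use Suc.prems in auto)
    moreover have "Gamma (s + 1) = s * Gamma s"
      using Suc.prems(1) by (intro Gamma_plus1) (auto elim!: nonpos_Ints_cases)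
    moreover have "of_real y * exp (- (s + 1) * of_real (ln y)) = exp (- s * of_real (ln y))"
    proof -
      have "complex_of_real y = exp (of_real (ln y))" using y by (simp add: exp_of_real)
      then have "of_real y * exp (- (s + 1) * of_real (ln y)) = exp (of_real (ln y)) * exp (- (s + 1) * of_real (ln y))" by simp
      also have "\<dots> = exp (- s * of_real (ln y))" unfolding exp_add[symmetric] by (simp add: algebra_simps)
      finally show ?thesis .
    qed
    ultimately have "s * exp_exp_integral y s = s * (Gamma s * exp (- s * of_real (ln y))) - of_real y * lower_gamma_sum y (s + 1) - exp (- of_real y)"
      unfolding exp_exp_integral_rec[OF y] by (simp add: right_diff_distrib mult.left_commute)
    also have "\<dots> = s * (Gamma s * exp (- s * of_real (ln y))) - s * lower_gamma_sum y s"
      unfolding lower_gamma_sum_rec[OF Suc.prems(1)] by simp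
    finally show ?case using nz by (simp flip: right_diff_distrib)
  qed
  moreover obtain n where "- Re s < real n" using reals_Archimedean2 by blast
  ultimately show ?thesis using s by (meson minus_less_iff)
qed

lemma suminf_swap:
  fixes f :: "nat \<Rightarrow> nat \<Rightarrow> complex"
  assumes a: "summable a" and f: "\<And>k j. norm (f k j) \<le> a k * a j" and nonneg: "\<And>k. (0::real) \<le> a k"
  shows "(\<Sum>k. \<Sum>j. f k j) = (\<Sum>j. \<Sum>k. f k j)" (is ?A) "summable (\<lambda>k. \<Sum>j. f k j)"
proof -
  let ?M = "count_space (UNIV :: nat set)"
  have 1: "summable (\<lambda>j. norm (f k j))" for k
    by (rule summable_comparison_test'[OF summable_mult[OF a, of "a k"], of 0]) (use f in simp)
  have 2: "summable (\<lambda>k. norm (f k j))" for j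
    by (rule summable_comparison_test'[OF summable_mult2[OF a, of "a j"], of 0]) (use f in simp)
  have le: "(\<Sum>j. norm (f k j)) \<le> a k * suminf a" for k
  proof -
    have "(\<Sum>j. norm (f k j)) \<le> (\<Sum>j. a k * a j)"
      by (intro suminf_le f 1 summable_mult a)
    then show ?thesis using a by (simp add: suminf_mult)
  qed
  have 3: "summable (\<lambda>k. \<Sum>j. norm (f k j))"
    by (rule summable_comparison_test'[OF summable_mult2[OF a, of "suminf a"], of 0])
      (use le 1 in \<open>simp add: suminf_nonneg\<close>)
  have int: "integrable ?M (f k)" for k using 1 by (simp add: integrable_count_space_nat_iff)
  have "(\<lambda>k. integral\<^sup>L ?M (f k)) sums (\<integral>j. (\<Sum>k. f k j) \<partial>?M)"
    by (rule sums_integral)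
      (use int 2 3 1 in \<open>auto simp: integral_count_space_nat integrable_count_space_nat_iff\<close>)
  moreover have "integrable ?M (\<lambda>j. \<Sum>k. f k j)"
    by (rule integrable_suminf)
      (use int 2 3 1 in \<open>auto simp: integral_count_space_nat integrable_count_space_nat_iff\<close>)
  moreover have "integral\<^sup>L ?M (f k) = (\<Sum>j. f k j)" for k
    using int by (rule integral_count_space_nat)
  ultimately have "(\<lambda>k. \<Sum>j. f k j) sums (\<Sum>j. \<Sum>k. f k j)"
    by (simp add: integral_count_space_nat)
  then show ?A "summable (\<lambda>k. \<Sum>j. f k j)"
    by (auto simp: sums_iff)
qed

section \<open>From the Macdonald integral to Bessel series\<close>

text \<open>Half of Macdonald's integral: the values at \<open>v\<close> and \<open>- v\<close> add
  up to \<open>2 * K_v(2 * y)\<close>. With the factor 2 the exponential splits into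
  \<open>exp (- y * exp u)\<close> and \<open>exp (- y * exp (- u))\<close>.\<close>

definition half_cosh_integral :: "real \<Rightarrow> complex \<Rightarrow> complex" where
  "half_cosh_integral y v = (LBINT u:{0<..}. exp (- of_real (2 * y * cosh u) + v * of_real u))"

text \<open>Only the factor \<open>exp (- y * exp (- u))\<close> is expanded. For
  \<open>u > 0\<close> its series is dominated by the coefficients, and each power of
  \<open>exp (- u)\<close> lowers \<open>v\<close> by one.\<close>

lemma half_cosh_integral_sums:
  assumes y: "y > 0"
  shows "(\<lambda>k. of_real ((- y) ^ k / fact k) * exp_exp_integral y (v - of_nat k)) sums half_cosh_integral y v"
proof -
  define a where "a = (\<lambda>j. complex_of_real ((- y) ^ j / fact j))"
  define F where "F = (\<lambda>s u. exp (- of_real (y * exp u) + s * complex_of_real u))"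
  define f where "f = (\<lambda>k u. indicator {0<..} u *\<^sub>R (a k * F (v - of_nat k) u))"
  have sa: "summable (\<lambda>j. norm (a j))" unfolding a_def by (rule summable_exp_coeff)
  have int: "integrable lborel (f k)" for k
    using set_integrable_mult_right[OF set_integrable_exp_exp[OF y, of "v - of_nat k"], of "a k"]
    by (simp add: f_def F_def set_integrable_def)
  have e: "integrable lborel (\<lambda>u. indicator {0<..} u * norm (F v u))"
    using set_integrable_norm[OF set_integrable_exp_exp[OF y, of v]] by (simp add: F_def set_integrable_def)
  have nf: "norm (f k u) \<le> norm (a k) * (indicator {0<..} u * norm (F v u))" for k u
  proof (cases "u > 0")
    case True
    then have "norm (F (v - of_nat k) u) \<le> norm (F v u)" unfolding F_def norm_exp_exp by (simp add: left_diff_distrib)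
    then show ?thesis using True by (simp add: f_def norm_mult mult_left_mono)
  qed (simp add: f_def)
  have sumf: "(\<lambda>k. f k u) sums (indicator {0<..} u *\<^sub>R exp (- of_real (2 * y * cosh u) + v * of_real u))" for u
  proof -
    have "(\<lambda>k. (a k * exp (- of_real u) ^ k) * F v u) sums (exp (- (of_real y * exp (- of_real u))) * F v u)"
      unfolding a_def by (intro sums_mult2 sums_exp_coeff)
    also have "(\<lambda>k. (a k * exp (- of_real u) ^ k) * F v u) = (\<lambda>k. a k * F (v - of_nat k) u)"
    proof
      fix k
      have "exp (- complex_of_real u) ^ k = exp (of_nat k * (- of_real u))" by (simp only: exp_of_nat_mult)
      then show "(a k * exp (- of_real u) ^ k) * F v u = a k * F (v - of_nat k) u"
        unfolding F_def by (simp only: mult.assoc exp_add[symmetric]) (simp add: algebra_simps)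
    qed
    also have "exp (- (of_real y * exp (- of_real u))) * F v u = exp (- of_real (2 * y * cosh u) + v * of_real u)"
      unfolding F_def exp_add[symmetric] by (simp add: cosh_def exp_of_real[symmetric] algebra_simps)
    finally show ?thesis unfolding f_def by (rule sums_scaleR_right)
  qed
  note sums_lebesgue_integral_dominated[OF sa int e nf sumf]
  moreover have "integral\<^sup>L lborel (f k) = a k * exp_exp_integral y (v - of_nat k)" for k
    using set_integral_mult_right[where a = "a k"]
    unfolding f_def set_lebesgue_integral_def[symmetric] by (simp add: exp_exp_integral_def F_def)
  ultimately show ?thesis
    unfolding half_cosh_integral_def set_lebesgue_integral_def a_def by simp
qed

text \<open>Written out, the sum is a double series of \<open>a k * a j / (v - k + j)\<close>.
  Replacing \<open>v\<close> by \<open>- v\<close> and exchanging \<open>k\<close> and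
  \<open>j\<close> changes its sign, so the lower incomplete parts drop out of the sum over both
  orders.\<close>

lemma lower_gamma_sum_antisym:
  fixes y :: real
  assumes v: "Im v \<noteq> 0"
  defines "a \<equiv> (\<lambda>k. complex_of_real ((- y) ^ k / fact k))"
  shows "summable (\<lambda>k. a k * lower_gamma_sum y (v - of_nat k))" (is ?A)
    and "(\<Sum>k. a k * lower_gamma_sum y (v - of_nat k)) + (\<Sum>k. a k * lower_gamma_sum y (- v - of_nat k)) = 0" (is ?B)
proof -
  define f where "f = (\<lambda>v k j. a k * a j / (v - of_nat k + of_nat j))"
  \<comment> \<open>The square root splits \<open>1 / \<bar>Im v\<bar>\<close> evenly, because
    \<open>suminf_swap\<close> asks for a bound of the form \<open>a k * a j\<close>.\<close>
  define b where "b = (\<lambda>v k. norm (a k) / sqrt \<bar>Im v\<bar>)"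
  have sa: "summable (\<lambda>j. norm (a j))" unfolding a_def by (rule summable_exp_coeff)
  have W: "a k * lower_gamma_sum y (v - of_nat k) = (\<Sum>j. f v k j)" if "Im v \<noteq> 0" for v k
  proof -
    have "summable (\<lambda>j. a j / (v - of_nat k + of_nat j))"
      unfolding a_def by (rule summable_norm_cancel, rule summable_lower_gamma_sum) (use that in simp)
    from suminf_mult[OF this, of "a k"] show ?thesis
      unfolding lower_gamma_sum_def f_def a_def by (simp only: times_divide_eq_right)
  qed
  have f: "norm (f v k j) \<le> b v k * b v j" if "Im v \<noteq> 0" for v k j
  proof -
    have "\<bar>Im v\<bar> \<le> norm (v - of_nat k + of_nat j)" using abs_Im_le_cmod[of "v - of_nat k + of_nat j"] by simp
    moreover have "\<bar>Im v\<bar> > 0" using that by simp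
    ultimately have "norm (f v k j) \<le> norm (a k) * norm (a j) / \<bar>Im v\<bar>"
      unfolding f_def norm_divide norm_mult
      by (intro divide_left_mono mult_pos_pos mult_nonneg_nonneg norm_ge_zero) linarith+
    also have "\<dots> = b v k * b v j" by (simp add: b_def)
    finally show ?thesis .
  qed
  have b: "summable (b v)" "0 \<le> b v k" for v k
    unfolding b_def using sa by (auto intro: summable_divide)
  have swap: "(\<Sum>k. \<Sum>j. f v k j) = (\<Sum>j. \<Sum>k. f v k j)" "summable (\<lambda>k. \<Sum>j. f v k j)" if "Im v \<noteq> 0" for v
    using suminf_swap[OF b(1) f[OF that] b(2)] by auto
  show ?A
    using swap(2)[OF v] by (simp add: W[OF v])
  have anti: "f (- v) k j = - f v j k" for k j
  proof -
    have "- v - of_nat k + of_nat j = - (v - of_nat j + of_nat k)" by simp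
    then show ?thesis unfolding f_def by (simp only: mult.commute divide_minus_right)
  qed
  have sk: "summable (\<lambda>k. f v k j)" for j
    by (rule summable_norm_cancel, rule summable_comparison_test'[OF summable_mult2[OF b(1)[of v], of "b v j"], of 0])
      (use f[OF v] in simp)
  have "(\<Sum>k. a k * lower_gamma_sum y (- v - of_nat k)) = (\<Sum>k. \<Sum>j. - f v j k)"
    using v by (simp add: W anti)
  also have "\<dots> = - (\<Sum>k. \<Sum>j. f v j k)"
  proof -
    have "(\<Sum>j. - f v j k) = - (\<Sum>j. f v j k)" for k using sk by (rule suminf_minus)
    moreover have "summable (\<lambda>k. \<Sum>j. f v j k)"
      using swap(2)[of "- v"] v sk by (simp add: anti suminf_minus summable_minus_iff)
    ultimately show ?thesis by (simp add: suminf_minus)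
  qed
  also have "(\<Sum>k. \<Sum>j. f v j k) = (\<Sum>k. a k * lower_gamma_sum y (v - of_nat k))"
    using swap(1)[OF v] by (simp add: W[OF v])
  finally show ?B
    by simp
qed

text \<open>This is \<open>y^(-\<mu>)\<close> times the modified Bessel function
  \<open>I_\<mu>(2 * y)\<close>.\<close>

definition bessel_series :: "real \<Rightarrow> complex \<Rightarrow> complex" where
  "bessel_series y \<mu> = (\<Sum>k. of_real (y ^ (2 * k)) * rGamma (\<mu> + of_nat k + 1) / fact k)"

lemma sin_pi_neq_0_of_Im:
  assumes "Im v \<noteq> 0"
  shows "sin (of_real pi * v) \<noteq> 0"
proof
  assume "sin (of_real pi * v) = 0"
  then obtain n where "of_real pi * v = of_real (real_of_int n * pi)"
    by (auto simp: sin_eq_0)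
  then have "Im (of_real pi * v) = 0" by (metis Im_complex_of_real)
  then show False using assms by simp
qed

lemma Gamma_diff_of_nat:
  assumes "Im v \<noteq> 0"
  shows "Gamma (v - of_nat k) = (- 1) ^ k * of_real pi / sin (of_real pi * v) * rGamma (- v + of_nat k + 1)"
proof -
  have nz: "Gamma (1 - (v - of_nat k)) \<noteq> 0"
  proof -
    have "Im (1 - (v - of_nat k)) \<noteq> 0" using assms by simp
    then have "1 - (v - of_nat k) \<notin> \<int>\<^sub>\<le>\<^sub>0" by (metis Im_complex_of_real nonpos_Ints_cases of_real_of_int_eq)
    then show ?thesis by (simp add: Gamma_eq_zero_iff)
  qed
  have "sin (of_real pi * (v - of_nat k)) = (- 1) ^ k * sin (of_real pi * v)"
  proof (induction k)
    case (Suc k)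
    have "of_real pi * (v - of_nat (Suc k)) = of_real pi * (v - of_nat k) - of_real pi"
      by (simp add: algebra_simps)
    then have "sin (of_real pi * (v - of_nat (Suc k))) = - sin (of_real pi * (v - of_nat k))"
      by (simp only: sin_diff cos_of_real sin_of_real cos_pi sin_pi) simp
    then show ?case using Suc by simp
  qed simp
  moreover have "Gamma (v - of_nat k) * Gamma (1 - (v - of_nat k)) = of_real pi / sin (of_real pi * (v - of_nat k))"
    by (rule Gamma_reflection_complex)
  ultimately have "Gamma (v - of_nat k) * Gamma (1 - (v - of_nat k)) = of_real pi / ((- 1) ^ k * sin (of_real pi * v))"
    by (simp only:)
  then have "Gamma (v - of_nat k) = of_real pi / ((- 1) ^ k * sin (of_real pi * v)) / Gamma (1 - (v - of_nat k))"
    using nz by (simp only: nonzero_eq_divide_eq not_False_eq_True)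
  also have "\<dots> = (1 / (- 1) ^ k) * of_real pi / sin (of_real pi * v) * inverse (Gamma (1 - (v - of_nat k)))"
    by (simp add: divide_inverse)
  also have "1 / ((- 1) ^ k :: complex) = (- 1) ^ k" by (simp add: power_one_over[symmetric])
  also have "1 - (v - of_nat k) = - v + of_nat k + 1" by simp
  finally show ?thesis by (simp only: rGamma_inverse_Gamma)
qed


text \<open>The classical \<open>K_v = pi / 2 * (I_(-v) - I_v) / sin (pi * v)\<close> at
  \<open>2 * y\<close>. Each half integral is a series of complete gamma values minus lower
  incomplete ones; the latter cancel, and the reflection formula turns the former into Bessel
  series.\<close>

lemma half_cosh_integral_symmetric_sum:
  assumes y: "y > 0" and v: "Im v \<noteq> 0"
  shows "half_cosh_integral y v + half_cosh_integral y (- v) =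
    of_real pi / sin (of_real pi * v) *
      (exp (- v * of_real (ln y)) * bessel_series y (- v) - exp (v * of_real (ln y)) * bessel_series y v)"
proof -
  define a where "a = (\<lambda>k. complex_of_real ((- y) ^ k / fact k))"
  define G where "G = (\<lambda>v k. a k * (Gamma (v - of_nat k) * exp (- (v - of_nat k) * of_real (ln y))))"
  have G: "G v sums (half_cosh_integral y v + (\<Sum>k. a k * lower_gamma_sum y (v - of_nat k)))" if v: "Im v \<noteq> 0" for v
  proof -
    have "(\<lambda>k. a k * exp_exp_integral y (v - of_nat k) + a k * lower_gamma_sum y (v - of_nat k)) sums
        (half_cosh_integral y v + (\<Sum>k. a k * lower_gamma_sum y (v - of_nat k)))"
      unfolding a_def by (intro sums_add half_cosh_integral_sums y summable_sums lower_gamma_sum_antisym(1) v)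
    moreover have "a k * exp_exp_integral y (v - of_nat k) + a k * lower_gamma_sum y (v - of_nat k) = G v k" for k
    proof -
      have "Im (v - of_nat k) \<noteq> 0" using v by simp
      from exp_exp_integral_eq[OF y this] show ?thesis
        unfolding G_def by (simp only: right_diff_distrib) simp
    qed
    ultimately show ?thesis by simp
  qed
  have Geq: "G v k = of_real pi / sin (of_real pi * v) * exp (- v * of_real (ln y)) *
      (of_real (y ^ (2 * k)) * rGamma (- v + of_nat k + 1) / fact k)" if v: "Im v \<noteq> 0" for v k
  proof -
    have "complex_of_real y = exp (of_real (ln y))" using y by (simp add: exp_of_real)
    then have "exp (of_nat k * of_real (ln y)) = complex_of_real y ^ k" by (simp add: exp_of_nat_mult)
    moreover have "- (v - of_nat k) * of_real (ln y) = - v * of_real (ln y) + of_nat k * of_real (ln y)"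
      by (simp add: algebra_simps)
    ultimately have e: "exp (- (v - of_nat k) * of_real (ln y)) = exp (- v * of_real (ln y)) * complex_of_real y ^ k"
      by (simp only: exp_add)
    have r: "a k * (- 1) ^ k * complex_of_real y ^ k = of_real (y ^ (2 * k)) / fact k"
    proof -
      have "a k = (- 1) ^ k * complex_of_real y ^ k / fact k"
        unfolding a_def by (simp add: power_minus[of "complex_of_real y"])
      moreover have "complex_of_real y ^ k * complex_of_real y ^ k = of_real (y ^ (2 * k))"
        by (simp add: mult_2 power_add)
      moreover have "(- 1) ^ k * b / c * (- 1) ^ k * b = b * b / c" for b c :: complex
        by (simp add: mult.commute[of "(- 1) ^ k"] flip: mult.assoc)
      ultimately show ?thesis by (simp only:)
    qed
    define c where "c = of_real pi / sin (of_real pi * v)"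
    define g where "g = rGamma (- v + of_nat k + 1)"
    have "Gamma (v - of_nat k) = (- 1) ^ k * (c * g)"
      unfolding Gamma_diff_of_nat[OF v] c_def g_def by simp
    then have "G v k = (a k * (- 1) ^ k * complex_of_real y ^ k) * (c * g * exp (- v * of_real (ln y)))"
      unfolding G_def e by (simp only: mult_ac)
    then show ?thesis unfolding r c_def[symmetric] g_def[symmetric] by (simp add: mult_ac)
  qed
  have suminf_G: "suminf (G v) = of_real pi / sin (of_real pi * v) * exp (- v * of_real (ln y)) * bessel_series y (- v)"
    if v: "Im v \<noteq> 0" for v
  proof -
    define c where "c = of_real pi / sin (of_real pi * v) * exp (- v * of_real (ln y))"
    have "c \<noteq> 0" using sin_pi_neq_0_of_Im[OF v] by (simp add: c_def)
    have "summable (\<lambda>k. c * (of_real (y ^ (2 * k)) * rGamma (- v + of_nat k + 1) / fact k))"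
      using sums_summable[OF G[OF v]] unfolding Geq[OF v] c_def .
    then have "summable (\<lambda>k. of_real (y ^ (2 * k)) * rGamma (- v + of_nat k + 1) / fact k)"
      using \<open>c \<noteq> 0\<close> by (simp only: summable_cmult_iff) simp
    note this = suminf_mult[OF this, of c]
    moreover have "G v = (\<lambda>k. c * (of_real (y ^ (2 * k)) * rGamma (- v + of_nat k + 1) / fact k))"
      unfolding c_def by (rule ext) (rule Geq[OF v])
    ultimately show ?thesis
      unfolding bessel_series_def c_def[symmetric] by (simp only:)
  qed
  have "half_cosh_integral y v + half_cosh_integral y (- v) = suminf (G v) + suminf (G (- v))"
  proof -
    define X where "X = (\<Sum>k. a k * lower_gamma_sum y (v - of_nat k))"
    define Y where "Y = (\<Sum>k. a k * lower_gamma_sum y (- v - of_nat k))"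
    have "X + Y = 0" unfolding X_def Y_def a_def by (rule lower_gamma_sum_antisym(2)[OF v])
    moreover have "suminf (G v) = half_cosh_integral y v + X" "suminf (G (- v)) = half_cosh_integral y (- v) + Y"
      unfolding X_def Y_def using v by (auto intro!: sums_unique[symmetric] G)
    moreover have "(p + X) + (q + Y) = p + q + (X + Y)" for p q by (simp add: ac_simps)
    ultimately show ?thesis by simp
  qed
  also have "\<dots> = of_real pi / sin (of_real pi * v) *
      (exp (- v * of_real (ln y)) * bessel_series y (- v) - exp (v * of_real (ln y)) * bessel_series y v)"
    using v suminf_G[OF v] suminf_G[of "- v"] by (simp add: right_diff_distrib mult.assoc)
  finally show ?thesis .
qed

lemma bessel_J_imaginary:
  assumes y: "y > 0"
  shows "bessel_J \<mu> (\<i> * of_real (2 * y)) = exp (\<mu> * (of_real (ln y) + \<i> * of_real (pi / 2))) * bessel_series y \<mu>"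
proof -
  have 1: "\<i> * of_real (2 * y) / 2 = of_real y * \<i>" by simp
  have 2: "Ln (of_real y * \<i>) = of_real (ln y) + \<i> * of_real (pi / 2)"
    using y Ln_times_of_real[of y \<i>] by (simp add: Ln_of_real)
  have 3: "(- 1) ^ k * (of_real y * \<i>) ^ (2 * k) = complex_of_real (y ^ (2 * k))" for k
  proof -
    have "(of_real y * \<i>) ^ (2 * k) = complex_of_real y ^ (2 * k) * (- 1) ^ k"
      unfolding power_mult_distrib by (simp add: power_mult[of \<i>])
    moreover have "(- 1) ^ k * (c * (- 1) ^ k) = c" for c :: complex
      by (simp add: mult.left_commute[of _ c])
    ultimately show ?thesis by simp
  qed
  show ?thesis
    unfolding bessel_J_def bessel_series_def powr_def 1 2 3 using y by simp
qed

lemma integrable_exp_minus_abs: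
  assumes c: "c > 0"
  shows "integrable lborel (\<lambda>a::real. exp (- c * \<bar>a\<bar>))"
proof -
  have 1: "integrable lborel (\<lambda>a. indicator {0<..} a * exp (- c * a))"
    using exp_lebesgue_integral(1)[of "of_real c", THEN set_integrable_norm] c
    by (simp add: set_integrable_def)
  have 2: "integrable lborel (\<lambda>a. indicator {0<..} (- a) * exp (c * a))"
    using lborel_integrable_real_affine[OF 1, of "- 1" 0] by simp
  have "integrable lborel (\<lambda>a. indicator {0<..} a * exp (- c * a) + indicator {0<..} (- a) * exp (c * a))"
    using 1 2 by (rule Bochner_Integration.integrable_add)
  moreover have "AE a in lborel. exp (- c * \<bar>a\<bar>) = indicator {0<..} a * exp (- c * a) + indicator {0<..} (- a) * exp (c * a)"
  proof -
    have "AE x in lborel. x \<noteq> (0::real)" by (rule AE_lborel_singleton)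
    then show ?thesis by eventually_elim (auto simp: indicator_def)
  qed
  ultimately show ?thesis by (subst integrable_cong_AE) auto
qed

lemma cosh_ge_half_exp_abs: "exp \<bar>x\<bar> / 2 \<le> cosh (x::real)"
  by (cases "x \<ge> 0") (auto simp: cosh_def)

text \<open>At \<open>v = \<i> * t\<close> as order and argument, both Bessel terms carry the common
  factor \<open>exp (- \<i> * pi * v / 2)\<close>, which is the \<open>exp (pi * t / 2)\<close> on
  the right. What remains is the difference of Bessel series in Macdonald's formula with
  \<open>y = t / 2\<close>.\<close>

lemma hankel_H1_integral:
  assumes t: "t > 0"
  shows "\<i> * hankel_H1 (\<i> * of_real t) (\<i> * of_real t) =
    of_real (exp (pi * t / 2) / pi) * (LBINT u. exp (- of_real (t * cosh u) + \<i> * of_real t * of_real u))"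
proof -
  define y where "y = t / 2"
  define v where "v = \<i> * complex_of_real t"
  define S where "S = sin (of_real pi * v)"
  have y: "y > 0" and ty: "t = 2 * y" using t by (auto simp: y_def)
  have v: "Im v \<noteq> 0" using t by (simp add: v_def)
  have S: "S \<noteq> 0" unfolding S_def by (rule sin_pi_neq_0_of_Im[OF v])
  have vt: "v = \<i> * of_real (2 * y)" by (simp add: v_def ty)
  have "v \<notin> \<int>" using v by (metis Ints_cases complex_Im_of_int)
  define P where "P = exp (- v * of_real (ln y)) * bessel_series y (- v)"
  define Q where "Q = exp (v * of_real (ln y)) * bessel_series y v"
  define E where "E = exp (- v * (\<i> * of_real (pi / 2)))"
  have E: "E = of_real (exp (pi * t / 2))"
    unfolding E_def v_def by (simp add: exp_of_real[symmetric] field_simps)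
  have J1: "bessel_J (- v) v = E * P"
    unfolding P_def E_def
    by (subst (2) vt, subst bessel_J_imaginary[OF y]) (simp add: exp_add[symmetric] algebra_simps)
  have J2: "exp (- of_real pi * \<i> * v) * bessel_J v v = E * Q"
    unfolding Q_def E_def
    by (subst (3) vt, subst bessel_J_imaginary[OF y]) (simp add: exp_add[symmetric] algebra_simps)
  have "hankel_H1 v v = (E * P - E * Q) / (\<i> * S)"
    using \<open>v \<notin> \<int>\<close> unfolding hankel_H1_def Let_def S_def J1[symmetric] J2[symmetric] by simp
  then have "\<i> * hankel_H1 v v = E / of_real pi * (of_real pi / S * (P - Q))"
    using S by (simp only:) (simp add: divide_simps right_diff_distrib)
  also have "of_real pi / S * (P - Q) = half_cosh_integral y v + half_cosh_integral y (- v)"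
    unfolding half_cosh_integral_symmetric_sum[OF y v] S_def P_def Q_def ..
  also have "half_cosh_integral y v + half_cosh_integral y (- v) =
      (LBINT u. exp (- of_real (t * cosh u) + v * of_real u))"
  proof -
    have int: "integrable lborel (\<lambda>u. exp (- of_real (t * cosh u) + v * of_real u))"
    proof (rule Bochner_Integration.integrable_bound)
      show "integrable lborel (\<lambda>u. exp (- (t / 2) * \<bar>u\<bar>))"
        using t by (intro integrable_exp_minus_abs) simp
      show "AE u in lborel. norm (exp (- of_real (t * cosh u) + v * of_real u)) \<le> norm (exp (- (t / 2) * \<bar>u\<bar>))"
      proof (intro AE_I2)
        fix u :: real
        have "\<bar>u\<bar> / 2 \<le> cosh u"
          using cosh_ge_half_exp_abs[of u] exp_ge_add_one_self[of "\<bar>u\<bar>"] by linarith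
        then have "t * (\<bar>u\<bar> / 2) \<le> t * cosh u" using t by simp
        then show "norm (exp (- of_real (t * cosh u) + v * of_real u)) \<le> norm (exp (- (t / 2) * \<bar>u\<bar>))"
          by (simp add: v_def)
      qed
    qed (simp add: cosh_field_def)
    show ?thesis
      using integral_split_reflect[OF int] unfolding half_cosh_integral_def ty by simp
  qed
  finally show ?thesis unfolding E v_def by simp
qed

section \<open>The cube root of \<open>sinh z - z\<close>\<close>

lemma Re_sinh_complex: "Re (sinh z) = sinh (Re z) * cos (Im z)"
  and Im_sinh_complex: "Im (sinh z) = cosh (Re z) * sin (Im z)"
  by (simp_all add: sinh_field_def cosh_field_def Re_exp Im_exp algebra_simps diff_divide_distrib add_divide_distrib)

lemma sinh_real_bounds:
  assumes x: "x > (0::real)"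
  shows "x < sinh x" "sinh x \<le> x * cosh x"
proof -
  have D: "(sinh has_real_derivative cosh t) (at t)" for t :: real
    by (auto intro!: derivative_eq_intros)
  obtain z where z: "0 < z" "z < x" "sinh x - sinh 0 = (x - 0) * cosh z"
    using MVT2[OF x D] by auto
  have "1 < cosh z" using z(1) cosh_real_nonneg_less_iff[of 0 z] by simp
  then show "x < sinh x" using z x by simp
  have "cosh z \<le> cosh x" using z x cosh_real_nonneg_le_iff[of z x] by simp
  then show "sinh x \<le> x * cosh x" using z x by simp
qed

lemma mult_cos_less_sin:
  assumes y: "0 < y" "y < pi"
  shows "y * cos y < sin y"
proof -
  define f where "f = (\<lambda>y::real. sin y - y * cos y)"
  have "f 0 < f y"
  proof (rule DERIV_pos_imp_increasing_open[OF y(1)])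
    fix x assume x: "0 < x" "x < y"
    have "(f has_real_derivative x * sin x) (at x)"
      unfolding f_def by (auto intro!: derivative_eq_intros)
    moreover have "x * sin x > 0" using x y by (intro mult_pos_pos sin_gt_zero) auto
    ultimately show "\<exists>d. (f has_real_derivative d) (at x) \<and> d > 0" by blast
  qed (auto simp: f_def intro!: continuous_intros)
  then show ?thesis by (simp add: f_def)
qed

lemma sin_less_self:
  assumes y: "y > (0::real)"
  shows "sin y < y"
proof (cases "y \<le> 1")
  case True
  define f where "f = (\<lambda>y::real. y - sin y)"
  have "f 0 < f y"
  proof (rule DERIV_pos_imp_increasing_open[OF y])
    fix x assume x: "0 < x" "x < y"
    have "(f has_real_derivative 1 - cos x) (at x)"
      unfolding f_def by (auto intro!: derivative_eq_intros)
    moreover have "cos x < cos 0" using x True pi_gt3 by (intro cos_monotone_0_pi) auto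
    ultimately show "\<exists>d. (f has_real_derivative d) (at x) \<and> d > 0" by (intro exI[of _ "1 - cos x"]) simp
  qed (auto simp: f_def intro!: continuous_intros)
  then show ?thesis by (simp add: f_def)
next
  case False
  then show ?thesis using sin_le_one[of y] by linarith
qed

lemma cos_nonpos_middle:
  assumes "pi / 2 \<le> y" "y \<le> 3 * pi / 2"
  shows "cos y \<le> 0"
proof -
  have "cos y = - sin (y - pi / 2)" by (simp add: sin_diff)
  moreover have "sin (y - pi / 2) \<ge> 0" using assms by (intro sin_ge_zero) auto
  ultimately show ?thesis by simp
qed

text \<open>The hypothesis forces \<open>cos y > 0\<close>, hence \<open>y < pi / 2\<close>; the
  alternative on \<open>y\<close> excludes the part beyond \<open>3 * pi / 2\<close>, where the
  cosine is positive again. Then \<open>sinh x \<le> x * cosh x\<close> and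
  \<open>y * cos y < sin y\<close> combine. In terms of \<open>z = x + \<i> y\<close>, the real part
  of \<open>sinh z - z\<close> cannot be nonnegative unless the imaginary part is positive.\<close>

lemma sinh_cos_ge_imp_cosh_sin_gt:
  assumes x: "x > (0::real)" and y: "0 < y" "y < 2 * pi" "sin y > 0 \<or> y \<le> 3 * pi / 2" and ge: "sinh x * cos y \<ge> x"
  shows "cosh x * sin y > y"
proof -
  have "sinh x > 0" using x by simp
  have "cos y > 0"
  proof (rule ccontr)
    assume "\<not> cos y > 0"
    then have "sinh x * cos y \<le> 0" using \<open>sinh x > 0\<close> by (simp add: mult_nonneg_nonpos)
    then show False using ge x by simp
  qed
  then have "y < pi / 2 \<or> y > 3 * pi / 2" using cos_nonpos_middle[of y] by linarith
  moreover have "\<not> y > 3 * pi / 2"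
  proof
    assume a: "y > 3 * pi / 2"
    then have "sin y > 0" using y by auto
    moreover have "sin y \<le> 0" using a y sin_le_zero[of y] by simp
    ultimately show False by simp
  qed
  ultimately have "y < pi" using pi_gt_zero by linarith
  then have "y * cos y < sin y" using y by (intro mult_cos_less_sin)
  have "y * x \<le> y * (sinh x * cos y)" using ge y by simp
  also have "\<dots> \<le> y * (x * cosh x * cos y)"
    using sinh_real_bounds(2)[OF x] \<open>cos y > 0\<close> y by (intro mult_left_mono mult_right_mono) auto
  also have "\<dots> = x * (cosh x * (y * cos y))" by simp
  also have "\<dots> < x * (cosh x * sin y)"
    using \<open>y * cos y < sin y\<close> x by (intro mult_strict_left_mono) auto
  finally show ?thesis using x by (simp add: mult.commute)
qed

text \<open>Symmetry reduces to \<open>x, y \<ge> 0\<close>, and \<open>cosh x * sin y = y\<close>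
  makes \<open>sin y\<close> positive if \<open>y > 0\<close>. For \<open>x > 0\<close> the
  inequality above, or \<open>x < sinh x\<close> when \<open>y = 0\<close>, excludes a zero; on the
  imaginary axis \<open>sin y < y\<close> does.\<close>

lemma sinh_eq_self_iff:
  assumes z: "\<bar>Im z\<bar> < 2 * pi"
  shows "sinh z = z \<longleftrightarrow> z = 0"
proof
  assume e: "sinh z = z"
  define x y where "x = \<bar>Re z\<bar>" and "y = \<bar>Im z\<bar>"
  have "sinh (Re z) * cos (Im z) = Re z" "cosh (Re z) * sin (Im z) = Im z"
    using e Re_sinh_complex[of z] Im_sinh_complex[of z] by simp_all
  then have e1: "sinh x * cos y = x" and e2: "cosh x * sin y = y"
    by (auto simp: x_def y_def abs_if)
  have y: "y \<ge> 0" "y < 2 * pi" using z by (simp_all add: y_def)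
  have sin: "sin y > 0" if "y > 0"
  proof -
    have "cosh x * sin y > 0" using e2 that by simp
    then show ?thesis using cosh_real_pos[of x] by (simp add: zero_less_mult_iff)
  qed
  have "x = 0"
  proof (rule ccontr)
    assume "x \<noteq> 0"
    then have x: "x > 0" by (simp add: x_def)
    then have "y \<noteq> 0" using e1 sinh_real_bounds(1)[OF x] by auto
    then show False using sinh_cos_ge_imp_cosh_sin_gt[OF x, of y] sin y e1 e2 by simp
  qed
  moreover from this have "y = 0" using sin_less_self[of y] y e2 by fastforce
  ultimately show "z = 0" by (simp add: x_def y_def complex_eq_iff)
qed simp

section \<open>The holomorphic cube root and its symmetries\<close>

definition sinh_cubic_quotient :: "complex \<Rightarrow> complex" where
  "sinh_cubic_quotient z = (if z = 0 then 1 / 6 else (sinh z - z) / z ^ 3)"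

lemma sinh_cubic_quotient_mult: "z ^ 3 * sinh_cubic_quotient z = sinh z - z"
  by (simp add: sinh_cubic_quotient_def)

lemma holomorphic_sinh_cubic_quotient: "sinh_cubic_quotient holomorphic_on S"
proof -
  \<comment> \<open>The coefficients of \<open>sinh\<close> shifted by three. The series takes the
    value \<open>1 / 6\<close> at 0 by itself, so holomorphy there comes with it.\<close>
  define c where "c = (\<lambda>n. if even n then 1 / fact (n + 3) else (0::complex))"
  have sums: "(\<lambda>n. c n * z ^ n) sums sinh_cubic_quotient z" for z
  proof (cases "z = 0")
    case True
    have "(\<lambda>n. c n * 0 ^ n) sums c 0" by (rule powser_sums_zero)
    then show ?thesis using True by (simp add: sinh_cubic_quotient_def c_def fact_numeral)
  next
    case False
    define a where "a = (\<lambda>n. if even n then 0 else z ^ n /\<^sub>R fact n)"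
    have "a sums sinh z" unfolding a_def by (rule sinh_converges)
    then have "(\<lambda>n. a (n + 3)) sums (sinh z - (\<Sum>i<3. a i))"
      by (subst sums_iff_shift) simp
    also have "(\<Sum>i<3. a i) = z" by (simp add: a_def eval_nat_numeral)
    finally have "(\<lambda>n. a (n + 3) / z ^ 3) sums ((sinh z - z) / z ^ 3)" by (rule sums_divide)
    also have "(\<lambda>n. a (n + 3) / z ^ 3) = (\<lambda>n. c n * z ^ n)"
      using False by (auto simp: a_def c_def fun_eq_iff power_add scaleR_conv_of_real divide_inverse)
    finally show ?thesis using False by (simp add: sinh_cubic_quotient_def)
  qed
  have hol: "sinh_cubic_quotient holomorphic_on ball 0 (norm z + 1)" for z :: complex
    by (rule power_series_holomorphic[where a = c]) (use sums in simp)
  have "sinh_cubic_quotient field_differentiable at z" for z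
    by (rule holomorphic_on_imp_differentiable_at[OF hol[of z]]) auto
  then show ?thesis
    by (auto simp: holomorphic_on_def intro: field_differentiable_at_within)
qed

lemma sinh_cubic_quotient_neq_0: "\<bar>Im z\<bar> < 2 * pi \<Longrightarrow> sinh_cubic_quotient z \<noteq> 0"
  using sinh_eq_self_iff[of z] by (simp add: sinh_cubic_quotient_def)

abbreviation wide_strip :: "complex set" where
  "wide_strip \<equiv> {z. \<bar>Im z\<bar> < 2 * pi}"

text \<open>The quotient of two continuous cube roots takes values in the finite set of cube roots
  of unity, hence is constant on a connected set. Symmetries of the cube thus pass to the
  root.\<close>

lemma cube_root_unique:
  assumes S: "connected S" "0 \<in> S" and cont: "continuous_on S f" "continuous_on S g"
    and eq: "\<And>z. z \<in> S \<Longrightarrow> f z ^ 3 = g z ^ 3" and nz: "\<And>z. z \<in> S \<Longrightarrow> g z \<noteq> 0" and 0: "f 0 = g 0"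
    and z: "z \<in> S"
  shows "f z = (g z :: complex)"
proof -
  have "(\<lambda>z. f z / g z) ` S \<subseteq> {w. w ^ 3 = 1}"
    using eq nz by (auto simp: power_divide)
  moreover have "finite {w::complex. w ^ 3 = 1}" by (rule finite_roots_unity) simp
  ultimately have "finite ((\<lambda>z. f z / g z) ` S)" by (rule finite_subset)
  moreover have "continuous_on S (\<lambda>z. f z / g z)" using cont nz by (intro continuous_intros) auto
  ultimately have "(\<lambda>z. f z / g z) constant_on S" using S by (intro continuous_finite_range_constant)
  then have "f z / g z = f 0 / g 0" using S z unfolding constant_on_def by metis
  then show ?thesis using 0 nz S z by (simp add: field_simps)
qed

lemma sinh_cubic_root_exists:
  "\<exists>P. P holomorphic_on wide_strip \<and> (\<forall>z\<in>wide_strip. P z ^ 3 = sinh_cubic_quotient z) \<and> P 0 = of_real (root 3 (1 / 6))"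
proof -
  obtain g where g: "g holomorphic_on wide_strip" "\<And>z. z \<in> wide_strip \<Longrightarrow> exp (g z) = sinh_cubic_quotient z"
    using holomorphic_logarithm_exists[OF convex_strip open_strip holomorphic_sinh_cubic_quotient, of "2 * pi" 0]
      sinh_cubic_quotient_neq_0 by auto
  \<comment> \<open>Subtracting \<open>g 0\<close> removes the free multiple of
    \<open>2 * pi * \<i>\<close> in the logarithm; the constant is the positive cube root of the
    value \<open>1 / 6\<close> at 0 and selects the branch that is positive on the real
    axis.\<close>
  define P where "P = (\<lambda>z. exp ((g z - g 0) / 3) * of_real (root 3 (1 / 6)))"
  have "P z ^ 3 = sinh_cubic_quotient z" if "z \<in> wide_strip" for z
  proof -
    have "exp ((g z - g 0) / 3) ^ 3 = exp (of_nat 3 * ((g z - g 0) / 3))" by (simp only: exp_of_nat_mult)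
    also have "of_nat 3 * ((g z - g 0) / 3) = g z - g 0" by simp
    also have "exp (g z - g 0) = exp (g z) / exp (g 0)" by (rule exp_diff)
    also have "\<dots> = sinh_cubic_quotient z / (1 / 6)"
    proof -
      have "exp (g 0) = 1 / 6" using g(2)[of 0] by (simp add: sinh_cubic_quotient_def)
      then show ?thesis by (simp only: g(2)[OF that])
    qed
    finally have e: "exp ((g z - g 0) / 3) ^ 3 = sinh_cubic_quotient z / (1 / 6)" .
    have "complex_of_real (root 3 (1 / 6)) ^ 3 = of_real (root 3 (1 / 6) ^ 3)" by (rule of_real_power[symmetric])
    also have "root 3 (1 / 6 :: real) ^ 3 = 1 / 6" by (rule real_root_pow_pos2) auto
    finally have r: "complex_of_real (root 3 (1 / 6)) ^ 3 = of_real (1 / 6)" .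
    show ?thesis unfolding P_def power_mult_distrib e r by simp
  qed
  moreover have "P holomorphic_on wide_strip" unfolding P_def by (intro holomorphic_intros g) simp_all
  moreover have "P 0 = of_real (root 3 (1 / 6))" by (simp add: P_def)
  ultimately show ?thesis by blast
qed

definition sinh_cubic_root :: "complex \<Rightarrow> complex" where
  "sinh_cubic_root = (SOME P. P holomorphic_on wide_strip \<and>
     (\<forall>z\<in>wide_strip. P z ^ 3 = sinh_cubic_quotient z) \<and> P 0 = of_real (root 3 (1 / 6)))"

lemma holomorphic_sinh_cubic_root: "sinh_cubic_root holomorphic_on wide_strip"
  and sinh_cubic_root_cube: "\<And>z. \<bar>Im z\<bar> < 2 * pi \<Longrightarrow> sinh_cubic_root z ^ 3 = sinh_cubic_quotient z"
  and sinh_cubic_root_0: "sinh_cubic_root 0 = of_real (root 3 (1 / 6))"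
  using someI_ex[OF sinh_cubic_root_exists] unfolding sinh_cubic_root_def by auto

lemma sinh_cubic_root_neq_0: "\<bar>Im z\<bar> < 2 * pi \<Longrightarrow> sinh_cubic_root z \<noteq> 0"
  using sinh_cubic_root_cube[of z] sinh_cubic_quotient_neq_0[of z] by auto

lemma continuous_sinh_cubic_root: "continuous_on wide_strip sinh_cubic_root"
  by (rule holomorphic_on_imp_continuous_on[OF holomorphic_sinh_cubic_root])

lemma sinh_cubic_root_minus:
  assumes "\<bar>Im z\<bar> < 2 * pi"
  shows "sinh_cubic_root (- z) = sinh_cubic_root z"
proof (rule cube_root_unique[where S = wide_strip and f = "\<lambda>z. sinh_cubic_root (- z)" and g = sinh_cubic_root and z = z])
  show "continuous_on wide_strip (\<lambda>z. sinh_cubic_root (- z))"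
    by (rule continuous_on_compose2[OF continuous_sinh_cubic_root]) (auto intro!: continuous_intros)
  show "sinh_cubic_root (- z) ^ 3 = sinh_cubic_root z ^ 3" if "z \<in> wide_strip" for z
    using that sinh_cubic_root_cube[of z] sinh_cubic_root_cube[of "- z"]
    by (simp add: sinh_cubic_quotient_def) (simp add: divide_simps)
qed (use assms in \<open>auto intro: convex_connected convex_strip continuous_sinh_cubic_root simp: sinh_cubic_root_neq_0\<close>)

lemma sinh_cubic_root_cnj:
  assumes "\<bar>Im z\<bar> < 2 * pi"
  shows "sinh_cubic_root (cnj z) = cnj (sinh_cubic_root z)"
proof -
  have "cnj (sinh_cubic_root (cnj z)) = sinh_cubic_root z"
  proof (rule cube_root_unique[where S = wide_strip and f = "\<lambda>z. cnj (sinh_cubic_root (cnj z))" and g = sinh_cubic_root and z = z])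
    show "continuous_on wide_strip (\<lambda>z. cnj (sinh_cubic_root (cnj z)))"
      by (intro continuous_intros continuous_on_compose2[OF continuous_sinh_cubic_root]) auto
    show "cnj (sinh_cubic_root (cnj z)) ^ 3 = sinh_cubic_root z ^ 3" if "z \<in> wide_strip" for z
    proof -
      have "sinh_cubic_quotient (cnj z) = cnj (sinh_cubic_quotient z)"
        by (simp add: sinh_cubic_quotient_def sinh_field_def exp_cnj)
      then show ?thesis
        using that sinh_cubic_root_cube[of z] sinh_cubic_root_cube[of "cnj z"]
        by (simp flip: complex_cnj_power)
    qed
  qed (use assms in \<open>auto intro: convex_connected convex_strip continuous_sinh_cubic_root simp: sinh_cubic_root_neq_0 sinh_cubic_root_0\<close>)
  then show ?thesis by (metis complex_cnj_cnj)
qed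

text \<open>On either axis conjugation is the identity or the reflection at 0. The root commutes
  with conjugation and is even, so it is real there, and a real number with positive cube is
  positive.\<close>

lemma sinh_cubic_root_pos:
  assumes z: "\<bar>Im z\<bar> < 2 * pi" and eq: "cnj z = z \<or> cnj z = - z" and pos: "Re (sinh_cubic_quotient z) > 0"
  shows "sinh_cubic_root z = of_real (Re (sinh_cubic_root z))" (is ?A) "Re (sinh_cubic_root z) > 0"
proof -
  have "cnj (sinh_cubic_root z) = sinh_cubic_root z"
    using eq sinh_cubic_root_cnj[OF z] sinh_cubic_root_minus[OF z] by auto
  then show r: ?A
    by (simp add: complex_eq_iff)
  have "Re (sinh_cubic_root z) ^ 3 = Re (sinh_cubic_root z ^ 3)" by (subst (2) r) simp
  also have "\<dots> > 0" using pos sinh_cubic_root_cube[OF z] by simp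
  finally show "Re (sinh_cubic_root z) > 0" by (simp add: zero_less_power_eq)
qed

text \<open>The \<open>\<phi>\<close> of the overview: the factor \<open>z\<close> makes the even
  root odd and restores the zero at 0.\<close>

definition sinh_root :: "complex \<Rightarrow> complex" where
  "sinh_root z = z * sinh_cubic_root z"

lemma holomorphic_sinh_root: "sinh_root holomorphic_on wide_strip"
  unfolding sinh_root_def by (intro holomorphic_intros holomorphic_sinh_cubic_root)

lemma sinh_root_cube: "\<bar>Im z\<bar> < 2 * pi \<Longrightarrow> sinh_root z ^ 3 = sinh z - z"
  unfolding sinh_root_def power_mult_distrib by (simp add: sinh_cubic_root_cube sinh_cubic_quotient_mult)

lemma sinh_root_minus: "\<bar>Im z\<bar> < 2 * pi \<Longrightarrow> sinh_root (- z) = - sinh_root z"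
  and sinh_root_cnj: "\<bar>Im z\<bar> < 2 * pi \<Longrightarrow> sinh_root (cnj z) = cnj (sinh_root z)"
  by (simp_all add: sinh_root_def sinh_cubic_root_minus sinh_cubic_root_cnj)

lemma sinh_root_eq_0_iff: "\<bar>Im z\<bar> < 2 * pi \<Longrightarrow> sinh_root z = 0 \<longleftrightarrow> z = 0"
  by (simp add: sinh_root_def sinh_cubic_root_neq_0)

lemma sinh_root_of_real:
  assumes x: "x > 0"
  shows "sinh_root (of_real x) = of_real (Re (sinh_root (of_real x)))" (is ?A) "Re (sinh_root (of_real x)) > 0"
proof -
  have "sinh_cubic_quotient (of_real x) = of_real ((sinh x - x) / x ^ 3)"
    using x by (simp add: sinh_cubic_quotient_def sinh_field_def exp_of_real flip: of_real_minus)
  then have "Re (sinh_cubic_quotient (of_real x)) > 0"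
    using x sinh_real_bounds(1)[OF x] by simp
  note P = sinh_cubic_root_pos[OF _ _ this, simplified]
  show ?A
    unfolding sinh_root_def by (subst (1 2) P(1)) simp
  show "Re (sinh_root (of_real x)) > 0" using P(2) x by (simp add: sinh_root_def)
qed

lemma sinh_root_imaginary:
  assumes y: "0 < y" "y < 2 * pi"
  shows "\<exists>r>0. sinh_root (\<i> * of_real y) = \<i> * of_real r"
proof -
  have "(\<i> * complex_of_real y) ^ 3 = - \<i> * of_real (y ^ 3)"
    by (simp add: power3_eq_cube complex_eq_iff)
  moreover have "sinh (\<i> * complex_of_real y) = \<i> * of_real (sin y)"
    by (simp add: complex_eq_iff Re_sinh_complex Im_sinh_complex)
  ultimately have "sinh_cubic_quotient (\<i> * of_real y) = of_real ((y - sin y) / y ^ 3)"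
    using y by (simp add: sinh_cubic_quotient_def divide_simps) (simp add: algebra_simps)
  moreover have "sin y < y" using y by (intro sin_less_self)
  ultimately have "Re (sinh_cubic_quotient (\<i> * of_real y)) > 0" using y by simp
  note P = sinh_cubic_root_pos[OF _ _ this]
  show ?thesis
  proof (intro exI conjI)
    show "y * Re (sinh_cubic_root (\<i> * of_real y)) > 0" using P(2) y by simp
    show "sinh_root (\<i> * of_real y) = \<i> * of_real (y * Re (sinh_cubic_root (\<i> * of_real y)))"
      unfolding sinh_root_def by (subst P(1)) (use y in auto)
  qed
qed

text \<open>
  Otherwise the image of the half strip, which is connected and close to \<open>0\<close> meets the open first
  quadrant, would meet one of the half axes bounding that quadrant, where \<open>sinh z - z\<close> is
  either positive or a negative multiple of \<open>\<i>\<close>.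
\<close>

lemma sinh_root_first_quadrant:
  assumes z: "Re z > 0" "0 < Im z" "Im z \<le> 3 * pi / 2"
  shows "Re (sinh_root z) > 0 \<and> Im (sinh_root z) > 0"
proof (rule ccontr)
  assume neg: "\<not> ?thesis"
  define D where "D = {z. Re z > 0} \<inter> ({z. 0 < Im z} \<inter> {z. Im z \<le> 3 * pi / 2})"
  have D: "convex D" unfolding D_def
    by (intro convex_Int convex_halfspace_Re_gt convex_halfspace_Im_gt convex_halfspace_Im_le)
  have sub: "D \<subseteq> wide_strip" unfolding D_def using pi_gt_zero by auto
  define Q1 where "Q1 = {w. Re w > 0} \<inter> {w. Im w > 0}"
  \<comment> \<open>\<open>Q1\<close> and \<open>Q2\<close> are open and disjoint, and together omit
    only the two half axes bounding the quadrant, with 0.\<close>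
  define Q2 where "Q2 = {w. Re w < 0} \<union> {w. Im w < 0}"
  have "open Q1" "open Q2" unfolding Q1_def Q2_def
    by (auto intro!: open_halfspace_Re_gt open_halfspace_Im_gt open_halfspace_Re_lt open_halfspace_Im_lt)
  have cover: "sinh_root u \<in> Q1 \<union> Q2" if u: "u \<in> D" for u
  proof (rule ccontr)
    assume "sinh_root u \<notin> Q1 \<union> Q2"
    then have nn: "Re (sinh_root u) \<ge> 0" "Im (sinh_root u) \<ge> 0" and or: "Re (sinh_root u) = 0 \<or> Im (sinh_root u) = 0"
      by (auto simp: Q1_def Q2_def)
    define a b where "a = Re (sinh_root u)" and "b = Im (sinh_root u)"
    have ab: "sinh_root u = Complex a b" by (simp add: a_def b_def)
    have cube: "sinh u - u = Complex a b ^ 3" using sinh_root_cube[of u] u sub by (auto simp: ab)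
    have "Re (sinh u - u) \<ge> 0 \<and> Im (sinh u - u) \<le> 0"
      using or nn unfolding cube a_def[symmetric] b_def[symmetric]
      by (auto simp: power3_eq_cube)
    then have "sinh (Re u) * cos (Im u) \<ge> Re u" "cosh (Re u) * sin (Im u) \<le> Im u"
      by (auto simp: Re_sinh_complex Im_sinh_complex)
    then show False
      using sinh_cos_ge_imp_cosh_sin_gt[of "Re u" "Im u"] u pi_gt_zero by (auto simp: D_def)
  qed
  have "connected (sinh_root ` D)"
    using holomorphic_on_imp_continuous_on[OF holomorphic_sinh_root] D sub
    by (intro connected_continuous_image convex_connected) (auto intro: continuous_on_subset)
  moreover have "Q1 \<inter> Q2 \<inter> sinh_root ` D = {}" by (auto simp: Q1_def Q2_def)
  moreover have "sinh_root ` D \<subseteq> Q1 \<union> Q2" using cover by auto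
  moreover have "Q2 \<inter> sinh_root ` D \<noteq> {}"
    using neg cover[of z] z by (auto simp: D_def Q1_def)
  ultimately have no: "Q1 \<inter> sinh_root ` D = {}"
    using connectedD[of "sinh_root ` D" Q1 Q2] \<open>open Q1\<close> \<open>open Q2\<close> by blast
  \<comment> \<open>Near 0 the map is close to multiplication by \<open>k\<close>, so a small point
    on the diagonal goes into \<open>Q1\<close>: deviations below \<open>k / 4\<close> in both parts
    leave \<open>p - q\<close> and \<open>p + q\<close> positive.\<close>
  define k where "k = root 3 (1 / 6 :: real)"
  have k: "k > 0" by (simp add: k_def)
  have "isCont sinh_cubic_root 0"
    using continuous_sinh_cubic_root open_strip[of "2 * pi"] by (simp add: continuous_on_eq_continuous_at)
  then obtain d where d: "d > 0" "\<And>u. dist u 0 < d \<Longrightarrow> dist (sinh_cubic_root u) (of_real k) < k / 4"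
    unfolding continuous_at_eps_delta sinh_cubic_root_0[folded k_def]
    using k by (metis zero_less_divide_iff zero_less_numeral)
  define e where "e = min (d / 4) 1"
  have e: "e > 0" "e \<le> d / 4" "e \<le> 1" using d by (auto simp: e_def)
  define u where "u = Complex e e"
  have "norm u \<le> e + e" using e cmod_le[of u] by (simp add: u_def)
  then have "dist u 0 < d" using e by simp
  then have n: "norm (sinh_cubic_root u - of_real k) < k / 4" using d(2) by (simp add: dist_norm)
  define p q where "p = Re (sinh_cubic_root u)" and "q = Im (sinh_cubic_root u)"
  have "\<bar>p - k\<bar> < k / 4" "\<bar>q\<bar> < k / 4"
    using n abs_Re_le_cmod[of "sinh_cubic_root u - of_real k"] abs_Im_le_cmod[of "sinh_cubic_root u - of_real k"]
    by (auto simp: p_def q_def)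
  then have "p - q > 0" "p + q > 0" by linarith+
  then have "e * (p - q) > 0" "e * (p + q) > 0" using e by auto
  then have "sinh_root u \<in> Q1"
    by (simp add: Q1_def sinh_root_def u_def p_def q_def algebra_simps)
  moreover have "u \<in> D" using e pi_gt3 by (simp add: D_def u_def)
  ultimately show False using no by blast
qed

section \<open>Residues of odd functions on a strip\<close>

lemma contour_integral_linepath_same_Im:
  assumes ab: "a < b" and cont: "continuous_on (closed_segment (Complex a c) (Complex b c)) f"
  shows "contour_integral (linepath (Complex a c) (Complex b c)) f = (LBINT x:{a..b}. f (Complex x c))"
proof -
  have lin: "linepath (Complex a c) (Complex b c) t = Complex (a + (b - a) * t) c" for t
    by (simp add: linepath_def complex_eq_iff algebra_simps)
  have "continuous_on {0..1} (\<lambda>t. f (linepath (Complex a c) (Complex b c) t))"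
    by (rule continuous_on_compose2[OF cont]) (auto intro!: continuous_intros simp: linepath_in_path)
  then have int: "set_integrable lborel {0..1} (\<lambda>t. f (linepath (Complex a c) (Complex b c) t))"
    unfolding set_integrable_def by (intro borel_integrable_compact) auto
  have "contour_integral (linepath (Complex a c) (Complex b c)) f =
      (Complex b c - Complex a c) * integral {0..1} (\<lambda>t. f (linepath (Complex a c) (Complex b c) t))"
    by (simp add: contour_integral_integral)
  also have "integral {0..1} (\<lambda>t. f (linepath (Complex a c) (Complex b c) t)) =
      (LBINT t:{0..1}. f (Complex (a + (b - a) * t) c))"
    using set_borel_integral_eq_integral(2)[OF int] by (simp add: lin)
  also have "Complex b c - Complex a c = of_real (b - a)" by (simp add: complex_eq_iff)
  also have "of_real (b - a) * (LBINT t:{0..1}. f (Complex (a + (b - a) * t) c)) = (LBINT x:{a..b}. f (Complex x c))"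
  proof -
    have ind: "indicator {a..b} (a + (b - a) * t) = (indicator {0..1} t :: real)" for t
    proof -
      have "a \<le> a + (b - a) * t \<longleftrightarrow> 0 \<le> t" using ab by (simp add: zero_le_mult_iff)
      moreover have "a + (b - a) * t \<le> b \<longleftrightarrow> (b - a) * t \<le> (b - a) * 1" by auto
      moreover have "(b - a) * t \<le> (b - a) * 1 \<longleftrightarrow> t \<le> 1" using ab by (subst mult_le_cancel_left_pos) auto
      ultimately show ?thesis by (simp add: indicator_def)
    qed
    show ?thesis
      unfolding set_lebesgue_integral_def
      using lborel_integral_real_affine[of "b - a" "\<lambda>x. indicator {a..b} x *\<^sub>R f (Complex x c)" a] ab
      by (simp add: ind scaleR_conv_of_real)
  qed
  finally show ?thesis .
qed

lemma tendsto_integral_symmetric_intervals: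
  fixes f :: "real \<Rightarrow> 'a :: {banach, second_countable_topology}"
  assumes f: "integrable lborel f"
  shows "(\<lambda>n. LBINT x:{- real n..real n}. f x) \<longlonglongrightarrow> integral\<^sup>L lborel f"
  unfolding set_lebesgue_integral_def
proof (rule integral_dominated_convergence[where w = "\<lambda>x. norm (f x)"])
  show "AE x in lborel. (\<lambda>n. indicator {- real n..real n} x *\<^sub>R f x) \<longlonglongrightarrow> f x"
  proof (intro AE_I2 tendsto_eventually)
    fix x :: real
    obtain N where "\<bar>x\<bar> < real N" using reals_Archimedean2 by blast
    then show "eventually (\<lambda>n. indicator {- real n..real n} x *\<^sub>R f x = f x) sequentially"
      by (intro eventually_sequentiallyI[of N]) (auto simp: indicator_def)
  qed
qed (use f in \<open>auto simp: indicator_def\<close>)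

text \<open>
  For odd integrands the two horizontal sides of the rectangle contribute equally to the
  residue theorem.
\<close>

lemma odd_strip_integral:
  fixes f :: "complex \<Rightarrow> complex"
  assumes cd: "0 < c" "c < d" and pts: "finite pts" "\<And>p. p \<in> pts \<Longrightarrow> \<bar>Im p\<bar> < c"
    and hol: "f holomorphic_on {z. \<bar>Im z\<bar> < d} - pts"
    and odd: "\<And>z. \<bar>Im z\<bar> < d \<Longrightarrow> f (- z) = - f z"
    and int: "integrable lborel (\<lambda>a. f (Complex a (- c)))"
    and decay: "\<And>\<epsilon>. \<epsilon> > 0 \<Longrightarrow> \<exists>R. \<forall>x\<ge>R. \<forall>y. \<bar>y\<bar> \<le> c \<longrightarrow> norm (f (Complex x y)) \<le> \<epsilon>"
  shows "(LBINT a. f (Complex a (- c))) = of_real pi * \<i> * (\<Sum>p\<in>pts. residue f p)"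
proof -
  define T where "T = 2 * pi * \<i> * (\<Sum>p\<in>pts. residue f p)"
  define I where "I = (\<lambda>n::nat. LBINT x:{- real n..real n}. f (Complex x (- c)))"
  define S where "S = {z. \<bar>Im z\<bar> < d}"
  obtain B where B: "\<And>p. p \<in> pts \<Longrightarrow> norm p \<le> B" using pts(1) finite_imp_bounded bounded_iff by metis
  \<comment> \<open>Up to sign, \<open>2 * I n - T\<close> is the integral over the two vertical
    sides; each has length \<open>2 * c\<close>, whence the factor \<open>4 * c\<close>.\<close>
  have main: "\<exists>N. \<forall>n\<ge>N. norm (2 * I n - T) \<le> \<epsilon> * (4 * c)" if eps: "\<epsilon> > 0" for \<epsilon>
  proof -
    obtain R where R: "\<And>x y. x \<ge> R \<Longrightarrow> \<bar>y\<bar> \<le> c \<Longrightarrow> norm (f (Complex x y)) \<le> \<epsilon>"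
      using decay[OF eps] by blast
    obtain N where N: "max (max R (B + 1)) 1 \<le> real N" using real_arch_simple by blast
    show ?thesis
    proof (intro exI[of _ N] allI impI)
      fix n assume "n \<ge> N"
      define r where "r = real n"
      have r: "r \<ge> R" "r > B" "r > 0" using N \<open>n \<ge> N\<close> by (auto simp: r_def)
      define a1 a2 a3 a4 where "a1 = Complex (- r) (- c)" and "a2 = Complex r (- c)" and "a3 = Complex r c" and "a4 = Complex (- r) c"
      have re: "\<bar>Re p\<bar> < r" if "p \<in> pts" for p
        using B[OF that] r(2) abs_Re_le_cmod[of p] by linarith
      have box: "p \<in> box a1 a3" if "p \<in> pts" for p
        using re[OF that] pts(2)[OF that] by (auto simp: in_box_complex_iff a1_def a3_def)
      have image: "path_image (rectpath a1 a3) \<subseteq> S - pts"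
      proof
        fix z assume z: "z \<in> path_image (rectpath a1 a3)"
        have le: "Re a1 \<le> Re a3" "Im a1 \<le> Im a3" using r cd by (auto simp: a1_def a3_def)
        have "z \<in> cbox a1 a3" using z path_image_rectpath_subset_cbox[OF le] by blast
        then have "z \<in> S" using cd by (auto simp: S_def in_cbox_complex_iff a1_def a3_def)
        moreover have "z \<notin> box a1 a3" using z path_image_rectpath_inter_box[OF le] by blast
        ultimately show "z \<in> S - pts" using box by blast
      qed
      have rect: "rectpath a1 a3 = linepath a1 a2 +++ linepath a2 a3 +++ linepath a3 a4 +++ linepath a4 a1"
        by (simp add: rectpath_def a1_def a2_def a3_def a4_def Let_def)
      have segs: "closed_segment a1 a2 \<union> closed_segment a2 a3 \<union> closed_segment a3 a4 \<union> closed_segment a4 a1 \<subseteq> S - pts"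
        using image unfolding rect by (simp add: path_image_join Un_assoc)
      have cont: "continuous_on (S - pts) f" unfolding S_def by (rule holomorphic_on_imp_continuous_on[OF hol])
      have segc: "continuous_on (closed_segment a1 a2) f" "continuous_on (closed_segment a2 a3) f"
          "continuous_on (closed_segment a3 a4) f" "continuous_on (closed_segment a4 a1) f"
        by (rule continuous_on_subset[OF cont], use segs in blast)+
      note ci = segc[THEN contour_integrable_continuous_linepath]
      have "contour_integral (rectpath a1 a3) f = 2 * pi * \<i> * (\<Sum>p\<in>pts. winding_number (rectpath a1 a3) p * residue f p)"
      proof (rule Residue_theorem)
        show "open S" "connected S" unfolding S_def by (auto intro: open_strip convex_connected convex_strip)
        show "\<forall>z. z \<notin> S \<longrightarrow> winding_number (rectpath a1 a3) z = 0"
        proof (intro allI impI)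
          fix z assume "z \<notin> S"
          moreover have "path_image (rectpath a1 a3) \<subseteq> S" using image by blast
          ultimately show "winding_number (rectpath a1 a3) z = 0"
            using convex_strip[of d] unfolding S_def
            by (intro winding_number_zero_outside[where s = "{z. \<bar>Im z\<bar> < d}"]) simp_all
        qed
        show "f holomorphic_on S - pts" using hol by (simp add: S_def)
      qed (use image pts in auto)
      also have "(\<Sum>p\<in>pts. winding_number (rectpath a1 a3) p * residue f p) = (\<Sum>p\<in>pts. residue f p)"
        using box by (intro sum.cong refl) (simp add: winding_number_rectpath)
      finally have "contour_integral (rectpath a1 a3) f = T" by (simp add: T_def)
      moreover have "contour_integral (rectpath a1 a3) f = contour_integral (linepath a1 a2) f +
          (contour_integral (linepath a2 a3) f + (contour_integral (linepath a3 a4) f + contour_integral (linepath a4 a1) f))"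
        unfolding rect using ci by (simp add: contour_integrable_joinI)
      moreover have "contour_integral (linepath a1 a2) f = I n"
        unfolding a1_def a2_def I_def r_def[symmetric]
        by (rule contour_integral_linepath_same_Im) (use r segc(1) in \<open>auto simp: a1_def a2_def\<close>)
      \<comment> \<open>The upper side runs backwards, and after reflecting \<open>x\<close> the
        integrand changes sign by oddness; the two signs cancel.\<close>
      moreover have "contour_integral (linepath a3 a4) f = I n"
      proof -
        have "contour_integral (linepath a3 a4) f = - contour_integral (linepath a4 a3) f"
          using contour_integral_reversepath[of "linepath a4 a3" f] by simp
        also have "contour_integral (linepath a4 a3) f = (LBINT x:{- r..r}. f (Complex x c))"
          unfolding a3_def a4_def
          by (rule contour_integral_linepath_same_Im) (use r segc(3) in \<open>auto simp: a3_def a4_def closed_segment_commute\<close>)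
        also have "\<dots> = (LBINT x:{- r..r}. f (Complex (- x) c))"
          unfolding set_lebesgue_integral_def
          by (subst lborel_integral_real_affine[where c = "-1" and t = 0])
            (auto intro!: Bochner_Integration.integral_cong simp: indicator_def)
        also have "\<dots> = (LBINT x:{- r..r}. - f (Complex x (- c)))"
        proof -
          have "f (Complex (- x) c) = - f (Complex x (- c))" for x
          proof -
            have "Complex (- x) c = - Complex x (- c)" by (simp add: complex_eq_iff)
            then show ?thesis using odd[of "Complex x (- c)"] cd by simp
          qed
          then show ?thesis by simp
        qed
        also have "\<dots> = - I n" unfolding I_def r_def set_lebesgue_integral_def by simp
        finally show ?thesis by simp
      qed
      moreover have "norm (contour_integral (linepath a2 a3) f) \<le> \<epsilon> * norm (a3 - a2)"
      proof (rule contour_integral_bound_linepath[OF ci(2)])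
        fix z assume "z \<in> closed_segment a2 a3"
        then have "Re z = r" "Im z \<in> {- c..c}" using cd
          by (auto simp: a2_def a3_def closed_segment_same_Re closed_segment_eq_real_ivl)
        moreover from this have "z = Complex r (Im z)" by (simp add: complex_eq_iff)
        ultimately show "norm (f z) \<le> \<epsilon>" using R[of r "Im z"] r(1) by (metis abs_le_iff atLeastAtMost_iff minus_le_iff)
      qed (use eps in simp)
      moreover have "norm (contour_integral (linepath a4 a1) f) \<le> \<epsilon> * norm (a1 - a4)"
      proof (rule contour_integral_bound_linepath[OF ci(4)])
        fix z assume "z \<in> closed_segment a4 a1"
        then have z: "Re z = - r" "Im z \<in> {- c..c}" using cd
          by (auto simp: a1_def a4_def closed_segment_same_Re closed_segment_eq_real_ivl)
        then have "z = - Complex r (- Im z)" by (simp add: complex_eq_iff)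
        moreover have "f (- Complex r (- Im z)) = - f (Complex r (- Im z))" using z cd by (intro odd) auto
        ultimately have "norm (f z) = norm (f (Complex r (- Im z)))" by (metis norm_minus_cancel)
        then show "norm (f z) \<le> \<epsilon>" using R[of r "- Im z"] r(1) z by auto
      qed (use eps in simp)
      moreover have "norm (a3 - a2) = 2 * c" "norm (a1 - a4) = 2 * c"
      proof -
        have "a3 - a2 = \<i> * of_real (2 * c)" "a1 - a4 = - (\<i> * of_real (2 * c))"
          by (simp_all add: a1_def a2_def a3_def a4_def complex_eq_iff)
        then show "norm (a3 - a2) = 2 * c" "norm (a1 - a4) = 2 * c" using cd by (simp_all add: norm_mult)
      qed
      moreover have "2 * I n - T = - (contour_integral (linepath a2 a3) f + contour_integral (linepath a4 a1) f)"
      proof -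
        have "T = I n + (contour_integral (linepath a2 a3) f + (I n + contour_integral (linepath a4 a1) f))"
          using calculation(1-4) by simp
        then show ?thesis by simp
      qed
      ultimately have "norm (2 * I n - T) \<le> \<epsilon> * (2 * c) + \<epsilon> * (2 * c)"
        by (metis norm_minus_cancel norm_triangle_mono)
      then show "norm (2 * I n - T) \<le> \<epsilon> * (4 * c)" by simp
    qed
  qed
  have "(\<lambda>n. 2 * I n) \<longlonglongrightarrow> T"
  proof (rule LIMSEQ_I)
    fix r :: real assume "r > 0"
    then have "r / (8 * c) > 0" using cd by simp
    then obtain N where N: "\<And>n. n \<ge> N \<Longrightarrow> norm (2 * I n - T) \<le> r / (8 * c) * (4 * c)" using main by blast
    have "r / (8 * c) * (4 * c) < r" using \<open>r > 0\<close> cd by simp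
    then show "\<exists>N. \<forall>n\<ge>N. norm (2 * I n - T) < r" using N le_less_trans by blast
  qed
  moreover have "(\<lambda>n. 2 * I n) \<longlonglongrightarrow> 2 * (LBINT a. f (Complex a (- c)))"
    unfolding I_def by (intro tendsto_intros tendsto_integral_symmetric_intervals int)
  ultimately have "T = 2 * (LBINT a. f (Complex a (- c)))" by (rule LIMSEQ_unique)
  then show ?thesis by (simp add: T_def mult_ac)
qed

section \<open>The cube root on the line \<open>Im z = - 3 * pi / 2\<close>\<close>

definition hankel_phase :: "real \<Rightarrow> complex" where
  "hankel_phase a = of_real (cosh a + 3 * pi / 2) + \<i> * of_real a"

text \<open>The factor \<open>\<i>\<close> has cube \<open>- \<i>\<close>, matching
  \<open>s(a) = - \<i> * (sinh z - z)\<close>, and it turns the lower half-plane, where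
  \<open>\<phi>\<close> lies on this line, into the right half-plane.\<close>

definition phase_root :: "real \<Rightarrow> complex" where
  "phase_root a = \<i> * sinh_root (Complex a (- (3 * pi / 2)))"

lemma Im_less_2_pi: "\<bar>y\<bar> \<le> 3 * pi / 2 \<Longrightarrow> \<bar>y\<bar> < 2 * pi"
  using pi_gt_zero by linarith

lemma cos_sin_3pi2: "cos (3 * pi / 2) = 0" "sin (3 * pi / 2) = - 1"
proof -
  have e: "3 * pi / 2 = pi / 2 + pi" by simp
  show "cos (3 * pi / 2) = 0" "sin (3 * pi / 2) = - 1" by (simp_all only: e cos_add sin_add cos_pi sin_pi cos_pi_half sin_pi_half)
qed

lemma hankel_phase_Re: "Re (hankel_phase a) = cosh a + 3 * pi / 2"
  by (simp add: hankel_phase_def)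

lemma hankel_phase_Re_ge: "Re (hankel_phase a) \<ge> exp \<bar>a\<bar> / 2" "Re (hankel_phase a) \<ge> 1"
  using cosh_ge_half_exp_abs[of a] cosh_real_ge_1[of a] pi_gt_zero unfolding hankel_phase_Re by linarith+

lemma phase_root_cube: "phase_root a ^ 3 = hankel_phase a"
proof -
  have "\<bar>Im (Complex a (- (3 * pi / 2)))\<bar> < 2 * pi" using Im_less_2_pi[of "- (3 * pi / 2)"] by simp
  then have "phase_root a ^ 3 = \<i> ^ 3 * (sinh (Complex a (- (3 * pi / 2))) - Complex a (- (3 * pi / 2)))"
    unfolding phase_root_def power_mult_distrib by (subst sinh_root_cube) auto
  also have "\<dots> = hankel_phase a"
    by (simp add: complex_eq_iff Re_sinh_complex Im_sinh_complex hankel_phase_def power3_eq_cube cos_sin_3pi2)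
  finally show ?thesis .
qed

text \<open>The claim is that \<open>\<phi>\<close> has negative imaginary part on the line.
  Conjugation for \<open>a > 0\<close> and negation for \<open>a < 0\<close> move the point into the
  first quadrant, where the location of \<open>\<phi>\<close> is known; for \<open>a = 0\<close> it
  lies on the imaginary axis.\<close>

lemma phase_root_Re_pos: "Re (phase_root a) > 0"
proof -
  define z where "z = Complex a (- (3 * pi / 2))"
  have z: "\<bar>Im z\<bar> < 2 * pi" using Im_less_2_pi[of "- (3 * pi / 2)"] by (simp add: z_def)
  have Re: "Re (phase_root a) = - Im (sinh_root z)" by (simp add: phase_root_def z_def)
  consider "a > 0" | "a < 0" | "a = 0" by linarith
  then show ?thesis
  proof cases
    case 1
    then have "Im (sinh_root (cnj z)) > 0" using sinh_root_first_quadrant[of "cnj z"] by (simp add: z_def)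
    then show ?thesis using Re sinh_root_cnj[OF z] by simp
  next
    case 2
    then have "Im (sinh_root (- z)) > 0" using sinh_root_first_quadrant[of "- z"] by (simp add: z_def)
    then show ?thesis using Re sinh_root_minus[OF z] by simp
  next
    case 3
    have m: "- z = \<i> * of_real (3 * pi / 2)" using 3 by (simp add: z_def complex_eq_iff)
    obtain r where r: "r > 0" "sinh_root (\<i> * of_real (3 * pi / 2)) = \<i> * of_real r"
      using sinh_root_imaginary[of "3 * pi / 2"] pi_gt_zero by auto
    have "Im (sinh_root (- z)) > 0" unfolding m r(2) using r(1) by simp
    then show ?thesis using Re sinh_root_minus[OF z] by simp
  qed
qed

lemma phase_root_neq_0: "phase_root a \<noteq> 0"
  using phase_root_Re_pos[of a] by auto

text \<open>Positivity of the real part of the cube leaves three sectors of opening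
  \<open>pi / 3\<close>; \<open>Re \<sigma> > 0\<close> singles out the one around the positive
  axis.\<close>

lemma phase_root_Im_Ln: "\<bar>Im (Ln (phase_root a))\<bar> < pi / 6"
proof -
  define \<sigma> where "\<sigma> = phase_root a"
  define t where "t = \<bar>3 * Im (Ln \<sigma>)\<bar>"
  have "\<bar>Im (Ln \<sigma>)\<bar> < pi / 2"
    using phase_root_Re_pos[of a] phase_root_neq_0[of a] Re_Ln_pos_lt unfolding \<sigma>_def by blast
  then have t: "t < 3 * pi / 2" by (simp add: t_def)
  have "exp (of_nat 3 * Ln \<sigma>) = \<sigma> ^ 3"
    using phase_root_neq_0[of a] by (simp only: exp_of_nat_mult exp_Ln \<sigma>_def not_False_eq_True)
  also have "\<dots> = hankel_phase a" by (simp add: \<sigma>_def phase_root_cube)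
  finally have e: "exp (of_nat 3 * Ln \<sigma>) = hankel_phase a" .
  have "Re (exp (of_nat 3 * Ln \<sigma>)) > 0" unfolding e using hankel_phase_Re_ge(2)[of a] by linarith
  then have "cos (3 * Im (Ln \<sigma>)) > 0" by (simp add: Re_exp zero_less_mult_iff)
  then have "cos t > 0" unfolding t_def by (cases "Im (Ln \<sigma>) \<ge> 0") (auto simp: abs_if)
  then have "t < pi / 2" using cos_nonpos_middle[of t] t by linarith
  then show ?thesis by (simp add: t_def \<sigma>_def)
qed

lemma Re_square_pos_of_Im_Ln:
  assumes "\<sigma> \<noteq> 0" "\<bar>Im (Ln \<sigma>)\<bar> < pi / 6"
  shows "Re (\<sigma>\<^sup>2) > 0"
proof -
  have "exp (of_nat 2 * Ln \<sigma>) = \<sigma>\<^sup>2" using assms(1) by (simp only: exp_of_nat_mult exp_Ln not_False_eq_True)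
  moreover have "Re (exp (of_nat 2 * Ln \<sigma>)) > 0" using assms(2) by (intro Re_exp_pos) simp
  ultimately show ?thesis by simp
qed

lemma continuous_phase_root: "continuous_on UNIV phase_root"
proof -
  have "continuous_on UNIV (\<lambda>a. sinh_root (Complex a (- (3 * pi / 2))))"
  proof (rule continuous_on_compose2[OF holomorphic_on_imp_continuous_on[OF holomorphic_sinh_root]])
    show "continuous_on UNIV (\<lambda>a. Complex a (- (3 * pi / 2)))"
      unfolding Complex_eq by (intro continuous_intros)
    show "(\<lambda>a. Complex a (- (3 * pi / 2))) ` UNIV \<subseteq> wide_strip"
      using Im_less_2_pi[of "- (3 * pi / 2)"] by auto
  qed
  then show ?thesis unfolding phase_root_def by (intro continuous_intros)
qed

lemma borel_measurable_phase_root [measurable]: "phase_root \<in> borel_measurable borel"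
  by (rule borel_measurable_continuous_onI[OF continuous_phase_root])

text \<open>The cube grows at least like \<open>exp \<bar>a\<bar> / 2\<close>. The resulting rate
  \<open>1 / 3\<close> makes even the first inverse power of \<open>\<sigma>\<close> integrable over
  \<open>a\<close>.\<close>

lemma norm_phase_root_ge: "norm (phase_root a) \<ge> exp (\<bar>a\<bar> / 3) / 2" (is ?A) "norm (phase_root a) \<ge> 1" (is ?B)
proof -
  have "norm (phase_root a) ^ 3 = norm (hankel_phase a)"
    by (simp flip: norm_power add: phase_root_cube)
  moreover have "norm (hankel_phase a) \<ge> Re (hankel_phase a)" by (rule complex_Re_le_cmod)
  ultimately have ge: "norm (phase_root a) ^ 3 \<ge> Re (hankel_phase a)" by linarith
  have "Re (hankel_phase a) \<ge> exp \<bar>a\<bar> / 2" by (rule hankel_phase_Re_ge)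
  also have "exp \<bar>a\<bar> / 2 \<ge> (exp (\<bar>a\<bar> / 3) / 2) ^ 3"
  proof -
    have "exp (\<bar>a\<bar> / 3) ^ 3 = exp (of_nat 3 * (\<bar>a\<bar> / 3))" by (simp only: exp_of_nat_mult)
    then show ?thesis by (simp add: power_divide)
  qed
  finally have "(exp (\<bar>a\<bar> / 3) / 2) ^ 3 \<le> norm (phase_root a) ^ 3" using ge by linarith
  then show ?A by (rule power_le_imp_le_base[of _ 2, simplified eval_nat_numeral[symmetric]]) simp
  have "1 ^ 3 \<le> norm (phase_root a) ^ 3" using ge hankel_phase_Re_ge(2)[of a] by simp
  then show ?B by (metis norm_ge_zero power_mono_iff zero_less_numeral zero_le_one)
qed

lemma inverse_norm_phase_root:
  "1 / norm (phase_root a) \<le> 2 * exp (- (1 / 3) * \<bar>a\<bar>)"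
proof -
  have "1 / norm (phase_root a) \<le> 1 / (exp (\<bar>a\<bar> / 3) / 2)"
    using norm_phase_root_ge(1)[of a] by (intro divide_left_mono) (auto intro!: mult_pos_pos simp: phase_root_neq_0)
  then show ?thesis by (simp add: exp_minus inverse_eq_divide)
qed

lemma integrable_phase_root_bound:
  fixes f :: "real \<Rightarrow> complex"
  assumes "f \<in> borel_measurable borel" "\<And>a. norm (f a) \<le> 1 / norm (phase_root a)"
  shows "integrable lborel f"
proof (rule Bochner_Integration.integrable_bound)
  show "integrable lborel (\<lambda>a::real. 2 * exp (- (1 / 3) * \<bar>a\<bar>))"
    by (intro integrable_mult_right integrable_exp_minus_abs) simp
  show "AE a in lborel. norm (f a) \<le> norm (2 * exp (- (1 / 3) * \<bar>a\<bar>))"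
    using order_trans[OF assms(2) inverse_norm_phase_root] by (intro AE_I2) (simp add: abs_of_nonneg)
qed (use assms in simp)

text \<open>The threshold 6 is where the quadratic Taylor bound \<open>(x + x^2 / 2) / 2\<close>
  reaches \<open>2 * x\<close>.\<close>

lemma sinh_ge_double:
  assumes x: "x \<ge> (6::real)"
  shows "sinh x \<ge> 2 * x"
proof -
  have "exp x \<ge> 1 + x + x\<^sup>2 / 2" using exp_lower_Taylor_quadratic x by simp
  moreover have "exp (- x) \<le> 1" using x by simp
  ultimately have "x + x\<^sup>2 / 2 \<le> exp x - exp (- x)" by linarith
  then have "sinh x \<ge> (x + x\<^sup>2 / 2) / 2" unfolding sinh_field_def by (rule divide_right_mono) simp
  moreover have "x\<^sup>2 \<ge> 6 * x" using x by (simp add: power2_eq_square)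
  ultimately show ?thesis by simp
qed

text \<open>Since \<open>\<bar>sinh (x + \<i> y)\<bar>^2 = sinh^2 x + sin^2 y\<close>, the growth is
  uniform in \<open>y\<close>. This gives the decay needed on the vertical sides of the
  rectangles.\<close>

lemma norm_sinh_root_at_top:
  "\<exists>R. \<forall>x\<ge>R. \<forall>y. \<bar>y\<bar> \<le> 3 * pi / 2 \<longrightarrow> M \<le> norm (sinh_root (Complex x y))"
proof -
  define L where "L = \<bar>M\<bar> ^ 3 + 3 * pi / 2"
  have L: "L > 0" using pi_gt_zero by (simp add: L_def add_nonneg_pos)
  show ?thesis
  proof (intro exI[of _ "L + 6"] allI impI)
    fix x y :: real assume x: "L + 6 \<le> x" and y: "\<bar>y\<bar> \<le> 3 * pi / 2"
    have x0: "x > 0" using x L by simp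
    have s: "sinh x \<ge> 2 * x" using x L by (intro sinh_ge_double) simp
    have "\<bar>sinh x\<bar>\<^sup>2 \<le> (norm (sinh (Complex x y)))\<^sup>2"
    proof -
      have "(norm (sinh (Complex x y)))\<^sup>2 = (sinh x)\<^sup>2 * (cos y)\<^sup>2 + (cosh x)\<^sup>2 * (sin y)\<^sup>2"
        unfolding cmod_power2 by (simp add: Re_sinh_complex Im_sinh_complex power_mult_distrib)
      also have "(cosh x)\<^sup>2 = (sinh x)\<^sup>2 + 1" by (rule cosh_square_eq)
      also have "(sinh x)\<^sup>2 * (cos y)\<^sup>2 + ((sinh x)\<^sup>2 + 1) * (sin y)\<^sup>2 = (sinh x)\<^sup>2 + (sin y)\<^sup>2"
      proof -
        have "u * p + (u + 1) * q = u * (p + q) + q" for u p q :: real by (simp add: algebra_simps)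
        then show ?thesis by (simp only: sin_cos_squared_add2 mult_1_right)
      qed
      finally show ?thesis by simp
    qed
    then have "sinh x \<le> norm (sinh (Complex x y))"
      using power2_le_imp_le[of "\<bar>sinh x\<bar>"] by fastforce
    moreover have "norm (Complex x y) \<le> x + 3 * pi / 2" using cmod_le[of "Complex x y"] y x0 by simp
    moreover have "norm (sinh (Complex x y) - Complex x y) \<ge> norm (sinh (Complex x y)) - norm (Complex x y)"
      by (rule norm_triangle_ineq2)
    ultimately have "norm (sinh (Complex x y) - Complex x y) \<ge> x - 3 * pi / 2" using s by linarith
    also have "sinh (Complex x y) - Complex x y = sinh_root (Complex x y) ^ 3"
      using y Im_less_2_pi[of y] by (simp add: sinh_root_cube)
    finally have "x - 3 * pi / 2 \<le> norm (sinh_root (Complex x y)) ^ 3" by (simp only: norm_power)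
    moreover have "\<bar>M\<bar> ^ 3 \<le> x - 3 * pi / 2" using x unfolding L_def by linarith
    ultimately have "norm (sinh_root (Complex x y)) ^ 3 \<ge> \<bar>M\<bar> ^ 3" by linarith
    then have "\<bar>M\<bar> \<le> norm (sinh_root (Complex x y))"
      by (metis norm_ge_zero power_mono_iff zero_less_numeral abs_ge_zero)
    then show "M \<le> norm (sinh_root (Complex x y))" by simp
  qed
qed

section \<open>Poles and residues of the kernel\<close>

lemma residue_quotient_simple_zero:
  assumes S: "open S" "z \<in> S" and hol: "f holomorphic_on S" "g holomorphic_on S"
    and g: "g z = 0" "(g has_field_derivative g') (at z)" "g' \<noteq> 0" "\<And>w. w \<in> S - {z} \<Longrightarrow> g w \<noteq> 0"
  shows "residue (\<lambda>w. f w / g w) z = f z / g'"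
proof (rule residue_simple'[OF S])
  show "(\<lambda>w. f w / g w) holomorphic_on S - {z}"
    using g(4) by (intro holomorphic_intros holomorphic_on_subset[OF hol(1)] holomorphic_on_subset[OF hol(2)]) auto
  have "((\<lambda>w. (g w - g z) / (w - z)) \<longlongrightarrow> g') (at z)"
    using g(2) unfolding has_field_derivative_iff .
  then have inv: "((\<lambda>w. inverse ((g w - g z) / (w - z))) \<longlongrightarrow> inverse g') (at z)"
    using g(3) by (rule tendsto_inverse)
  have "(f \<longlongrightarrow> f z) (at z)"
    using holomorphic_on_imp_continuous_on[OF hol(1)] S continuous_on_eq_continuous_at isCont_def by metis
  from tendsto_mult[OF this inv]
  have "((\<lambda>w. f w * inverse ((g w - g z) / (w - z))) \<longlongrightarrow> f z * inverse g') (at z)" .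
  then show "((\<lambda>w. f w / g w * (w - z)) \<longlongrightarrow> f z / g') (at z)"
    by (simp add: g(1) field_simps)
qed

text \<open>A real \<open>\<phi>(z)\<close> makes \<open>sinh z - z\<close> real, so
  \<open>cosh x * sin y = y\<close>. For \<open>y > 0\<close> this gives \<open>sin y > 0\<close>,
  hence \<open>y < pi\<close>; but there, up to reflection in the imaginary axis,
  \<open>\<phi>\<close> has positive imaginary part. Conjugation settles
  \<open>y < 0\<close>.\<close>

lemma sinh_root_real_imp_Im_eq_0:
  assumes z: "\<bar>Im z\<bar> < 2 * pi" and r: "sinh_root z = of_real r" "r \<noteq> 0"
  shows "Im z = 0"
proof -
  have upper: False if z: "0 < Im z" "Im z < 2 * pi" and r: "sinh_root z = of_real r" "r \<noteq> 0" for z r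
  proof -
    have zs: "\<bar>Im z\<bar> < 2 * pi" using z by simp
    have "sinh z - z = of_real (r ^ 3)" using sinh_root_cube[OF zs] r by simp
    then have "cosh (Re z) * sin (Im z) - Im z = 0"
      by (metis Im_complex_of_real Im_sinh_complex minus_complex.sel(2))
    then have "cosh (Re z) * sin (Im z) > 0" using z by simp
    then have "sin (Im z) > 0" using cosh_real_pos[of "Re z"] by (simp add: zero_less_mult_iff)
    then have "Im z < pi" using sin_le_zero[of "Im z"] z by force
    then have z32: "Im z \<le> 3 * pi / 2" using pi_gt_zero by linarith
    consider "Re z > 0" | "Re z < 0" | "Re z = 0" by linarith
    then show False
    proof cases
      case 1
      then show False using sinh_root_first_quadrant[of z] z z32 r by simp
    next
      case 2
      then have "Im (sinh_root (- cnj z)) > 0" using sinh_root_first_quadrant[of "- cnj z"] z z32 by simp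
      then show False using r zs by (simp add: sinh_root_minus sinh_root_cnj)
    next
      case 3
      then have "z = \<i> * of_real (Im z)" by (simp add: complex_eq_iff)
      then show False using sinh_root_imaginary[of "Im z"] z r by (metis Im_complex_of_real Re_complex_of_real Im_i_times less_irrefl)
    qed
  qed
  show ?thesis
  proof (rule ccontr)
    assume "Im z \<noteq> 0"
    then consider "Im z > 0" | "Im z < 0" by linarith
    then show False
    proof cases
      case 1
      then show False using upper[of z r] z r by simp
    next
      case 2
      have "sinh_root (cnj z) = of_real r" using r z by (simp add: sinh_root_cnj)
      then show False using upper[of "cnj z" r] 2 z r by simp
    qed
  qed
qed

lemma sinh_minus_id_strict_mono:
  assumes "0 \<le> x" "x < (y::real)"
  shows "sinh x - x < sinh y - y"
proof (rule DERIV_pos_imp_increasing_open[OF assms(2)])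
  fix t assume t: "x < t" "t < y"
  have "((\<lambda>x. sinh x - x) has_real_derivative cosh t - 1) (at t)"
    by (auto intro!: derivative_eq_intros)
  moreover have "cosh t > 1" using cosh_real_nonneg_less_iff[of 0 t] t assms by simp
  ultimately show "\<exists>d. ((\<lambda>x. sinh x - x) has_real_derivative d) (at t) \<and> d > 0"
    by (intro exI[of _ "cosh t - 1"]) simp
qed (auto intro!: continuous_intros)

lemma sinh_root_real_cube:
  assumes x: "x > 0"
  shows "Re (sinh_root (of_real x)) ^ 3 = sinh x - x"
proof -
  have "complex_of_real (Re (sinh_root (of_real x)) ^ 3) = sinh_root (of_real x) ^ 3"
    by (subst (2) sinh_root_of_real(1)[OF x]) simp
  also have "\<dots> = sinh (of_real x) - of_real x" by (rule sinh_root_cube) simp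
  also have "\<dots> = of_real (sinh x - x)"
    by (simp add: complex_eq_iff Re_sinh_complex Im_sinh_complex)
  finally show ?thesis by (simp only: of_real_eq_iff)
qed

text \<open>Locates the poles of the kernel: \<open>\<phi>(z) = \<plusminus>\<phi>(T)\<close> is
  real and nonzero, so \<open>z\<close> is real, and \<open>sinh x - x\<close> is strictly
  increasing for \<open>x \<ge> 0\<close>.\<close>

lemma sinh_root_square_eq_iff:
  assumes T: "T > 0" and z: "\<bar>Im z\<bar> < 2 * pi"
  shows "sinh_root z ^ 2 = sinh_root (of_real T) ^ 2 \<longleftrightarrow> z = of_real T \<or> z = - of_real T"
proof
  assume eq: "sinh_root z ^ 2 = sinh_root (of_real T) ^ 2"
  define \<eta> where "\<eta> = Re (sinh_root (of_real T))"
  have \<eta>: "sinh_root (of_real T) = of_real \<eta>" "\<eta> > 0"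
    using sinh_root_of_real[OF T] by (simp_all add: \<eta>_def)
  have pm: "sinh_root z = of_real \<eta> \<or> sinh_root z = of_real (- \<eta>)"
    using eq unfolding \<eta>(1) by (simp add: power2_eq_iff)
  then have "Im z = 0" using sinh_root_real_imp_Im_eq_0[OF z, of \<eta>] sinh_root_real_imp_Im_eq_0[OF z, of "- \<eta>"] \<eta>(2) by auto
  then have zr: "z = of_real (Re z)" by (simp add: complex_eq_iff)
  have pos: "x = T" if "x > 0" "sinh_root (of_real x) = of_real \<eta> \<or> sinh_root (of_real x) = of_real (- \<eta>)" for x
  proof -
    have "Re (sinh_root (of_real x)) = \<eta>"
      using that sinh_root_of_real(2)[OF that(1)] \<eta>(2) by auto
    then have "sinh x - x = sinh T - T"
      using sinh_root_real_cube[OF that(1)] sinh_root_real_cube[OF T] \<eta>_def by simp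
    then show "x = T"
      using sinh_minus_id_strict_mono[of x T] sinh_minus_id_strict_mono[of T x] that T by (cases x T rule: linorder_cases) auto
  qed
  have "Re z \<noteq> 0"
  proof
    assume "Re z = 0"
    then have "z = 0" using zr by simp
    then show False using pm \<eta>(2) by (auto simp: sinh_root_def)
  qed
  then consider "Re z > 0" | "- Re z > 0" by linarith
  then show "z = of_real T \<or> z = - of_real T"
  proof cases
    case 1
    then show ?thesis using pos[of "Re z"] pm zr by metis
  next
    case 2
    have "sinh_root (- z) = of_real (- \<eta>) \<or> sinh_root (- z) = of_real \<eta>"
      using pm z by (auto simp: sinh_root_minus)
    moreover have "- z = of_real (- Re z)" using zr by simp
    ultimately have "- Re z = T" using pos[of "- Re z"] 2 by metis
    then show ?thesis using zr by (metis minus_minus of_real_minus)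
  qed
qed (auto simp: sinh_root_minus)

text \<open>Differentiating the cube gives \<open>3 \<phi>^2 \<phi>' = cosh z - 1\<close>.
  Eliminating \<open>\<phi>'\<close> makes the residues of the kernel explicit.\<close>

lemma sinh_root_square_has_derivative:
  assumes z: "\<bar>Im z\<bar> < 2 * pi" "z \<noteq> 0"
  shows "((\<lambda>z. sinh_root z ^ 2) has_field_derivative 2 * (cosh z - 1) / (3 * sinh_root z)) (at z)"
proof -
  have nz: "sinh_root z \<noteq> 0" using z by (simp add: sinh_root_eq_0_iff)
  have D: "(sinh_root has_field_derivative deriv sinh_root z) (at z)"
    by (rule holomorphic_derivI[OF holomorphic_sinh_root open_strip]) (use z in simp)
  have "((\<lambda>z. sinh_root z ^ 3) has_field_derivative 3 * sinh_root z ^ 2 * deriv sinh_root z) (at z)"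
    using D by (auto intro!: derivative_eq_intros)
  moreover have "((\<lambda>z. sinh_root z ^ 3) has_field_derivative cosh z - 1) (at z)"
  proof (rule has_field_derivative_transform_within_open)
    show "((\<lambda>z. sinh z - z) has_field_derivative cosh z - 1) (at z)"
      by (auto intro!: derivative_eq_intros)
    show "open wide_strip" by (rule open_strip)
  qed (use z in \<open>simp_all add: sinh_root_cube\<close>)
  ultimately have e: "3 * sinh_root z ^ 2 * deriv sinh_root z = cosh z - 1" by (rule DERIV_unique)
  have "2 * (cosh z - 1) / (3 * sinh_root z) = 2 * sinh_root z * deriv sinh_root z"
    unfolding e[symmetric] using nz by (simp add: power2_eq_square)
  moreover have "((\<lambda>z. sinh_root z ^ 2) has_field_derivative 2 * sinh_root z * deriv sinh_root z) (at z)"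
    using D by (auto intro!: derivative_eq_intros)
  ultimately show ?thesis by simp
qed

abbreviation phase_kernel :: "real \<Rightarrow> real \<Rightarrow> complex" where
  "phase_kernel a r \<equiv> phase_root a / (phase_root a ^ 2 + of_real r)"

lemma norm_hankel_phase_kernel:
  assumes "r \<ge> 0"
  shows "norm (phase_kernel a r) \<le> 1 / norm (phase_root a)"
proof -
  have "(norm (phase_root a))\<^sup>2 \<le> norm (phase_root a ^ 2 + of_real r)"
    by (intro norm_square_le_norm_square_add Re_square_pos_of_Im_Ln phase_root_neq_0 phase_root_Im_Ln assms)
  then have "norm (phase_root a) / norm (phase_root a ^ 2 + of_real r) \<le> norm (phase_root a) / (norm (phase_root a))\<^sup>2"
    using phase_root_neq_0[of a] by (intro divide_left_mono mult_pos_pos) (auto intro: less_le_trans[of 0 "(norm (phase_root a))\<^sup>2"])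
  then show ?thesis using phase_root_neq_0[of a] by (simp add: norm_divide power2_eq_square)
qed

text \<open>On the line the kernel is \<open>\<i> \<phi> / (\<phi>(T)^2 - \<phi>^2)\<close>, because
  \<open>q = \<phi>(T)^2\<close>. The two simple poles have equal residues. The denominator
  \<open>cosh T - 1\<close> is the Jacobian of \<open>T \<mapsto> sinh T - T\<close> and will cancel
  when that substitution is made.\<close>

lemma hankel_phase_kernel_integral:
  assumes T: "T > 0"
  defines "q \<equiv> (sinh T - T) powr (2 / 3)"
  shows "integrable lborel (\<lambda>a. phase_kernel a q)" (is ?A)
    and "(LBINT a. phase_kernel a q) =
      of_real (3 * pi * q / (cosh T - 1))" (is ?B)
proof -
  define \<eta> where "\<eta> = Re (sinh_root (of_real T))"
  have \<eta>: "sinh_root (of_real T) = of_real \<eta>" "\<eta> > 0"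
    using sinh_root_of_real[OF T] by (simp_all add: \<eta>_def)
  have "\<eta> ^ 3 = sinh T - T" using sinh_root_real_cube[OF T] by (simp add: \<eta>_def)
  then have "q = (\<eta> powr 3) powr (2 / 3)" using \<eta>(2) by (simp add: q_def)
  also have "\<dots> = \<eta> powr 2" by (subst powr_powr) simp
  finally have q: "q = \<eta>\<^sup>2" using \<eta>(2) by simp
  have coshT: "cosh T > 1" using cosh_real_nonneg_less_iff[of 0 T] T by simp
  define f where "f = (\<lambda>z. \<i> * sinh_root z)"
  define g where "g = (\<lambda>z. of_real q - sinh_root z ^ 2)"
  have line: "f (Complex a (- (3 * pi / 2))) / g (Complex a (- (3 * pi / 2))) =
      phase_kernel a q" for a
    by (simp add: f_def g_def phase_root_def power_mult_distrib)
  have "q \<ge> 0" by (simp add: q)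
  then show int: ?A
    by (intro integrable_phase_root_bound norm_hankel_phase_kernel) measurable
  have c: "0 < 3 * pi / 2" "3 * pi / 2 < 2 * pi" using pi_gt_zero by auto
  have g0: "g z \<noteq> 0" if "\<bar>Im z\<bar> < 2 * pi" "z \<noteq> of_real T" "z \<noteq> - of_real T" for z
    using sinh_root_square_eq_iff[OF T that(1)] that by (auto simp: g_def q \<eta>(1))
  have hf: "f holomorphic_on S" and hg: "g holomorphic_on S" if "S \<subseteq> wide_strip" for S
    unfolding f_def g_def by (intro holomorphic_intros holomorphic_on_subset[OF holomorphic_sinh_root that])+
  define pts where "pts = {complex_of_real T, - of_real T}"
  have "(LBINT a. f (Complex a (- (3 * pi / 2))) / g (Complex a (- (3 * pi / 2)))) =
      of_real pi * \<i> * (\<Sum>p\<in>pts. residue (\<lambda>z. f z / g z) p)"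
  proof (rule odd_strip_integral[OF c])
    show "(\<lambda>z. f z / g z) holomorphic_on wide_strip - pts"
      using g0 by (intro holomorphic_intros hf hg) (auto simp: pts_def)
    show "f (- z) / g (- z) = - (f z / g z)" if "\<bar>Im z\<bar> < 2 * pi" for z
      using that by (simp add: f_def g_def sinh_root_minus)
    show "integrable lborel (\<lambda>a. f (Complex a (- (3 * pi / 2))) / g (Complex a (- (3 * pi / 2))))"
      unfolding line by (rule int)
    show "\<exists>R. \<forall>x\<ge>R. \<forall>y. \<bar>y\<bar> \<le> 3 * pi / 2 \<longrightarrow> norm (f (Complex x y) / g (Complex x y)) \<le> \<epsilon>" if "\<epsilon> > 0" for \<epsilon>
    proof -
      \<comment> \<open>From \<open>n \<ge> 2 * \<eta>\<close> one gets
        \<open>n^2 - q \<ge> n^2 / 2\<close>, so the quotient is at most \<open>2 / n\<close>; and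
        \<open>n \<ge> 2 / \<epsilon>\<close> makes this at most \<open>\<epsilon>\<close>.\<close>
      define M where "M = \<eta> * 2 + 2 / \<epsilon>"
      have M: "M > 0" using \<eta>(2) that by (simp add: M_def add_pos_pos)
      obtain R where R: "\<And>x y. x \<ge> R \<Longrightarrow> \<bar>y\<bar> \<le> 3 * pi / 2 \<Longrightarrow> M \<le> norm (sinh_root (Complex x y))"
        using norm_sinh_root_at_top[of M] by blast
      have "norm (f (Complex x y) / g (Complex x y)) \<le> \<epsilon>" if "x \<ge> R" "\<bar>y\<bar> \<le> 3 * pi / 2" for x y
      proof -
        define n where "n = norm (sinh_root (Complex x y))"
        have n: "n \<ge> M" using R[OF that] by (simp add: n_def)
        have "norm (g (Complex x y)) \<ge> n\<^sup>2 - q"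
          using norm_triangle_ineq3[of "of_real q" "sinh_root (Complex x y) ^ 2"] by (simp add: g_def n_def norm_power q)
        moreover have "n\<^sup>2 - q \<ge> n\<^sup>2 / 2"
        proof -
          have "\<eta> * 2 \<le> n" using n \<open>\<epsilon> > 0\<close> unfolding M_def by (smt (verit) divide_pos_pos)
          then have "(\<eta> * 2)\<^sup>2 \<le> n\<^sup>2" using \<eta>(2) by (intro power_mono) auto
          then have "4 * \<eta>\<^sup>2 \<le> n\<^sup>2" by (simp add: power_mult_distrib)
          moreover have "0 \<le> \<eta>\<^sup>2" by simp
          ultimately show ?thesis unfolding q by linarith
        qed
        ultimately have "norm (g (Complex x y)) \<ge> n\<^sup>2 / 2" by linarith
        moreover have "n > 0" using n M by linarith
        ultimately have "norm (f (Complex x y) / g (Complex x y)) \<le> n / (n\<^sup>2 / 2)"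
          unfolding norm_divide by (intro frac_le) (auto simp: f_def n_def norm_mult)
        also have "\<dots> = 2 / n" using \<open>n > 0\<close> by (simp add: power2_eq_square)
        also have "\<dots> \<le> \<epsilon>"
        proof -
          have "2 / \<epsilon> \<le> n" using n \<eta>(2) by (simp add: M_def)
          then show ?thesis using \<open>n > 0\<close> \<open>\<epsilon> > 0\<close> by (simp add: field_simps)
        qed
        finally show ?thesis .
      qed
      then show ?thesis by blast
    qed
    show "\<bar>Im p\<bar> < 3 * pi / 2" if "p \<in> pts" for p using that c by (auto simp: pts_def)
  qed (simp add: pts_def)
  moreover have "residue (\<lambda>z. f z / g z) p = - \<i> * of_real (3 * q / (2 * (cosh T - 1)))" if p: "p = of_real T \<or> p = - of_real T" for p
  proof -
    define d where "d = 2 * (cosh p - 1) / (3 * sinh_root p)"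
    have p0: "\<bar>Im p\<bar> < 2 * pi" "p \<noteq> 0" using p T by auto
    have ch: "cosh p = of_real (cosh T)"
      using p by (auto simp: cosh_field_def exp_of_real[symmetric])
    have "sinh_root p \<noteq> 0" using p0 by (simp add: sinh_root_eq_0_iff)
    moreover have "cosh p - 1 \<noteq> 0" unfolding ch using coshT by (metis eq_iff_diff_eq_0 less_irrefl of_real_1 of_real_eq_iff)
    ultimately have d0: "d \<noteq> 0" by (simp add: d_def)
    have sq: "sinh_root p ^ 2 = of_real q" using p by (auto simp: sinh_root_minus \<eta>(1) q)
    \<comment> \<open>The opposite pole is removed from the strip so that \<open>p\<close> is the
      only zero of \<open>g\<close>.\<close>
    have "residue (\<lambda>z. f z / g z) p = f p / (- d)"
    proof (rule residue_quotient_simple_zero[where S = "wide_strip - {- p}"])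
      show "open (wide_strip - {- p})" by (intro open_Diff open_strip) simp
      show "p \<in> wide_strip - {- p}" using p0 by (auto simp: eq_neg_iff_add_eq_0)
      show "(g has_field_derivative - d) (at p)"
        unfolding g_def d_def using DERIV_diff[OF DERIV_const sinh_root_square_has_derivative[OF p0], of "of_real q"] by simp
      show "g w \<noteq> 0" if "w \<in> wide_strip - {- p} - {p}" for w using that p by (intro g0) auto
    qed (use hf hg d0 sq in \<open>auto simp: g_def\<close>)
    also have "\<dots> = - \<i> * (3 * sinh_root p ^ 2 / (2 * (cosh p - 1)))"
      unfolding f_def d_def by (simp add: power2_eq_square)
    also have "\<dots> = - \<i> * of_real (3 * q / (2 * (cosh T - 1)))" unfolding sq ch by simp
    finally show ?thesis .
  qed
  moreover have "complex_of_real T \<noteq> - of_real T" using T by (simp add: eq_neg_iff_add_eq_0)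
  ultimately have "(LBINT a. phase_kernel a q) =
      of_real pi * \<i> * (2 * (- \<i> * of_real (3 * q / (2 * (cosh T - 1)))))"
    unfolding line by (simp add: pts_def)
  also have "\<dots> = of_real (pi * (2 * (3 * q / (2 * (cosh T - 1)))))"
  proof -
    have "of_real pi * \<i> * (2 * (- \<i> * of_real r)) = complex_of_real (pi * (2 * r))" for r
      by (simp add: complex_eq_iff)
    then show ?thesis .
  qed
  also have "pi * (2 * (3 * q / (2 * (cosh T - 1)))) = 3 * pi * q / (cosh T - 1)"
  proof -
    have "pi * (2 * (3 * q / (2 * u))) = 3 * pi * q / u" for u by simp
    then show ?thesis .
  qed
  finally show ?B .
qed

text \<open>The sign comes from \<open>\<i> ^ (2 * n + 1) = (- 1) ^ n * \<i>\<close>. At 0 the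
  integrand is a holomorphic factor over \<open>z ^ (2 * n + 1)\<close>, so the residue is the
  Taylor coefficient of order \<open>2 * n\<close> of that factor.\<close>

lemma hankel_phase_power_integral:
  "integrable lborel (\<lambda>a. 1 / phase_root a ^ (2 * n + 1))" (is ?A)
  "(LBINT a. 1 / phase_root a ^ (2 * n + 1)) =
     (- 1) ^ n * of_real pi * ((deriv ^^ (2 * n)) (\<lambda>z. 1 / sinh_cubic_root z ^ (2 * n + 1)) 0 / fact (2 * n))" (is ?B)
proof -
  define f where "f = (\<lambda>z. 1 / sinh_root z ^ (2 * n + 1))"
  have line: "f (Complex a (- (3 * pi / 2))) = (- 1) ^ n * \<i> * (1 / phase_root a ^ (2 * n + 1))" for a
  proof -
    have "phase_root a ^ (2 * n + 1) = (- 1) ^ n * \<i> * sinh_root (Complex a (- (3 * pi / 2))) ^ (2 * n + 1)"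
      unfolding phase_root_def power_mult_distrib by (simp add: power_mult)
    moreover have "(- 1) ^ n * \<i> * (1 / ((- 1) ^ n * \<i> * w)) = 1 / w" for w :: complex by simp
    ultimately show ?thesis by (simp only: f_def)
  qed
  show int: ?A
  proof (rule integrable_phase_root_bound)
    fix a
    have "norm (phase_root a) ^ 1 \<le> norm (phase_root a) ^ (2 * n + 1)"
      using norm_phase_root_ge(2)[of a] by (intro power_increasing) auto
    then show "norm (1 / phase_root a ^ (2 * n + 1)) \<le> 1 / norm (phase_root a)"
      unfolding norm_divide norm_power norm_one using phase_root_neq_0[of a]
      by (intro divide_left_mono) (auto intro!: mult_pos_pos)
  qed measurable
  have c: "0 < 3 * pi / 2" "3 * pi / 2 < 2 * pi" using pi_gt_zero by auto
  have "(LBINT a. f (Complex a (- (3 * pi / 2)))) = of_real pi * \<i> * (\<Sum>p\<in>{0}. residue f p)"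
  proof (rule odd_strip_integral[OF c])
    show "f holomorphic_on wide_strip - {0}"
      unfolding f_def by (intro holomorphic_intros holomorphic_on_subset[OF holomorphic_sinh_root]) (auto simp: sinh_root_eq_0_iff)
    show "f (- z) = - f z" if "\<bar>Im z\<bar> < 2 * pi" for z
      using that by (simp add: f_def sinh_root_minus)
    show "integrable lborel (\<lambda>a. f (Complex a (- (3 * pi / 2))))"
      unfolding line by (intro integrable_mult_right int)
    show "\<exists>R. \<forall>x\<ge>R. \<forall>y. \<bar>y\<bar> \<le> 3 * pi / 2 \<longrightarrow> norm (f (Complex x y)) \<le> \<epsilon>" if "\<epsilon> > 0" for \<epsilon>
    proof -
      obtain R where R: "\<And>x y. x \<ge> R \<Longrightarrow> \<bar>y\<bar> \<le> 3 * pi / 2 \<Longrightarrow> max 1 (1 / \<epsilon>) \<le> norm (sinh_root (Complex x y))"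
        using norm_sinh_root_at_top[of "max 1 (1 / \<epsilon>)"] by blast
      have "norm (f (Complex x y)) \<le> \<epsilon>" if "x \<ge> R" "\<bar>y\<bar> \<le> 3 * pi / 2" for x y
      proof -
        define m where "m = norm (sinh_root (Complex x y))"
        have m: "m \<ge> 1" "m \<ge> 1 / \<epsilon>" using R[OF that] by (simp_all add: m_def)
        have "m ^ 1 \<le> m ^ (2 * n + 1)" using m by (intro power_increasing) auto
        then have "1 / \<epsilon> \<le> m ^ (2 * n + 1)" using m(2) unfolding power_one_right by linarith
        moreover have "m ^ (2 * n + 1) > 0" using m by (intro zero_less_power) simp
        ultimately have "1 / m ^ (2 * n + 1) \<le> \<epsilon>" using \<open>\<epsilon> > 0\<close> by (simp add: field_simps)
        then show ?thesis by (simp only: f_def m_def norm_divide norm_power norm_one)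
      qed
      then show ?thesis by blast
    qed
  qed (use c in auto)
  moreover have "residue f 0 = (deriv ^^ (2 * n)) (\<lambda>z. 1 / sinh_cubic_root z ^ (2 * n + 1)) 0 / fact (2 * n)"
  proof -
    have "f = (\<lambda>z. (1 / sinh_cubic_root z ^ (2 * n + 1)) / z ^ Suc (2 * n))"
      by (simp add: f_def fun_eq_iff sinh_root_def power_mult_distrib mult.commute)
    moreover have "residue (\<lambda>z. (1 / sinh_cubic_root z ^ (2 * n + 1)) / z ^ Suc (2 * n)) 0 =
        (deriv ^^ (2 * n)) (\<lambda>z. 1 / sinh_cubic_root z ^ (2 * n + 1)) 0 / fact (2 * n)"
      by (rule residue_holomorphic_over_power'[OF open_strip[of "2 * pi"]])
        (auto intro!: holomorphic_intros holomorphic_sinh_cubic_root simp: sinh_cubic_root_neq_0)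
    ultimately show ?thesis by (simp only:)
  qed
  ultimately have r: "(LBINT a. f (Complex a (- (3 * pi / 2)))) =
      of_real pi * \<i> * ((deriv ^^ (2 * n)) (\<lambda>z. 1 / sinh_cubic_root z ^ (2 * n + 1)) 0 / fact (2 * n))"
    by simp
  have "(LBINT a. f (Complex a (- (3 * pi / 2)))) = (- 1) ^ n * \<i> * (LBINT a. 1 / phase_root a ^ (2 * n + 1))"
    unfolding line by (rule integral_mult_right_zero)
  then have "(- 1) ^ n * \<i> * (LBINT a. 1 / phase_root a ^ (2 * n + 1)) = of_real pi * \<i> *
      ((deriv ^^ (2 * n)) (\<lambda>z. 1 / sinh_cubic_root z ^ (2 * n + 1)) 0 / fact (2 * n))"
    using r by (simp only:)
  moreover have "X = (- 1) ^ n * of_real pi * Y" if "(- 1) ^ n * \<i> * X = of_real pi * \<i> * Y" for X Y :: complex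
  proof -
    have "\<i> * ((- 1) ^ n * X) = \<i> * (of_real pi * Y)" using that by (simp only: mult_ac)
    then have "(- 1) ^ n * X = of_real pi * Y" by simp
    then have "(- 1) ^ n * ((- 1) ^ n * X) = (- 1) ^ n * (of_real pi * Y)" by simp
    then show ?thesis by (simp flip: mult.assoc)
  qed
  ultimately show ?B by blast
qed

section \<open>Moments of the Hankel density\<close>

text \<open>Links the real iterated derivative in \<open>aw_coeff\<close> to the complex one in the
  residue. Along the real axis the imaginary part of each derivative is constantly 0, so its own
  derivative vanishes and the induction proceeds.\<close>

lemma higher_deriv_of_real:
  fixes f :: "real \<Rightarrow> real" and F :: "complex \<Rightarrow> complex"
  assumes S: "open S" "\<And>t. complex_of_real t \<in> S" and F: "F holomorphic_on S"
    and eq: "\<And>t. F (of_real t) = of_real (f t)"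
  shows "(deriv ^^ n) F (of_real t) = of_real ((deriv ^^ n) f t)"
proof (induction n arbitrary: t)
  case (Suc n)
  define G where "G = (deriv ^^ n) F"
  define g where "g = (deriv ^^ n) f"
  have Gg: "G (of_real t) = of_real (g t)" for t using Suc by (simp add: G_def g_def)
  have "(G has_field_derivative deriv G (of_real t)) (at (of_real t))"
    unfolding G_def by (rule holomorphic_derivI[OF holomorphic_higher_deriv[OF F S(1)] S(1) S(2)])
  from has_vector_derivative_real_field[OF this]
  have D: "((\<lambda>t. complex_of_real (g t)) has_vector_derivative deriv G (of_real t)) (at t)"
    by (simp add: comp_def Gg)
  have ReD: "(g has_real_derivative Re (deriv G (of_real t))) (at t)"
    using has_derivative_Re[OF D[unfolded has_vector_derivative_def]]
    by (simp add: has_field_derivative_def mult.commute[of _ "Re _"] fun_eq_iff cong: if_cong)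
  have "((\<lambda>t. Im (complex_of_real (g t))) has_real_derivative Im (deriv G (of_real t))) (at t)"
    using has_derivative_Im[OF D[unfolded has_vector_derivative_def]]
    by (simp add: has_field_derivative_def mult.commute[of _ "Im _"])
  then have "((\<lambda>t. 0) has_real_derivative Im (deriv G (of_real t))) (at t)" by simp
  then have "Im (deriv G (of_real t)) = 0" using DERIV_unique[OF _ DERIV_const] by blast
  moreover have "deriv g t = Re (deriv G (of_real t))" using ReD by (rule DERIV_imp_deriv)
  ultimately have "deriv G (of_real t) = of_real (deriv g t)" by (simp add: complex_eq_iff)
  then show ?case by (simp add: G_def g_def)
qed (simp add: eq)

lemma sinh_cubic_root_power_of_real:
  "1 / sinh_cubic_root (of_real t) ^ (2 * n + 1) =
     of_real ((if t = 0 then 6 else t ^ 3 / (sinh t - t)) powr ((2 * real n + 1) / 3))"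
proof -
  define b where "b = (if t = 0 then 1 / 6 else (sinh t - t) / t ^ 3)"
  have b: "sinh_cubic_quotient (of_real t) = of_real b"
  proof (cases "t = 0")
    case False
    have "sinh (complex_of_real t) - of_real t = of_real (sinh t - t)"
      by (simp add: complex_eq_iff Re_sinh_complex Im_sinh_complex)
    then show ?thesis using False by (simp add: sinh_cubic_quotient_def b_def)
  qed (simp add: sinh_cubic_quotient_def b_def)
  have "b > 0"
  proof -
    consider "t = 0" | "t > 0" | "- t > 0" by linarith
    then show ?thesis
    proof cases
      case 2
      then show ?thesis using sinh_real_bounds(1)[OF 2] by (simp add: b_def)
    next
      case 3
      have "b = (sinh (- t) - (- t)) / (- t) ^ 3" using 3 by (simp add: b_def divide_simps)
      also have "\<dots> > 0" using sinh_real_bounds(1)[OF 3] 3 by (intro divide_pos_pos zero_less_power) linarith+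
      finally show ?thesis .
    qed (simp add: b_def)
  qed
  then have "Re (sinh_cubic_quotient (of_real t)) > 0" by (simp add: b)
  note P = sinh_cubic_root_pos[OF _ _ this, simplified]
  define r where "r = Re (sinh_cubic_root (of_real t))"
  have r: "sinh_cubic_root (of_real t) = of_real r" "r > 0" using P by (simp_all add: r_def)
  have "complex_of_real (r ^ 3) = of_real b"
    using sinh_cubic_root_cube[of "of_real t"] r b by simp
  then have "b = r powr 3" using r(2) by (simp only: of_real_eq_iff) simp
  moreover have "(if t = 0 then 6 else t ^ 3 / (sinh t - t)) = 1 / b" by (simp add: b_def)
  ultimately have "(if t = 0 then 6 else t ^ 3 / (sinh t - t)) powr ((2 * real n + 1) / 3) = (r powr - 3) powr ((2 * real n + 1) / 3)"
    by (simp add: powr_minus_divide)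
  also have "\<dots> = r powr (- real (2 * n + 1))"
  proof -
    have "- 3 * ((2 * real n + 1) / 3) = - real (2 * n + 1)" by simp
    then show ?thesis by (simp only: powr_powr)
  qed
  also have "\<dots> = 1 / r ^ (2 * n + 1)" using r(2) by (simp only: powr_minus_divide powr_realpow)
  finally show ?thesis unfolding r(1) by simp
qed

lemma aw_coeff_eq:
  "complex_of_real (aw_coeff n) = (deriv ^^ (2 * n)) (\<lambda>z. 1 / sinh_cubic_root z ^ (2 * n + 1)) 0 / fact (2 * n)"
proof -
  have "(deriv ^^ (2 * n)) (\<lambda>z. 1 / sinh_cubic_root z ^ (2 * n + 1)) (of_real 0) =
      of_real ((deriv ^^ (2 * n)) (\<lambda>t. (if t = 0 then 6 else t ^ 3 / (sinh t - t)) powr ((2 * real n + 1) / 3)) 0)"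
  proof (rule higher_deriv_of_real[where S = wide_strip])
    show "(\<lambda>z. 1 / sinh_cubic_root z ^ (2 * n + 1)) holomorphic_on wide_strip"
      by (intro holomorphic_intros holomorphic_sinh_cubic_root) (auto simp: sinh_cubic_root_neq_0)
    show "1 / sinh_cubic_root (of_real t) ^ (2 * n + 1) =
       of_real ((if t = 0 then 6 else t ^ 3 / (sinh t - t)) powr ((2 * real n + 1) / 3))" for t
      by (rule sinh_cubic_root_power_of_real)
  qed (auto intro: open_strip)
  then show ?thesis unfolding aw_coeff_def by simp
qed

section \<open>Exchanging the integrations over the line and the half-axis\<close>

text \<open>Absolute integrability is checked with \<open>x\<close> inside and \<open>a\<close>
  outside, where the bounds are explicit, and then serves for the opposite order.\<close>

lemma Fubini_dominated:
  fixes f :: "real \<Rightarrow> real \<Rightarrow> complex"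
  assumes meas: "case_prod f \<in> borel_measurable (lborel \<Otimes>\<^sub>M lborel)"
    and g: "\<And>a. integrable lborel (g a)" "\<And>a x. norm (f a x) \<le> g a x"
    and B: "integrable lborel B" "\<And>a. (LBINT x. g a x) \<le> B a"
  shows "(LBINT x. LBINT a. f a x) = (LBINT a. LBINT x. f a x)" (is ?A)
    and "integrable lborel (\<lambda>x. LBINT a. f a x)"
proof -
  have int: "integrable lborel (f a)" for a
  proof (rule Bochner_Integration.integrable_bound[OF g(1)[of a]])
    show "f a \<in> borel_measurable lborel"
      using measurable_Pair2'[of a lborel lborel] meas measurable_compose by fastforce
  qed (use g(2) in \<open>auto intro!: AE_I2 order_trans[OF _ abs_ge_self]\<close>)
  have "integrable (lborel \<Otimes>\<^sub>M lborel) (case_prod f)"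
  proof (rule lborel_pair.Fubini_integrable[OF meas])
    show "integrable lborel (\<lambda>x. LBINT y. norm (case (x, y) of (x, y) \<Rightarrow> f x y))"
    proof (rule Bochner_Integration.integrable_bound[OF B(1)])
      show "(\<lambda>x. LBINT y. norm (case (x, y) of (x, y) \<Rightarrow> f x y)) \<in> borel_measurable lborel"
        using meas by measurable
      show "AE x in lborel. norm (LBINT y. norm (case (x, y) of (x, y) \<Rightarrow> f x y)) \<le> norm (B x)"
      proof (intro AE_I2)
        fix x :: real
        have "(LBINT y. norm (f x y)) \<le> (LBINT y. g x y)"
          by (intro integral_mono integrable_norm int g)
        then show "norm (LBINT y. norm (case (x, y) of (x, y) \<Rightarrow> f x y)) \<le> norm (B x)"
          using B(2)[of x] by (simp add: abs_of_nonneg Bochner_Integration.integral_nonneg)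
      qed
    qed
  qed (use int in simp)
  then show ?A
    "integrable lborel (\<lambda>x. LBINT a. f a x)"
    by (rule lborel_pair.Fubini_integral, rule lborel_pair.integrable_snd)
qed

definition hankel_density :: "real \<Rightarrow> complex" where
  "hankel_density t = (LBINT a. exp (- (hankel_phase a * of_real t))) / of_real pi"

text \<open>The exponents \<open>- 2 * pi * t\<close> and \<open>pi * t / 2\<close> add up to
  \<open>- 3 * pi * t / 2\<close>; this is what places the integration line at
  \<open>Im z = - 3 * pi / 2\<close>. Reflecting \<open>u\<close> adjusts the sign of the
  oscillating term.\<close>

lemma hankel_density_eq:
  assumes t: "t > 0"
  shows "of_real (exp (- 2 * pi * t)) * (\<i> * hankel_H1 (\<i> * of_real t) (\<i> * of_real t)) = hankel_density t"
proof -
  have "(LBINT u. exp (- of_real (t * cosh u) + \<i> * of_real t * of_real u)) =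
      (LBINT u. exp (- of_real (t * cosh u) - \<i> * of_real t * of_real u))"
    by (subst lborel_integral_real_affine[where c = "- 1" and t = 0]) simp_all
  also have "of_real (exp (- (3 * pi / 2 * t))) * (LBINT u. exp (- of_real (t * cosh u) - \<i> * of_real t * of_real u)) =
      (LBINT u. of_real (exp (- (3 * pi / 2 * t))) * exp (- of_real (t * cosh u) - \<i> * of_real t * of_real u))"
    by (rule integral_mult_right_zero[symmetric])
  also have "\<dots> = (LBINT a. exp (- (hankel_phase a * of_real t)))"
    unfolding exp_of_real[symmetric] exp_add[symmetric]
    by (intro Bochner_Integration.integral_cong refl) (simp add: hankel_phase_def algebra_simps)
  finally have e: "of_real (exp (- (3 * pi / 2 * t))) * (LBINT u. exp (- of_real (t * cosh u) + \<i> * of_real t * of_real u)) =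
      (LBINT a. exp (- (hankel_phase a * of_real t)))" .
  have "exp (- 2 * pi * t) * exp (pi * t / 2) = exp (- (3 * pi / 2 * t))"
    unfolding exp_add[symmetric] by (simp add: field_simps)
  then have "complex_of_real (exp (- 2 * pi * t)) * of_real (exp (pi * t / 2) / pi) = of_real (exp (- (3 * pi / 2 * t))) / of_real pi"
    by (metis of_real_divide of_real_mult times_divide_eq_right)
  then show ?thesis
    unfolding hankel_H1_integral[OF t] hankel_density_def e[symmetric] by (simp flip: mult.assoc)
qed

lemma borel_measurable_hankel_phase [measurable]: "hankel_phase \<in> borel_measurable borel"
  unfolding hankel_phase_def by (intro borel_measurable_continuous_onI continuous_intros)

text \<open>One exchange serves both the pure powers of the moments and the weight in
  \<open>R_0\<close>, each bounded by a power of \<open>t\<close>. The inner integral of the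
  majorant is \<open>Gamma p * (Re s(a)) powr (- p)\<close>, which decays like
  \<open>exp (- p * \<bar>a\<bar>)\<close>.\<close>

lemma hankel_density_Fubini:
  fixes W :: "real \<Rightarrow> complex"
  assumes p: "p > 0" and W: "W \<in> borel_measurable borel" "\<And>t. t > 0 \<Longrightarrow> norm (W t) \<le> t powr (p - 1)"
  shows "set_integrable lborel {0<..} (\<lambda>t. W t * hankel_density t)" (is ?A)
    and "(LBINT t:{0<..}. W t * hankel_density t) =
      (LBINT a. (LBINT t:{0<..}. W t * exp (- (hankel_phase a * of_real t)))) / of_real pi" (is ?B)
proof -
  define f where "f = (\<lambda>a t. indicator {0<..} t *\<^sub>R (W t * exp (- (hankel_phase a * of_real t))))"
  define g where "g = (\<lambda>a t. indicator {0<..} t *\<^sub>R (t powr (p - 1) * exp (- Re (hankel_phase a) * t)))"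
  have Re: "Re (hankel_phase a) > 0" for a using hankel_phase_Re_ge(1)[of a] by (smt (verit) exp_gt_zero half_gt_zero)
  have G: "integrable lborel (g a)" "(LBINT t. g a t) = Gamma p * Re (hankel_phase a) powr (- p)" for a
    using Gamma_lebesgue_integral_scaled[OF p Re[of a]] unfolding g_def set_integrable_def set_lebesgue_integral_def by simp_all
  have meas: "case_prod f \<in> borel_measurable (lborel \<Otimes>\<^sub>M lborel)"
    unfolding f_def using W(1) by measurable
  have fg: "norm (f a t) \<le> g a t" for a t
    using W(2)[of t] by (auto simp: f_def g_def indicator_def norm_mult intro!: mult_mono)
  have B: "integrable lborel (\<lambda>a::real. Gamma p * (2 powr p * exp (- p * \<bar>a\<bar>)))"
    by (intro integrable_mult_right integrable_exp_minus_abs p)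
  have gB: "(LBINT t. g a t) \<le> Gamma p * (2 powr p * exp (- p * \<bar>a\<bar>))" for a
  proof -
    have "Re (hankel_phase a) powr (- p) \<le> (exp \<bar>a\<bar> / 2) powr (- p)"
      using hankel_phase_Re_ge(1)[of a] p by (intro powr_mono2') auto
    also have "\<dots> = 2 powr p * exp (- p * \<bar>a\<bar>)"
      by (simp add: powr_def ln_div exp_add[symmetric] algebra_simps)
    finally show ?thesis unfolding G(2) using p by (intro mult_left_mono Gamma_real_nonneg) auto
  qed
  note Fub = Fubini_dominated[OF meas G(1) fg B gB]
  have inner: "(LBINT a. f a t) = of_real pi * (indicator {0<..} t *\<^sub>R (W t * hankel_density t))" for t
    unfolding f_def hankel_density_def by (cases "t > 0") simp_all
  have "integrable lborel (\<lambda>t. (1 / of_real pi) * (of_real pi * (indicator {0<..} t *\<^sub>R (W t * hankel_density t))))"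
    using Fub(2) unfolding inner by (rule integrable_mult_right)
  then show ?A
    unfolding set_integrable_def by simp
  have "of_real pi * (LBINT t:{0<..}. W t * hankel_density t) =
      (LBINT a. (LBINT t:{0<..}. W t * exp (- (hankel_phase a * of_real t))))"
    using Fub(1) unfolding inner unfolding f_def set_lebesgue_integral_def by (simp only: integral_mult_right_zero)
  then show ?B
    by (simp add: field_simps)
qed

lemma hankel_density_moment:
  "set_integrable lborel {0<..} (\<lambda>t. of_real (t powr ((2 * real n + 1) / 3 - 1)) * hankel_density t)" (is ?A)
  "(LBINT t:{0<..}. of_real (t powr ((2 * real n + 1) / 3 - 1)) * hankel_density t) =
     (- 1) ^ n * of_real (Gamma ((2 * real n + 1) / 3)) * of_real (aw_coeff n)" (is ?B)
proof -
  have p: "(2 * real n + 1) / 3 > 0" by simp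
  have W: "(\<lambda>t. complex_of_real (t powr ((2 * real n + 1) / 3 - 1))) \<in> borel_measurable borel" by measurable
  note F = hankel_density_Fubini[OF p W]
  show ?A
    by (rule F(1)) simp
  have "(LBINT t:{0<..}. of_real (t powr ((2 * real n + 1) / 3 - 1)) * hankel_density t) =
      (LBINT a. of_real (Gamma ((2 * real n + 1) / 3)) * (1 / phase_root a ^ (2 * n + 1))) / of_real pi"
    by (subst F(2)) (simp_all only: Gamma_lebesgue_integral_cube[OF phase_root_neq_0 phase_root_Im_Ln, unfolded phase_root_cube] norm_of_real, simp_all)
  also have "(LBINT a. of_real (Gamma ((2 * real n + 1) / 3)) * (1 / phase_root a ^ (2 * n + 1))) =
      of_real (Gamma ((2 * real n + 1) / 3)) * ((- 1) ^ n * of_real pi * of_real (aw_coeff n))"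
    unfolding aw_coeff_eq hankel_phase_power_integral(2)[symmetric] by (rule integral_mult_right_zero)
  finally show ?B by (simp add: mult_ac)
qed

lemma set_lebesgue_integral_substitution:
  fixes f :: "real \<Rightarrow> 'a :: euclidean_space"
  assumes S: "S \<in> sets borel" and g: "\<And>x. x \<in> S \<Longrightarrow> (g has_real_derivative g' x) (at x within S)" "inj_on g S"
    and f: "set_integrable lborel (g ` S) f"
    and meas: "set_borel_measurable lborel S (\<lambda>x. \<bar>g' x\<bar> *\<^sub>R f (g x))"
  shows "(LBINT x:g ` S. f x) = (LBINT x:S. \<bar>g' x\<bar> *\<^sub>R f (g x))"
proof -
  have "f absolutely_integrable_on (g ` S)"
    using f unfolding set_integrable_def
    by (subst integrable_completion) (auto dest: borel_measurable_integrable)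
  then have "(\<lambda>x. \<bar>g' x\<bar> *\<^sub>R f (g x)) absolutely_integrable_on S \<and>
      integral S (\<lambda>x. \<bar>g' x\<bar> *\<^sub>R f (g x)) = integral (g ` S) f"
    using S g by (subst has_absolute_integral_change_of_variables_real) auto
  then show ?thesis
    using set_integrable_lborel_of_lebesgue(2)[OF _ meas] set_borel_integral_eq_integral(2)[OF f] by simp
qed

lemma sinh_minus_id_image: "(\<lambda>x::real. sinh x - x) ` {0<..} = {0<..}"
proof (intro equalityI subsetI)
  fix y :: real assume y: "y \<in> {0<..}"
  \<comment> \<open>From 6 on \<open>sinh b \<ge> 2 * b\<close>, so
    \<open>sinh b - b \<ge> b \<ge> y\<close>.\<close>
  define b where "b = y + 6"
  have "y \<le> sinh b - b" using sinh_ge_double[of b] y by (simp add: b_def)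
  moreover have "sinh 0 - 0 \<le> y" using y by simp
  moreover have "continuous_on {0..b} (\<lambda>x::real. sinh x - x)" by (intro continuous_intros)
  moreover have "0 \<le> b" using y by (simp add: b_def)
  ultimately obtain x where x: "0 \<le> x" "sinh x - x = y"
    using IVT'[of "\<lambda>x. sinh x - x" 0 y b] by blast
  have "x \<noteq> 0" using x y by auto
  then show "y \<in> (\<lambda>x::real. sinh x - x) ` {0<..}" using x by (intro image_eqI[of _ _ x]) auto
qed (use sinh_real_bounds(1) in auto)

text \<open>With the \<open>a\<close> integration done first and \<open>x = sinh T - T\<close>, the
  factor \<open>x powr (-2/3)\<close> is \<open>1 / q\<close> and the Jacobian is
  \<open>cosh T - 1\<close>. Both cancel against the kernel integral
  \<open>3 * pi * q / (cosh T - 1)\<close>, and only the constant \<open>3 * pi\<close> and the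
  exponential remain.\<close>

lemma rotated_kernel_double_integral:
  assumes \<nu>: "\<nu> > 0"
  shows "(LBINT a. (LBINT x:{0<..}. of_real (x powr (-2/3) * exp (- \<nu> * x)) *
            phase_kernel a (x powr (2/3)))) =
         of_real (3 * pi) * (LBINT T:{0<..}. of_real (exp (- \<nu> * (sinh T - T))))"
proof -
  define k where "k = (\<lambda>x. LBINT a. phase_kernel a (x powr (2/3)))"
  define f where "f = (\<lambda>a x. indicator {0<..} x *\<^sub>R (of_real (x powr (-2/3) * exp (- \<nu> * x)) *
            phase_kernel a (x powr (2/3))))"
  define g where "g = (\<lambda>a x. (1 / norm (phase_root a)) * (indicator {0<..} x *\<^sub>R (x powr (-2/3) * exp (- \<nu> * x))))"
  have G1: "integrable lborel (\<lambda>x. indicator {0<..} x *\<^sub>R (x powr (-2/3) * exp (- \<nu> * x)))"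
    and G2: "(LBINT x. indicator {0<..} x *\<^sub>R (x powr (-2/3) * exp (- \<nu> * x))) = Gamma (1/3) * \<nu> powr (- (1/3))"
    using Gamma_lebesgue_integral_scaled[of "1/3" \<nu>] \<nu> unfolding set_integrable_def set_lebesgue_integral_def by simp_all
  have meas: "case_prod f \<in> borel_measurable (lborel \<Otimes>\<^sub>M lborel)"
    unfolding f_def by measurable
  have fg: "norm (f a x) \<le> g a x" for a x
    using norm_hankel_phase_kernel[of "x powr (2/3)" a]
    by (auto simp: f_def g_def indicator_def norm_mult abs_mult mult.commute[of _ "x powr (-2/3) * exp (- \<nu> * x)"] simp del: times_divide_eq_right times_divide_eq_left intro!: mult_left_mono)
  have g: "integrable lborel (g a)" for a
    unfolding g_def by (intro integrable_mult_right G1)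
  have B: "integrable lborel (\<lambda>a. norm (complex_of_real (Gamma (1/3) * \<nu> powr (- (1/3))) * (1 / phase_root a)))"
    by (intro integrable_norm integrable_mult_right integrable_phase_root_bound) (auto simp: norm_divide)
  have gB: "(LBINT x. g a x) \<le> norm (complex_of_real (Gamma (1/3) * \<nu> powr (- (1/3))) * (1 / phase_root a))" for a
  proof -
    have "(LBINT x. g a x) = (1 / norm (phase_root a)) * (Gamma (1/3) * \<nu> powr (- (1/3)))"
      unfolding g_def G2[symmetric] by (rule integral_mult_right_zero)
    also have "\<dots> \<le> norm (complex_of_real (Gamma (1/3) * \<nu> powr (- (1/3))) * (1 / phase_root a))"
      unfolding norm_mult norm_of_real norm_divide norm_one
      by (subst mult.commute, rule mult_right_mono) auto
    finally show ?thesis .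
  qed
  note Fub = Fubini_dominated[OF meas g fg B gB]
  have inner: "(LBINT a. f a x) = indicator {0<..} x *\<^sub>R (of_real (x powr (-2/3) * exp (- \<nu> * x)) * k x)" for x
    unfolding f_def k_def by (cases "x > 0") (simp_all only: integral_scaleR_right integral_mult_right_zero)
  define h where "h = (\<lambda>x. of_real (x powr (-2/3) * exp (- \<nu> * x)) * k x)"
  define \<zeta> where "\<zeta> = (\<lambda>x::real. sinh x - x)"
  have img: "\<zeta> ` {0<..} = {0<..}" unfolding \<zeta>_def by (rule sinh_minus_id_image)
  have h: "set_integrable lborel {0<..} h"
    using Fub(2) unfolding inner h_def set_integrable_def .
  have hz: "\<bar>cosh T - 1\<bar> *\<^sub>R h (\<zeta> T) = of_real (3 * pi) * of_real (exp (- \<nu> * (sinh T - T)))" if "T \<in> {0<..}" for T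
  proof -
    have T: "T > 0" using that by simp
    define c q E where "c = cosh T - 1" and "q = (sinh T - T) powr (2/3)" and "E = exp (- \<nu> * (sinh T - T))"
    have c: "c > 0" using cosh_real_nonneg_less_iff[of 0 T] T by (simp add: c_def)
    have zp: "sinh T - T > 0" using sinh_real_bounds(1)[OF T] by simp
    then have q: "q > 0" by (simp add: q_def)
    have m: "(sinh T - T) powr (-2/3) = 1 / q"
      using powr_minus_divide[of "sinh T - T" "2/3"] by (simp add: q_def)
    have "\<bar>c\<bar> * (1 / q * E * (3 * pi * q / c)) = 3 * pi * E" using c q by simp
    then show ?thesis
      unfolding h_def \<zeta>_def k_def hankel_phase_kernel_integral(2)[OF T] scaleR_conv_of_real
      unfolding m c_def[symmetric] q_def[symmetric] E_def[symmetric] by (simp only: of_real_mult[symmetric])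
  qed
  have "(LBINT a. (LBINT x. f a x)) = (LBINT x:{0<..}. h x)"
    using Fub(1)[symmetric] unfolding inner set_lebesgue_integral_def h_def .
  also have "\<dots> = (LBINT x:\<zeta> ` {0<..}. h x)" by (simp only: img)
  also have "\<dots> = (LBINT T:{0<..}. \<bar>cosh T - 1\<bar> *\<^sub>R h (\<zeta> T))"
  proof (rule set_lebesgue_integral_substitution)
    show "(\<zeta> has_real_derivative cosh T - 1) (at T within {0<..})" for T
      unfolding \<zeta>_def by (auto intro!: derivative_eq_intros)
    show "inj_on \<zeta> {0<..}"
    proof (rule inj_onI)
      fix x y assume "x \<in> {0<..}" "y \<in> {0<..}" "\<zeta> x = \<zeta> y"
      then show "x = y" using sinh_minus_id_strict_mono[of x y] sinh_minus_id_strict_mono[of y x]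
        by (cases x y rule: linorder_cases) (auto simp: \<zeta>_def)
    qed
    \<comment> \<open>Measurability after the substitution is read off from the closed form
      \<open>hz\<close>.\<close>
    have "(\<lambda>T. indicat_real {0<..} T *\<^sub>R (\<bar>cosh T - 1\<bar> *\<^sub>R h (\<zeta> T))) =
        (\<lambda>T. indicat_real {0<..} T *\<^sub>R (of_real (3 * pi) * of_real (exp (- \<nu> * (sinh T - T)))))"
      using hz by (auto simp: fun_eq_iff indicator_def)
    moreover have "(\<lambda>T. indicat_real {0<..} T *\<^sub>R (of_real (3 * pi) * complex_of_real (exp (- \<nu> * (sinh T - T))))) \<in> borel_measurable lborel"
      unfolding sinh_field_def by measurable
    ultimately show "set_borel_measurable lborel {0<..} (\<lambda>T. \<bar>cosh T - 1\<bar> *\<^sub>R h (\<zeta> T))"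
      unfolding set_borel_measurable_def by (simp only:)
    show "set_integrable lborel (\<zeta> ` {0<..}) h" unfolding img by (rule h)
  qed simp
  also have "\<dots> = (LBINT T:{0<..}. of_real (3 * pi) * of_real (exp (- \<nu> * (sinh T - T))))"
    by (intro set_lebesgue_integral_cong allI impI hz) auto
  also have "\<dots> = of_real (3 * pi) * (LBINT T:{0<..}. of_real (exp (- \<nu> * (sinh T - T))))"
    by (rule set_integral_mult_right)
  finally show ?thesis unfolding f_def set_lebesgue_integral_def .
qed

lemma hankel_density_Stieltjes:
  assumes \<nu>: "\<nu> > 0"
  shows "(LBINT t:{0<..}. of_real (t powr (-2/3) / (1 + (t / \<nu>) powr (2/3))) * hankel_density t) =
    of_real (3 * \<nu> powr (1/3)) * (LBINT T:{0<..}. of_real (exp (- \<nu> * (sinh T - T))))"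
proof -
  define W where "W = (\<lambda>t. complex_of_real (t powr (-2/3) / (1 + (t / \<nu>) powr (2/3))))"
  have W: "W \<in> borel_measurable borel" unfolding W_def by measurable
  have Wb: "norm (W t) \<le> t powr (1/3 - 1)" if "t > 0" for t
  proof -
    have "t powr (-2/3) / (1 + (t / \<nu>) powr (2/3)) \<le> t powr (-2/3) / 1"
      by (intro divide_left_mono) (auto intro: add_pos_nonneg)
    moreover have "0 \<le> t powr (-2/3) / (1 + (t / \<nu>) powr (2/3))" by (intro divide_nonneg_nonneg) auto
    ultimately show ?thesis unfolding W_def norm_of_real by simp
  qed
  have inner: "(LBINT t:{0<..}. W t * exp (- (hankel_phase a * of_real t))) =
      of_real (\<nu> powr (1/3)) * (LBINT x:{0<..}. of_real (x powr (-2/3) * exp (- \<nu> * x)) *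
            phase_kernel a (x powr (2/3)))" for a
  proof -
    \<comment> \<open>In \<open>t = \<nu> * x\<close> the Jacobian and the power combine to
      \<open>\<nu> * \<nu> powr (-2/3) = \<nu> powr (1/3)\<close>, and the denominator becomes
      independent of \<open>\<nu>\<close>.\<close>
    have Wn: "\<nu> *\<^sub>R (W (\<nu> * x) * exp (- (hankel_phase a * of_real (\<nu> * x)))) =
        of_real (\<nu> powr (1/3)) * (of_real (x powr (-2/3) / (1 + x powr (2/3))) * exp (- (hankel_phase a * of_real (\<nu> * x))))"
      if "x \<in> {0<..}" for x
    proof -
      have "\<nu> * \<nu> powr (-2/3) = \<nu> powr (1/3)" using \<nu> by (simp add: powr_mult_base)
      then have "\<nu> * ((\<nu> * x) powr (-2/3) / (1 + (\<nu> * x / \<nu>) powr (2/3))) = \<nu> powr (1/3) * (x powr (-2/3) / (1 + x powr (2/3)))"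
        using \<nu> that by (simp add: powr_mult)
      then have "complex_of_real \<nu> * W (\<nu> * x) = of_real (\<nu> powr (1/3)) * of_real (x powr (-2/3) / (1 + x powr (2/3)))"
        unfolding W_def by (simp only: of_real_mult[symmetric])
      then show ?thesis unfolding scaleR_conv_of_real by (simp only: mult.assoc[symmetric])
    qed
    have "(LBINT t:{0<..}. W t * exp (- (hankel_phase a * of_real t))) =
        \<nu> *\<^sub>R (LBINT x:{0<..}. W (\<nu> * x) * exp (- (hankel_phase a * of_real (\<nu> * x))))"
      by (rule set_lebesgue_integral_Ioi_scale[OF \<nu>])
    also have "\<dots> = (LBINT x:{0<..}. \<nu> *\<^sub>R (W (\<nu> * x) * exp (- (hankel_phase a * of_real (\<nu> * x)))))"
      by (rule set_integral_scaleR_right[symmetric])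
    also have "\<dots> = (LBINT x:{0<..}. of_real (\<nu> powr (1/3)) * (of_real (x powr (-2/3) / (1 + x powr (2/3))) * exp (- (hankel_phase a * of_real (\<nu> * x)))))"
      by (intro set_lebesgue_integral_cong allI impI Wn) auto
    also have "\<dots> = of_real (\<nu> powr (1/3)) * (LBINT x:{0<..}. of_real (x powr (-2/3) / (1 + x powr (2/3))) * exp (- (hankel_phase a * of_real (\<nu> * x))))"
      by (rule set_integral_mult_right)
    finally show ?thesis
      using rotated_Stieltjes_integral[OF \<nu> phase_root_neq_0 phase_root_Im_Ln, of a]
      by (simp only: phase_root_cube)
  qed
  have "(LBINT t:{0<..}. W t * hankel_density t) =
      (LBINT a. of_real (\<nu> powr (1/3)) * (LBINT x:{0<..}. of_real (x powr (-2/3) * exp (- \<nu> * x)) *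
            phase_kernel a (x powr (2/3)))) / of_real pi"
    using hankel_density_Fubini(2)[OF _ W Wb] unfolding inner by simp
  also have "\<dots> = of_real (\<nu> powr (1/3)) * (of_real (3 * pi) * (LBINT T:{0<..}. of_real (exp (- \<nu> * (sinh T - T))))) / of_real pi"
    unfolding rotated_kernel_double_integral[OF \<nu>, symmetric] by (simp only: integral_mult_right_zero)
  also have "\<dots> = of_real (3 * \<nu> powr (1/3)) * (LBINT T:{0<..}. of_real (exp (- \<nu> * (sinh T - T))))"
    by simp
  finally show ?thesis unfolding W_def .
qed

section \<open>The remainder and the analytic continuation\<close>

text \<open>Multiplying by the unimodular \<open>exp (- \<i> * Im z / 2)\<close> gives a number of
  real part \<open>(1 + exp (Re z)) * cos (Im z / 2)\<close>.\<close>

lemma norm_one_plus_exp_ge: "norm (1 + exp z) \<ge> cos (Im z / 2)"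
proof (cases "cos (Im z / 2) \<ge> 0")
  case True
  define w where "w = \<i> * complex_of_real (Im z / 2)"
  have "- w + z = of_real (Re z) + w" by (simp add: w_def complex_eq_iff)
  then have "exp (- w) * exp z = exp (of_real (Re z)) * exp w" by (simp only: exp_add[symmetric])
  then have "exp (- w) * (1 + exp z) = exp (- w) + exp (of_real (Re z)) * exp w"
    by (simp only: distrib_left mult_1_right)
  then have "Re (exp (- w) * (1 + exp z)) = cos (Im z / 2) + exp (Re z) * cos (Im z / 2)"
    by (simp add: w_def Re_exp exp_of_real)
  then have "cos (Im z / 2) \<le> Re (exp (- w) * (1 + exp z))" using True by simp
  also have "\<dots> \<le> norm (exp (- w) * (1 + exp z))" by (rule complex_Re_le_cmod)
  also have "\<dots> = norm (1 + exp z)" by (simp add: norm_mult w_def)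
  finally show ?thesis .
qed (use norm_ge_zero[of "1 + exp z"] in linarith)

text \<open>The sector of the theorem originates here: the exponent \<open>2 / 3\<close> and the
  halving of the angle leave \<open>Im w / 3\<close>, whose cosine is positive for
  \<open>\<bar>Im w\<bar> < 3 * pi / 2\<close>. The bound is uniform in \<open>x\<close>.\<close>

lemma one_plus_log_powr_bound:
  assumes w: "\<bar>Im w\<bar> \<le> c" "c < 3 * pi / 2"
  shows "norm (1 + log_powr (of_real x - w) (2 / 3)) \<ge> cos (c / 3)" (is ?A) "cos (c / 3) > 0"
proof -
  have "cos (c / 3) \<le> cos \<bar>Im w / 3\<bar>"
    using w by (intro cos_monotone_0_pi_le) auto
  also have "cos \<bar>Im w / 3\<bar> = cos (Im w / 3)" by (rule cos_abs_real)
  also have "\<dots> = cos (Im (of_real (2 / 3) * (of_real x - w)) / 2)" by simp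
  also have "\<dots> \<le> norm (1 + log_powr (of_real x - w) (2 / 3))"
    unfolding log_powr_def by (rule norm_one_plus_exp_ge)
  finally show ?A .
  show "cos (c / 3) > 0" using w by (intro cos_gt_zero_pi) auto
qed

lemma log_powr_neq_0 [simp]: "log_powr w s \<noteq> 0"
  by (simp add: log_powr_def)

lemma log_powr_add: "log_powr w (s + r) = log_powr w s * log_powr w r"
  by (simp add: log_powr_def exp_add distrib_right)

lemma borel_measurable_hankel_density [measurable]: "hankel_density \<in> borel_measurable borel"
  unfolding hankel_density_def by measurable

lemma aw_remainder_eq:
  "aw_remainder N w = (- 1) ^ N / (3 * of_real pi * log_powr w ((2 * real N + 1) / 3)) *
     (LBINT t:{0<..}. of_real (t powr ((2 * real N + 1) / 3 - 1)) * hankel_density t /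
        (1 + log_powr (of_real (ln t) - w) (2 / 3)))"
proof -
  have "of_real (t powr ((2 * real N - 2) / 3) * exp (- 2 * pi * t)) / (1 + log_powr (of_real (ln t) - w) (2 / 3)) *
          (\<i> * hankel_H1 (\<i> * of_real t) (\<i> * of_real t)) =
        of_real (t powr ((2 * real N + 1) / 3 - 1)) * hankel_density t / (1 + log_powr (of_real (ln t) - w) (2 / 3))"
    if "t \<in> {0<..}" for t
  proof -
    have e: "(2 * real N + 1) / 3 - 1 = (2 * real N - 2) / 3" by (simp add: field_simps)
    have "t > 0" using that by simp
    from hankel_density_eq[OF this] show ?thesis unfolding e by (simp add: mult_ac)
  qed
  then show ?thesis unfolding aw_remainder_def
    by (intro arg_cong2[of _ _ _ _ "(*)"] refl set_lebesgue_integral_cong) auto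
qed

lemma set_integrable_remainder_integrand:
  assumes w: "\<bar>Im w\<bar> < 3 * pi / 2"
  shows "set_integrable lborel {0<..} (\<lambda>t. of_real (t powr ((2 * real N + 1) / 3 - 1)) * hankel_density t /
        (1 + log_powr (of_real (ln t) - w) (2 / 3)))"
proof (rule set_integrable_bound)
  let ?A = "\<lambda>t. of_real (t powr ((2 * real N + 1) / 3 - 1)) * hankel_density t"
  define d where "d = cos (\<bar>Im w\<bar> / 3)"
  note b = one_plus_log_powr_bound[OF order_refl w]
  have d: "d > 0" using b(2) by (simp add: d_def)
  show "set_integrable lborel {0<..} (\<lambda>t. of_real (1 / d) * (?A t))"
    by (intro set_integrable_mult_right hankel_density_moment(1))
  show "AE t in lborel. t \<in> {0<..} \<longrightarrow> norm (?A t /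
        (1 + log_powr (of_real (ln t) - w) (2 / 3))) \<le>
      norm (of_real (1 / d) * (?A t))"
  proof (intro AE_I2 impI)
    fix t :: real
    define A where "A = norm (?A t)"
    have "A / norm (1 + log_powr (of_real (ln t) - w) (2 / 3)) \<le> A / d"
      using b(1)[of "ln t"] d unfolding d_def[symmetric]
      by (intro divide_left_mono mult_pos_pos) (auto simp: A_def)
    then show "norm (?A t /
        (1 + log_powr (of_real (ln t) - w) (2 / 3))) \<le>
      norm (of_real (1 / d) * (?A t))"
      unfolding norm_divide A_def[symmetric] norm_mult[of "of_real (1 / d)"] norm_of_real using d by simp
  qed
qed (simp add: set_borel_measurable_def log_powr_def)

text \<open>With \<open>q = (t / \<nu>)^(2/3)\<close> one has
  \<open>q / (1 + q) = 1 - 1 / (1 + q)\<close> and \<open>\<nu>^(2/3) * q = t^(2/3)\<close>. So the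
  integral in the next remainder is \<open>\<nu>^(2/3)\<close> times the \<open>N\<close>-th moment
  minus the present integral.\<close>

lemma aw_remainder_step:
  assumes w: "\<bar>Im w\<bar> < 3 * pi / 2"
  shows "aw_remainder N w = 1 / (3 * of_real pi) * (of_real (aw_coeff N) * of_real (Gamma ((2 * real N + 1) / 3)) /
           log_powr w ((2 * real N + 1) / 3)) + aw_remainder (Suc N) w"
proof -
  define p where "p = (2 * real N + 1) / 3"
  define q where "q = (\<lambda>t. log_powr (of_real (ln t) - w) (2 / 3))"
  define F where "F = (\<lambda>t. of_real (t powr (p - 1)) * hankel_density t)"
  define I where "I = (LBINT t:{0<..}. F t / (1 + q t))"
  define J where "J = (LBINT t:{0<..}. of_real (t powr ((2 * real (Suc N) + 1) / 3 - 1)) * hankel_density t / (1 + q t))"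
  define E where "E = log_powr w (2 / 3)"
  have p': "(2 * real (Suc N) + 1) / 3 = p + 2 / 3" by (simp add: p_def field_simps)
  have E: "E \<noteq> 0" by (simp add: E_def)
  have int: "set_integrable lborel {0<..} (\<lambda>t. F t / (1 + q t))"
    unfolding F_def q_def p_def by (rule set_integrable_remainder_integrand[OF w])
  have intF: "set_integrable lborel {0<..} F" unfolding F_def p_def by (rule hankel_density_moment(1))
  have "J = (LBINT t:{0<..}. E * (F t - F t / (1 + q t)))"
    unfolding J_def
  proof (intro set_lebesgue_integral_cong allI impI)
    fix t :: real assume "t \<in> {0<..}"
    then have t: "t > 0" by simp
    have "(2 * real (Suc N) + 1) / 3 - 1 = (p - 1) + 2 / 3" unfolding p' by simp
    then have pw: "t powr ((2 * real (Suc N) + 1) / 3 - 1) = t powr (p - 1) * t powr (2 / 3)"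
      by (simp only: powr_add)
    have "E * q t = exp (of_real (2 / 3 * ln t))"
    proof -
      have "of_real (2 / 3) * w + of_real (2 / 3) * (of_real (ln t) - w) = complex_of_real (2 / 3 * ln t)"
        by (simp add: right_diff_distrib)
      then show ?thesis unfolding E_def q_def log_powr_def by (simp only: exp_add[symmetric])
    qed
    moreover have "t powr (2 / 3) = exp (2 / 3 * ln t)" using t by (simp add: powr_def)
    ultimately have Eq: "E * q t = of_real (t powr (2 / 3))" by (simp only: exp_of_real)
    have "norm (1 + q t) > 0" using one_plus_log_powr_bound(1)[OF order_refl w, of "ln t"] one_plus_log_powr_bound(2)[OF order_refl w] unfolding q_def by linarith
    then have nz: "1 + q t \<noteq> 0" by auto
    have "F t - F t / (1 + q t) = F t * q t / (1 + q t)"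
      using nz by (simp add: divide_simps) (simp add: algebra_simps)
    then have "E * (F t - F t / (1 + q t)) = F t * (E * q t) / (1 + q t)" by simp
    then show "of_real (t powr ((2 * real (Suc N) + 1) / 3 - 1)) * hankel_density t / (1 + q t) = E * (F t - F t / (1 + q t))"
      unfolding pw Eq F_def by (simp add: mult_ac)
  qed simp
  also have "\<dots> = E * ((LBINT t:{0<..}. F t) - I)"
    unfolding set_integral_mult_right I_def by (subst set_integral_diff(2)[OF intF int]) simp
  also have "(LBINT t:{0<..}. F t) = (- 1) ^ N * of_real (Gamma p) * of_real (aw_coeff N)"
    unfolding F_def p_def by (rule hankel_density_moment(2))
  finally have J: "J = E * ((- 1) ^ N * of_real (Gamma p) * of_real (aw_coeff N) - I)" .
  define L where "L = 3 * of_real pi * log_powr w p"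
  have L: "L \<noteq> 0" by (simp add: L_def)
  have "aw_remainder (Suc N) w = (- 1) ^ Suc N / (L * E) * J"
    unfolding aw_remainder_eq[of "Suc N"] J_def q_def L_def E_def p' log_powr_add by (simp add: mult.assoc)
  also have "\<dots> = - ((- 1) ^ N / L) * ((- 1) ^ N * of_real (Gamma p) * of_real (aw_coeff N) - I)"
    unfolding J using E by simp
  also have "\<dots> = (- 1) ^ N / L * I - (- 1) ^ N * ((- 1) ^ N * (of_real (Gamma p) * of_real (aw_coeff N) / L))"
    by (simp add: algebra_simps diff_divide_distrib)
  also have "\<dots> = (- 1) ^ N / L * I - of_real (Gamma p) * of_real (aw_coeff N) / L"
    by (simp flip: mult.assoc)
  also have "(- 1) ^ N / L * I = aw_remainder N w"
    unfolding aw_remainder_eq[of N] I_def F_def q_def L_def p_def ..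
  finally show ?thesis unfolding p_def[symmetric] L_def by (simp add: mult_ac)
qed

lemma aw_remainder_0_holomorphic: "aw_remainder 0 holomorphic_on {w. \<bar>Im w\<bar> < 3 * pi / 2}"
proof -
  define S where "S = {w. \<bar>Im w\<bar> < 3 * pi / 2}"
  have "(\<lambda>w. LBINT t:{0<..}. of_real (t powr ((2 * real 0 + 1) / 3 - 1)) * hankel_density t /
        (1 + log_powr (of_real (ln t) - w) (2 / 3))) holomorphic_on S"
  proof (rule holomorphic_on_set_lebesgue_integral)
    show "open S" unfolding S_def by (rule open_strip)
    show "(\<lambda>w. of_real (t powr ((2 * real 0 + 1) / 3 - 1)) * hankel_density t /
        (1 + log_powr (of_real (ln t) - w) (2 / 3))) holomorphic_on S" for t
    proof -
      have "1 + exp (of_real (2 / 3) * (of_real (ln t) - w)) \<noteq> 0" if "w \<in> S" for w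
      proof -
        have w: "\<bar>Im w\<bar> < 3 * pi / 2" using that by (simp add: S_def)
        have "norm (1 + log_powr (of_real (ln t) - w) (2 / 3)) > 0"
          using one_plus_log_powr_bound(1)[OF order_refl w, of "ln t"] one_plus_log_powr_bound(2)[OF order_refl w] by linarith
        then show ?thesis unfolding log_powr_def by (simp only: zero_less_norm_iff not_False_eq_True)
      qed
      then show ?thesis unfolding log_powr_def by (intro holomorphic_intros) auto
    qed
    fix w assume "w \<in> S"
    \<comment> \<open>A margin below \<open>3 * pi / 2\<close> makes the lower bound of the
      denominator uniform near \<open>w\<close>.\<close>
    then obtain c where c: "\<bar>Im w\<bar> < c" "c < 3 * pi / 2" unfolding S_def using dense by blast
    define d where "d = cos (c / 3)"
    define A where "A = (\<lambda>t. complex_of_real (t powr ((2 * real 0 + 1) / 3 - 1)) * hankel_density t)"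
    have d: "d > 0" using one_plus_log_powr_bound(2)[of w c] c by (simp add: d_def)
    have "norm (A t / (1 + log_powr (of_real (ln t) - u) (2 / 3))) \<le> norm (A t) / d" if "\<bar>Im u\<bar> < c" for u t
      unfolding norm_divide using one_plus_log_powr_bound(1)[of u c "ln t"] c that d unfolding d_def[symmetric]
      by (intro divide_left_mono mult_pos_pos) auto
    moreover have "set_integrable lborel {0<..} (\<lambda>t. norm (A t) / d)"
      unfolding A_def by (intro set_integrable_divide set_integrable_norm hankel_density_moment(1))
    ultimately show "\<exists>U g. open U \<and> w \<in> U \<and> set_integrable lborel {0<..} g \<and>
        (\<forall>u\<in>U \<inter> S. \<forall>t\<in>{0<..}. norm (complex_of_real (t powr ((2 * real 0 + 1) / 3 - 1)) * hankel_density t /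
        (1 + log_powr (of_real (ln t) - u) (2 / 3))) \<le> g t)"
      using c open_strip[of c]
      by (intro exI[of _ "{u. \<bar>Im u\<bar> < c}"] exI[of _ "\<lambda>t. norm (A t) / d"]) (auto simp: A_def)
  qed (simp add: set_borel_measurable_def log_powr_def)
  then show ?thesis
    unfolding S_def[symmetric] aw_remainder_eq[abs_def] unfolding log_powr_def[of _ "(2 * real 0 + 1) / 3"]
    by (intro holomorphic_intros) auto
qed

section \<open>Identification with the analytic continuation\<close>

lemma anger_weber_diag_integral:
  "anger_weber (- \<nu>) \<nu> = 1 / of_real pi * (LBINT t:{0<..}. exp (- (\<nu> * of_real (sinh t - t))))"
  unfolding anger_weber_def by (simp add: algebra_simps)

lemma set_integrable_exp_sinh:
  assumes d: "d > 0"
  shows "set_integrable lborel {0<..} (\<lambda>t::real. exp (- (d * (sinh t - t))))"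
proof (rule set_integrable_bound)
  show "set_integrable lborel {0<..} (\<lambda>t. of_real (exp (6 * d)) * exp (- (of_real d * complex_of_real t)))"
    using d by (intro set_integrable_mult_right exp_lebesgue_integral(1)) simp
  show "AE t in lborel. t \<in> {0<..} \<longrightarrow> norm (exp (- (d * (sinh t - t)))) \<le>
      norm (of_real (exp (6 * d)) * exp (- (of_real d * complex_of_real t)))"
  proof (intro AE_I2 impI)
    fix t :: real assume "t \<in> {0<..}"
    then have t: "t > 0" by simp
    \<comment> \<open>For \<open>t \<ge> 6\<close> this is \<open>sinh t \<ge> 2 * t\<close> with
      room to spare; for smaller \<open>t\<close> the left side is negative.\<close>
    have "t - 6 \<le> sinh t - t"
      using sinh_ge_double[of t] sinh_real_bounds(1)[OF t] by (cases "t \<ge> 6") linarith+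
    then have "d * (t - 6) \<le> d * (sinh t - t)" using d by simp
    then have "- (d * (sinh t - t)) \<le> 6 * d + - (d * t)" by (simp add: algebra_simps)
    then have "exp (- (d * (sinh t - t))) \<le> exp (6 * d) * exp (- (d * t))"
      unfolding exp_add[symmetric] by simp
    then show "norm (exp (- (d * (sinh t - t)))) \<le>
      norm (of_real (exp (6 * d)) * exp (- (of_real d * complex_of_real t)))"
      by (simp add: norm_mult)
  qed
qed (simp add: set_borel_measurable_def sinh_field_def)

lemma anger_weber_diag_holomorphic:
  "(\<lambda>u. anger_weber (- exp u) (exp u)) holomorphic_on {u. \<bar>Im u\<bar> < pi / 2}"
proof -
  have "(\<lambda>u. LBINT t:{0<..}. exp (- (exp u * of_real (sinh t - t)))) holomorphic_on {u. \<bar>Im u\<bar> < pi / 2}"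
  proof (rule holomorphic_on_set_lebesgue_integral[OF open_strip])
    fix z assume "z \<in> {u. \<bar>Im u\<bar> < pi / 2}"
    then have "Re (exp (1 * z)) > 0" by (simp add: Re_exp_pos)
    then obtain \<delta> U where \<delta>: "\<delta> > 0" and U: "open U" "z \<in> U" "\<And>v. v \<in> U \<Longrightarrow> Re (exp v) > \<delta>"
      using exp_halfplane_neighbourhood[of 1 z] by auto
    have "norm (exp (- (exp u * of_real (sinh t - t)))) \<le> exp (- (\<delta> * (sinh t - t)))" if "u \<in> U" "t > 0" for u t
    proof -
      have "\<delta> * (sinh t - t) \<le> Re (exp u) * (sinh t - t)"
        using U(3)[OF that(1)] sinh_real_bounds(1)[OF that(2)] by (intro mult_right_mono) auto
      moreover have "norm (exp (- (exp u * of_real (sinh t - t)))) = exp (- (Re (exp u) * (sinh t - t)))"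
        unfolding norm_exp_eq_Re by simp
      ultimately show ?thesis by simp
    qed
    then show "\<exists>U g. open U \<and> z \<in> U \<and> set_integrable lborel {0<..} g \<and>
        (\<forall>u\<in>U \<inter> {u. \<bar>Im u\<bar> < pi / 2}. \<forall>t\<in>{0<..}. norm (exp (- (exp u * of_real (sinh t - t)))) \<le> g t)"
      using U(1,2) set_integrable_exp_sinh[OF \<delta>]
      by (intro exI[of _ U] exI[of _ "\<lambda>t. exp (- (\<delta> * (sinh t - t)))"]) simp
  qed (auto simp: set_borel_measurable_def sinh_field_def intro!: holomorphic_intros)
  then show ?thesis unfolding anger_weber_diag_integral by (intro holomorphic_intros)
qed

lemma aw_remainder_0_of_real:
  "aw_remainder 0 (of_real x) = anger_weber (- exp (of_real x)) (exp (of_real x))"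
proof -
  define \<nu> where "\<nu> = exp x"
  have \<nu>: "\<nu> > 0" by (simp add: \<nu>_def)
  have q: "log_powr (of_real (ln t) - of_real x) (2 / 3) = of_real ((t / \<nu>) powr (2/3))" if "t > 0" for t
    using that by (simp add: log_powr_def powr_def \<nu>_def ln_div exp_of_real[symmetric])
  have "(LBINT t:{0<..}. of_real (t powr ((2 * real 0 + 1) / 3 - 1)) * hankel_density t /
        (1 + log_powr (of_real (ln t) - of_real x) (2 / 3))) =
      (LBINT t:{0<..}. of_real (t powr (-2/3) / (1 + (t / \<nu>) powr (2/3))) * hankel_density t)"
    by (intro set_lebesgue_integral_cong allI impI) (simp_all add: q)
  also have "\<dots> = of_real (3 * \<nu> powr (1/3)) * (LBINT T:{0<..}. of_real (exp (- \<nu> * (sinh T - T))))"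
    by (rule hankel_density_Stieltjes[OF \<nu>])
  also have "(LBINT T:{0<..}. complex_of_real (exp (- \<nu> * (sinh T - T)))) =
      (LBINT t:{0<..}. exp (- (of_real \<nu> * of_real (sinh t - t))))"
    by (simp add: exp_of_real[symmetric])
  finally have I: "(LBINT t:{0<..}. of_real (t powr ((2 * real 0 + 1) / 3 - 1)) * hankel_density t /
        (1 + log_powr (of_real (ln t) - of_real x) (2 / 3))) =
      of_real (3 * \<nu> powr (1/3)) * (LBINT t:{0<..}. exp (- (of_real \<nu> * of_real (sinh t - t))))" .
  have l: "log_powr (of_real x) ((2 * real 0 + 1) / 3) = of_real (\<nu> powr (1/3))"
    by (simp add: log_powr_def powr_def \<nu>_def exp_of_real[symmetric])
  have "\<nu> powr (1/3) \<noteq> 0" using \<nu> by simp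
  then show ?thesis
    unfolding aw_remainder_eq I l anger_weber_diag_integral exp_of_real \<nu>_def[symmetric] by simp
qed

text \<open>\<open>R_0\<close> is a continuation to the full sector: it agrees with the integral for
  positive \<open>\<nu>\<close>, hence on the right half-plane. Any other admissible continuation
  agrees with it on the real axis, which makes the description denote.\<close>

lemma anger_weber_diag_eq:
  assumes w: "\<bar>Im w\<bar> < 3 * pi / 2"
  shows "anger_weber_diag w = aw_remainder 0 w"
proof -
  have small: "aw_remainder 0 u = anger_weber (- exp u) (exp u)" if "\<bar>Im u\<bar> < pi / 2" for u
  proof (rule holomorphic_strip_eqI[where F = "aw_remainder 0" and G = "\<lambda>u. anger_weber (- exp u) (exp u)" and c = "pi / 2" and w = u])
    show "aw_remainder 0 holomorphic_on {u. \<bar>Im u\<bar> < pi / 2}"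
      by (rule holomorphic_on_subset[OF aw_remainder_0_holomorphic]) auto
  qed (rule anger_weber_diag_holomorphic aw_remainder_0_of_real that)+
  show ?thesis
    unfolding anger_weber_diag_def log_continuation_def
  proof (rule the_equality)
    show "\<exists>c F. pi / 2 \<le> c \<and> \<bar>Im w\<bar> < c \<and> F holomorphic_on {u. \<bar>Im u\<bar> < c} \<and>
        (\<forall>u. \<bar>Im u\<bar> < pi / 2 \<longrightarrow> F u = anger_weber (- exp u) (exp u)) \<and> aw_remainder 0 w = F w"
      using w small aw_remainder_0_holomorphic by (intro exI[of _ "3 * pi / 2"] exI[of _ "aw_remainder 0"]) auto
    fix v assume "\<exists>c F. pi / 2 \<le> c \<and> \<bar>Im w\<bar> < c \<and> F holomorphic_on {u. \<bar>Im u\<bar> < c} \<and>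
        (\<forall>u. \<bar>Im u\<bar> < pi / 2 \<longrightarrow> F u = anger_weber (- exp u) (exp u)) \<and> v = F w"
    then obtain c F where c: "\<bar>Im w\<bar> < c" and F: "F holomorphic_on {u. \<bar>Im u\<bar> < c}"
      "\<And>u. \<bar>Im u\<bar> < pi / 2 \<Longrightarrow> F u = anger_weber (- exp u) (exp u)" and v: "v = F w" by blast
    \<comment> \<open>The competitor lives on a strip of its own width \<open>c\<close>; the
      comparison takes place on the narrower of the two strips, which still contains
      \<open>w\<close>.\<close>
    define d where "d = min c (3 * pi / 2)"
    have "F w = aw_remainder 0 w"
    proof (rule holomorphic_strip_eqI[where F = F and G = "aw_remainder 0" and c = d and w = w])
      show "F holomorphic_on {u. \<bar>Im u\<bar> < d}" "aw_remainder 0 holomorphic_on {u. \<bar>Im u\<bar> < d}"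
        by (rule holomorphic_on_subset[OF F(1)] holomorphic_on_subset[OF aw_remainder_0_holomorphic], force simp: d_def)+
      show "F (of_real x) = aw_remainder 0 (of_real x)" for x
        using F(2)[of "of_real x"] small[of "of_real x"] by simp
      show "\<bar>Im w\<bar> < d" using c w by (simp add: d_def)
    qed
    then show "v = aw_remainder 0 w" by (simp add: v)
  qed
qed

theorem theorem1p2:
  shows "(\<forall>(N::nat) (w::complex). - (3 * pi / 2) < Im w \<and> Im w < 3 * pi / 2 \<longrightarrow>
            anger_weber_diag w =
              1 / (3 * of_real pi) *
              (\<Sum>n<N. of_real (aw_coeff n) * of_real (Gamma ((2 * real n + 1) / 3)) /
                     log_powr w ((2 * real n + 1) / 3))
              + aw_remainder N w) \<and>
         (\<forall>n::nat. complex_of_real (aw_coeff n) =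
            (-1) ^ n / of_real (Gamma ((2 * real n + 1) / 3)) *
            (LINT t:{0<..}|lborel.
               of_real (t powr ((2 * real n - 2) / 3) * exp (- 2 * pi * t)) *
               (\<i> * hankel_H1 (\<i> * of_real t) (\<i> * of_real t))))"
proof (intro conjI allI impI)
  fix N :: nat and w :: complex
  assume "- (3 * pi / 2) < Im w \<and> Im w < 3 * pi / 2"
  then have w: "\<bar>Im w\<bar> < 3 * pi / 2" by linarith
  show "anger_weber_diag w =
              1 / (3 * of_real pi) *
              (\<Sum>n<N. of_real (aw_coeff n) * of_real (Gamma ((2 * real n + 1) / 3)) /
                     log_powr w ((2 * real n + 1) / 3))
              + aw_remainder N w"
  \<comment> \<open>For \<open>N = 0\<close> the sum is empty and the claim is that
    \<open>R_0\<close> is the continuation; each step splits the next term off the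
    remainder.\<close>
  proof (induction N)
    case (Suc N)
    then show ?case
      unfolding sum.lessThan_Suc distrib_left using aw_remainder_step[OF w, of N] by (simp only: add.assoc)
  qed (simp add: anger_weber_diag_eq[OF w])
next
  fix n :: nat
  let ?I = "LINT t:{0<..}|lborel. of_real (t powr ((2 * real n - 2) / 3) * exp (- 2 * pi * t)) *
               (\<i> * hankel_H1 (\<i> * of_real t) (\<i> * of_real t))"
  define p where "p = (2 * real n + 1) / 3"
  define G where "G = Gamma p"
  have "p > 0" by (simp add: p_def)
  then have G: "G > 0" unfolding G_def by (rule Gamma_real_pos)
  have "?I =
      (LINT t:{0<..}|lborel. of_real (t powr (p - 1)) * hankel_density t)"
  proof (intro set_lebesgue_integral_cong allI impI)
    fix t :: real assume "t \<in> {0<..}"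
    then have "t > 0" by simp
    moreover have "(2 * real n - 2) / 3 = p - 1" by (simp add: p_def field_simps)
    ultimately show "of_real (t powr ((2 * real n - 2) / 3) * exp (- 2 * pi * t)) *
               (\<i> * hankel_H1 (\<i> * of_real t) (\<i> * of_real t)) = of_real (t powr (p - 1)) * hankel_density t"
      using hankel_density_eq[of t] by (simp only: of_real_mult mult.assoc)
  qed simp
  also have "\<dots> = (- 1) ^ n * of_real G * of_real (aw_coeff n)"
    unfolding p_def G_def by (rule hankel_density_moment(2))
  finally have I: "?I = (- 1) ^ n * of_real G * of_real (aw_coeff n)" .
  have "(- 1) ^ n / of_real G * ((- 1) ^ n * of_real G * c) = c" for c :: complex
    using G by (simp flip: mult.assoc)
  then show "complex_of_real (aw_coeff n) =
            (-1) ^ n / of_real (Gamma ((2 * real n + 1) / 3)) *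
            ?I"
    unfolding I p_def[symmetric] G_def[symmetric] by simp
qed

end
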